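(* Let $X$ be a downward skip-free continuous-time Markov chain on $\mathbb{N}$ satisfying the standing assumptions of the context, and suppose $\mathbb{P}_x[\tau_0<\infty]=1$ for all $x\ge0$. Then $$\lambda_0=\max\{\lambda\ge0: W^{(-\lambda)}(0,x)>0\text{ for every }x>0\}.$$
   Context: $\mathbb{N}=\{0,1,2,\dots\}$. $(\{X_t\}_{t\ge0},\{\mathbb{P}_x\}_{x\in\mathbb{N}})$ is a continuous-time Markov chain on $\mathbb{N}$ with càdlàg paths, whose $Q$-matrix $Q=(Q(x,y))_{x,y\ge0}$ is conservative ($\sum_{y}Q(x,y)=0$ for all $x$), killed at its explosion time $\lim_{z\to\infty}\tau_z^+$. For $A\subset\mathbb{N}$, $\tau_A:=\inf\{t>0: X_t\in A\}$ (with $\inf\emptyset=\infty$), $\tau_x:=\tau_{\{x\}}$, $\tau_z^+:=\tau_{[z,\infty)\cap\mathbb{N}}$; $Q(x):=-Q(x,x)$. $\mathbb{E}_x[Y,A]$ means $\mathbb{E}_x[Y1_A]$. Standing assumptions: $X$ is downward skip-free, i.e. $Q(x,y)=0$ for $0\le y\le x-2$; $X$ is irreducible on $\mathbb{N}\setminus\{0\}$: $\mathbb{P}_x[\tau_y<\infty]>0$ for $x\ge1$, $y\ge0$; $X$ is regular on $\mathbb{N}\setminus\{0\}$: $\mathbb{P}_x[\tau_{\mathbb{N}\setminus\{x\}}>0]=1$ for $x\ge1$; and $0$ is a trap: $\mathbb{P}_0[X_t=0]=1$ for all $t$. Scale function: for $z\ge1$, $n_z$ is $Q(z)$ times the law under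 $\mathbb{P}_z$ of the path of $X$ after its first exit time from $z$, stopped upon returning to $z$. Thus, writing $\sigma_z:=\tau_{\mathbb{N}\setminus\{z\}}$ and $R_z:=\inf\{t>\sigma_z:X_t=z\}$, for $x<z$, $n_z[e^{-q\tau_x},\tau_x<\infty]=Q(z)\,\mathbb{E}_z[e^{-q(\tau_x-\sigma_z)},\ \tau_x<R_z]$. For $q\ge0$, $W^{(q)}(x,z):=1/n_z[e^{-q\tau_x},\tau_x<\infty]$ for $0\le x<z$ and $W^{(q)}(x,z):=0$ for $x\ge z$; $W:=W^{(0)}$. For fixed $x,y$, $q\mapsto W^{(q)}(x,y)$ is a polynomial, $W^{(q)}(x,y)=\sum_{n\ge0}q^nW^{n+1}(x,y)$ ($W^n$ = matrix power, finite sum), and this formula defines $W^{(q)}(x,y)$ for all $q\in\mathbb{C}$. Decay parameter: $\lambda_0:=\sup\{\lambda\ge0:\mathbb{E}_x[e^{\lambda\tau_0}]<\infty\text{ for some }x\ge1\}$. *)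

theory Defs
  imports "HOL-Probability.Probability"
begin

text \<open>
  A path is \<open>\<lambda>t. X t w\<close> for \<open>t \<ge> 0\<close>. The value \<open>Some x\<close> means that the chain sits in \<open>x\<close>,
  the value \<open>None\<close> that it has been killed; \<open>None\<close> is not a state.
  Times are extended reals, so that the infimum of the empty set of times is \<open>\<infinity>\<close>.
\<close>

definition hit :: "(real \<Rightarrow> 'w \<Rightarrow> nat option) \<Rightarrow> nat set \<Rightarrow> 'w \<Rightarrow> ereal" where
  "hit X A w = Inf (ereal ` {t. 0 < t \<and> X t w \<in> Some ` A})"

text \<open>The times \<open>hit X {z..}\<close> increase with \<open>z\<close>, so their limit is their supremum.\<close>

definition explosion_time :: "(real \<Rightarrow> 'w \<Rightarrow> nat option) \<Rightarrow> 'w \<Rightarrow> ereal" where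
  "explosion_time X w = (SUP z. hit X {z..} w)"

definition exit_time :: "(real \<Rightarrow> 'w \<Rightarrow> nat option) \<Rightarrow> nat \<Rightarrow> 'w \<Rightarrow> ereal" where
  "exit_time X z = hit X (UNIV - {z})"

definition return_time :: "(real \<Rightarrow> 'w \<Rightarrow> nat option) \<Rightarrow> nat \<Rightarrow> 'w \<Rightarrow> ereal" where
  "return_time X z w = Inf (ereal ` {t. exit_time X z w < ereal t \<and> X t w = Some z})"

definition past_sets :: "'w measure \<Rightarrow> (real \<Rightarrow> 'w \<Rightarrow> nat option) \<Rightarrow> real \<Rightarrow> 'w set set" where
  "past_sets M X s = sigma_sets (space M) {X u -` B \<inter> space M | u B. 0 \<le> u \<and> u \<le> s}"

text \<open>
  Since the state space is discrete, right continuity and existence of left limits in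
  \<open>\<nat>\<close> say that a path is constant on a right (punctured left) neighbourhood of each time.
  They are required before the explosion time only: a path killed at a finite time
  tends to infinity there. In \<open>Q_matrix\<close>, \<open>of_bool (x = y)\<close> is the transition
  probability at time zero.
\<close>

locale killed_markov_chain =
  fixes M :: "'w measure"
    and P :: "nat \<Rightarrow> 'w measure"
    and X :: "real \<Rightarrow> 'w \<Rightarrow> nat option"
    and Q :: "nat \<Rightarrow> nat \<Rightarrow> real"
  assumes prob_space_P: "\<And>x. prob_space (P x)"
    and sets_P: "\<And>x. sets (P x) = sets M"
    and measurable_X: "\<And>t. 0 \<le> t \<Longrightarrow> X t \<in> M \<rightarrow>\<^sub>M count_space UNIV"
    and start: "\<And>x. AE w in P x. X 0 w = Some x"
    and right_continuous: "\<And>w t. \<lbrakk>w \<in> space M; 0 \<le> t; ereal t < explosion_time X w\<rbrakk>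
          \<Longrightarrow> \<forall>\<^sub>F s in at_right t. X s w = X t w"
    and left_limits: "\<And>w t. \<lbrakk>w \<in> space M; 0 < t; ereal t < explosion_time X w\<rbrakk>
          \<Longrightarrow> \<exists>y. \<forall>\<^sub>F s in at_left t. X s w = Some y"
    and killed_at_explosion: "\<And>w t. \<lbrakk>w \<in> space M; 0 \<le> t\<rbrakk>
          \<Longrightarrow> X t w = None \<longleftrightarrow> explosion_time X w \<le> ereal t"
    and Markov: "\<And>x y z s t A. \<lbrakk>0 \<le> s; 0 \<le> t; A \<in> past_sets M X s\<rbrakk> \<Longrightarrow>
          measure (P x) {w \<in> A. X s w = Some y \<and> X (s + t) w = Some z} =
          measure (P x) {w \<in> A. X s w = Some y} * measure (P y) {w \<in> space M. X t w = Some z}"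
    and Q_matrix: "\<And>x y.
          ((\<lambda>t. (measure (P x) {w \<in> space M. X t w = Some y} - of_bool (x = y)) / t) \<longlongrightarrow> Q x y)
            (at_right 0)"
    and conservative: "\<And>x. Q x sums 0"

locale downward_skip_free_chain = killed_markov_chain M P X Q
  for M :: "'w measure"
    and P :: "nat \<Rightarrow> 'w measure"
    and X :: "real \<Rightarrow> 'w \<Rightarrow> nat option"
    and Q :: "nat \<Rightarrow> nat \<Rightarrow> real" +
  assumes skip_free: "\<And>x y. y + 2 \<le> x \<Longrightarrow> Q x y = 0"
    and irreducible: "\<And>x y. 1 \<le> x \<Longrightarrow> 0 < measure (P x) {w \<in> space M. hit X {y} w < \<infinity>}"
    and regular: "\<And>x. 1 \<le> x \<Longrightarrow> AE w in P x. 0 < hit X (UNIV - {x}) w"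
    and trap: "\<And>t. 0 \<le> t \<Longrightarrow> AE w in P 0. X t w = Some 0"

text \<open>
  For \<open>x < z\<close> and \<open>q \<ge> 0\<close> this is the integral of \<open>exp (- q \<tau>\<^sub>x)\<close> over \<open>\<tau>\<^sub>x < \<infinity>\<close> with respect to
  the excursion measure \<open>n\<^sub>z\<close>: paths under \<open>P z\<close> are shifted by the exit time of \<open>z\<close>, stopped on
  returning to \<open>z\<close>, and weighted by the exit rate of \<open>z\<close>.
\<close>

definition excursion_laplace ::
  "(nat \<Rightarrow> 'w measure) \<Rightarrow> (real \<Rightarrow> 'w \<Rightarrow> nat option) \<Rightarrow> (nat \<Rightarrow> nat \<Rightarrow> real)
    \<Rightarrow> real \<Rightarrow> nat \<Rightarrow> nat \<Rightarrow> real" where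
  "excursion_laplace P X Q q z x =
     (- Q z z) * (LINT w|P z. indicator {w. hit X {x} w < return_time X z w} w *
                    exp (- q * real_of_ereal (hit X {x} w - exit_time X z w)))"

definition excursion_scale ::
  "(nat \<Rightarrow> 'w measure) \<Rightarrow> (real \<Rightarrow> 'w \<Rightarrow> nat option) \<Rightarrow> (nat \<Rightarrow> nat \<Rightarrow> real)
    \<Rightarrow> real \<Rightarrow> nat \<Rightarrow> nat \<Rightarrow> real" where
  "excursion_scale P X Q q x z = (if x < z then 1 / excursion_laplace P X Q q z x else 0)"

text \<open>
  Powers of a strictly upper triangular matrix; in the product \<open>A\<^sup>n A\<close> the terms with
  \<open>z \<ge> y\<close> vanish because \<open>A z y = 0\<close>.
\<close>

primrec mat_power :: "(nat \<Rightarrow> nat \<Rightarrow> real) \<Rightarrow> nat \<Rightarrow> nat \<Rightarrow> nat \<Rightarrow> real" where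
  "mat_power A 0 x y = of_bool (x = y)"
| "mat_power A (Suc n) x y = (\<Sum>z<y. mat_power A n x z * A z y)"

text \<open>
  The scale function \<open>W\<^sup>(\<^sup>q\<^sup>)\<close> for every real or complex \<open>q\<close>, as a power series in \<open>q\<close> with
  matrix powers of \<open>W = W\<^sup>(\<^sup>0\<^sup>)\<close> as coefficients. Only the terms with \<open>n < y\<close> are nonzero,
  so the series is a polynomial in \<open>q\<close>. For \<open>q > 0\<close> it equals \<open>excursion_scale P X Q q x y\<close>,
  which is a theorem and not part of the definition.
\<close>

definition scale_function ::
  "(nat \<Rightarrow> 'w measure) \<Rightarrow> (real \<Rightarrow> 'w \<Rightarrow> nat option) \<Rightarrow> (nat \<Rightarrow> nat \<Rightarrow> real)
    \<Rightarrow> 'q::real_normed_field \<Rightarrow> nat \<Rightarrow> nat \<Rightarrow> 'q" where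
  "scale_function P X Q q x y =
     (\<Sum>n. q ^ n * of_real (mat_power (excursion_scale P X Q 0) (Suc n) x y))"

text \<open>With \<open>0 * \<infinity> = 0\<close> in the extended reals, \<open>exp (\<lambda> \<tau>)\<close> is \<open>1\<close> for \<open>\<lambda> = 0\<close>, also where \<open>\<tau> = \<infinity>\<close>.\<close>

definition exp_ereal :: "ereal \<Rightarrow> ennreal" where
  "exp_ereal u =
     (if u = \<infinity> then \<infinity> else if u = - \<infinity> then 0 else ennreal (exp (real_of_ereal u)))"

definition decay_parameter ::
  "(nat \<Rightarrow> 'w measure) \<Rightarrow> (real \<Rightarrow> 'w \<Rightarrow> nat option) \<Rightarrow> ereal" where
  "decay_parameter P X =
     Sup (ereal ` {l. 0 \<le> l \<and> (\<exists>x\<ge>1. (\<integral>\<^sup>+ w. exp_ereal (ereal l * hit X {0} w) \<partial>P x) < \<infinity>)})"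

end

theory Submission
  imports Defs
begin

text \<open>
  Sample the chain on the grids \<open>h \<nat>\<close> with \<open>h \<rightarrow> 0\<close>. Events of the form
  ``stay in \<open>z\<close>, then in a finite set \<open>D\<close>, then reach \<open>a\<close>'' are limits of the same events for the
  sampled chain, and the one-step equations of the latter, divided by \<open>h\<close>, become linear equations
  for \<open>Q\<close>. Since downward jumps have size one, they say that \<open>W\<close> is the inverse of \<open>Q\<close> with its
  rows shifted by one. Hence \<open>(Q - q) W\<^sup>(\<^sup>q\<^sup>) = I\<close> on the rows \<open>y \<ge> 1\<close> and \<open>W\<^sup>(\<^sup>q\<^sup>) (Q - q) = I\<close>.

  Let \<open>S\<close> be the set of \<open>\<lambda> \<ge> 0\<close> with \<open>W\<^sup>(\<^sup>-\<^sup>\<lambda>\<^sup>)(0, x) > 0\<close> for all \<open>x > 0\<close>. If \<open>\<lambda> \<in> S\<close>, then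
  \<open>W\<^sup>(\<^sup>-\<^sup>\<lambda>\<^sup>)(0, \<cdot>)\<close> is a positive left eigenvector of \<open>Q\<close>. It bounds the probability that the sampled
  chain stays in \<open>{1..<n}\<close> up to time \<open>t\<close> and then jumps to \<open>0\<close>, uniformly in \<open>n\<close>, so that the tail
  of \<open>\<tau>\<^sub>0\<close> decays at every exponential rate below \<open>\<lambda>\<close>. Conversely, if \<open>\<tau>\<^sub>0\<close> has a finite exponential
  moment of order \<open>\<lambda>\<close>, then \<open>g(y) = E\<^sub>y[exp (\<lambda> \<tau>\<^sub>0)]\<close> is positive with \<open>Q g \<le> - \<lambda> g\<close>, and comparing
  the right eigenvectors \<open>W\<^sup>(\<^sup>-\<^sup>\<lambda>\<^sup>)(\<cdot>, x)\<close> with \<open>g\<close> at the minimum of the quotient shows \<open>\<lambda> \<in> S\<close>. The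
  same comparison with a pointwise limit of \<open>g / g(1)\<close> as \<open>\<lambda>\<close> increases to \<open>sup S\<close> gives \<open>sup S \<in> S\<close>.
\<close>

section \<open>Paths of a right continuous process in discrete space\<close>

text \<open>The axioms give the Markov property at fixed times only; nothing is known beforehand
  about hitting times, holding times or the law of the jumps. Sampling turns questions about them
  into fixed-time questions. Rates may be unbounded, and the lemmas on the chain also allow
  explosion, so no limit is exchanged with an infinite sum over states: generator sums are finite,
  and where mass is discarded only an inequality is left. Such inequalities suffice because
  off-diagonal rates are nonnegative and the test functions are nonnegative.

  Two obstacles remain. The entries of a column of \<open>W\<close> belong to passages with
  different targets. The strong Markov property would relate them; here the relation comes from the
  linear equations and skip-freeness (\<open>pass_prob_factor\<close>). The quotients
  \<open>g / g(1)\<close> stay bounded, uniformly in the rate, by a Harnack inequality coming from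
  irreducibility, and so they have a limit along a subsequence.\<close>

definition right_constant :: "(real \<Rightarrow> 'a) \<Rightarrow> bool" where
  "right_constant f \<longleftrightarrow> (\<forall>t\<ge>0. \<exists>d>0. \<forall>s. t \<le> s \<and> s < t + d \<longrightarrow> f s = f t)"

lemma right_constantD:
  assumes "right_constant f" "0 \<le> t"
  shows "\<exists>d>0. \<forall>s. t \<le> s \<and> s < t + d \<longrightarrow> f s = f t"
  using assms unfolding right_constant_def by simp

text \<open>Right constancy makes the infimum of the times spent in \<open>B\<close> itself such a
  time.\<close>

lemma first_time:
  assumes rc: "right_constant f" and ab: "0 \<le> a" "a \<le> b" and b: "f b \<in> B"
  shows "\<exists>r. a \<le> r \<and> r \<le> b \<and> f r \<in> B \<and> (\<forall>s. a \<le> s \<and> s < r \<longrightarrow> f s \<notin> B)"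
proof -
  define S where "S = {s. a \<le> s \<and> f s \<in> B}"
  define r where "r = Inf S"
  have bdd: "bdd_below S" unfolding S_def by (auto intro: bdd_belowI)
  have bS: "b \<in> S" using ab b by (auto simp: S_def)
  have ar: "a \<le> r" unfolding r_def using bS by (intro cInf_greatest) (auto simp: S_def)
  have rb: "r \<le> b" unfolding r_def by (rule cInf_lower[OF bS bdd])
  have r0: "0 \<le> r" using ar ab by simp
  obtain d where d: "d > 0" "\<And>s. r \<le> s \<Longrightarrow> s < r + d \<Longrightarrow> f s = f r"
    using right_constantD[OF rc r0] by blast
  obtain s where s: "s \<in> S" "s < r + d"
    using cInf_lessD[of S "r + d"] bS d(1) by (auto simp: r_def)
  have "r \<le> s" unfolding r_def by (rule cInf_lower[OF s(1) bdd])
  then have "f r \<in> B" using d(2)[of s] s by (auto simp: S_def)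
  moreover have "f s \<notin> B" if "a \<le> s" "s < r" for s
    using that cInf_lower[of s S, OF _ bdd] by (force simp: S_def r_def)
  ultimately show ?thesis using ar rb by blast
qed

text \<open>Applied with \<open>r\<close> an exit or arrival time: once \<open>h\<close> is below
  the length of the constancy interval starting at \<open>r\<close>, the first grid point from
  \<open>r\<close> on still shows the value at \<open>r\<close>.\<close>

lemma first_grid_point:
  fixes h r :: real
  assumes "0 < h" "0 \<le> r"
  shows "\<exists>k::nat. r \<le> real k * h \<and> real k * h < r + h \<and> (\<forall>j<k. real j * h < r)"
proof -
  define k where "k = nat \<lceil>r / h\<rceil>"
  have k0: "0 \<le> \<lceil>r / h\<rceil>" using assms by (metis ceiling_mono ceiling_zero divide_nonneg_pos)
  have k: "real k = of_int \<lceil>r / h\<rceil>" using k0 by (simp add: k_def)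
  have "r / h \<le> real k" "real k < r / h + 1" unfolding k by linarith+
  then have 1: "r \<le> real k * h" "real k * h < r + h" using assms by (auto simp: field_simps)
  have "real j * h < r" if "j < k" for j
  proof -
    have "real j + 1 \<le> real k" using that by linarith
    then have "(real j + 1) * h \<le> real k * h" using assms by (intro mult_right_mono) auto
    then show ?thesis using 1(2) by (simp add: algebra_simps)
  qed
  then show ?thesis using 1 by blast
qed

text \<open>As a regular expression: the path spells \<open>z\<^sup>* D\<^sup>* a\<close>; both initial stretches may be empty.\<close>

definition passes :: "'a \<Rightarrow> 'a set \<Rightarrow> 'a \<Rightarrow> (real \<Rightarrow> 'a) \<Rightarrow> bool" where
  "passes z D a f \<longleftrightarrow> (\<exists>u t. 0 \<le> u \<and> u \<le> t \<and> (\<forall>s. 0 \<le> s \<and> s < u \<longrightarrow> f s = z) \<and>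
     (\<forall>s. u \<le> s \<and> s < t \<longrightarrow> f s \<in> D) \<and> f t = a)"

definition passes_grid :: "real \<Rightarrow> 'a \<Rightarrow> 'a set \<Rightarrow> 'a \<Rightarrow> (real \<Rightarrow> 'a) \<Rightarrow> bool" where
  "passes_grid h z D a f \<longleftrightarrow> (\<exists>i k::nat. i \<le> k \<and> (\<forall>j<i. f (real j * h) = z) \<and>
     (\<forall>j. i \<le> j \<and> j < k \<longrightarrow> f (real j * h) \<in> D) \<and> f (real k * h) = a)"

text \<open>Round \<open>u\<close> and \<open>t\<close> up to the grid; \<open>h\<close> only has to
  be shorter than the stay in \<open>a\<close> that begins at \<open>t\<close>.\<close>

lemma passes_grid_if_passes:
  assumes rc: "right_constant f" and A: "passes z D a f"
  shows "\<exists>d>0. \<forall>h. 0 < h \<and> h < d \<longrightarrow> passes_grid h z D a f"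
proof -
  from A obtain u t where ut: "0 \<le> u" "u \<le> t" and uz: "\<And>s. 0 \<le> s \<Longrightarrow> s < u \<Longrightarrow> f s = z"
    and uD: "\<And>s. u \<le> s \<Longrightarrow> s < t \<Longrightarrow> f s \<in> D" and ft: "f t = a"
    unfolding passes_def by blast
  have t0: "0 \<le> t" using ut by simp
  obtain d where d: "d > 0" "\<And>s. t \<le> s \<Longrightarrow> s < t + d \<Longrightarrow> f s = f t"
    using right_constantD[OF rc t0] by blast
  have "passes_grid h z D a f" if h: "0 < h" "h < d" for h
  proof -
    obtain i :: nat where i: "u \<le> real i * h" "real i * h < u + h" "\<And>j. j < i \<Longrightarrow> real j * h < u"
      using first_grid_point[OF h(1) ut(1)] by blast
    obtain k :: nat where k: "t \<le> real k * h" "real k * h < t + h" "\<And>j. j < k \<Longrightarrow> real j * h < t"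
      using first_grid_point[OF h(1) t0] by blast
    have "i \<le> k" using i(3)[of k] k(1) ut by (meson leD le_less_linear order_trans)
    moreover have "\<forall>j<i. f (real j * h) = z" using uz i(3) h by simp
    moreover have "f (real j * h) \<in> D" if "i \<le> j" "j < k" for j
    proof (rule uD)
      have "real i * h \<le> real j * h" using that h by (intro mult_right_mono) auto
      then show "u \<le> real j * h" using i(1) by simp
    qed (use k(3) that in auto)
    moreover have "f (real k * h) = a" using d(2)[of "real k * h"] k h ft by simp
    ultimately show ?thesis unfolding passes_grid_def by blast
  qed
  then show ?thesis using d(1) by blast
qed

text \<open>A coarse grid can miss a short visit to a forbidden state. Only two visits matter: the
  one that ends the stay in \<open>z\<close> (at \<open>u\<close>) and the one that ends the
  following stay in \<open>D\<close> (at \<open>r\<close>). A mesh shorter than both of them detects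
  the violation.\<close>

lemma not_passes_grid_if_not_passes:
  assumes rc: "right_constant f" and ne: "z \<notin> D" "a \<notin> D" "a \<noteq> z" and A: "\<not> passes z D a f"
  shows "\<exists>d>0. \<forall>h. 0 < h \<and> h < d \<longrightarrow> \<not> passes_grid h z D a f"
proof (cases "\<exists>b\<ge>0. f b \<noteq> z")
  case False
  then have "\<not> passes_grid h z D a f" if "0 < h" for h
    unfolding passes_grid_def using that ne by auto
  then show ?thesis by (intro exI[of _ 1]) auto
next
  case True
  then obtain b where b: "0 \<le> b" "f b \<in> - {z}" by auto
  obtain u where u: "0 \<le> u" "f u \<noteq> z" "\<And>s. 0 \<le> s \<Longrightarrow> s < u \<Longrightarrow> f s = z"
    using first_time[OF rc order_refl b] by blast
  obtain d where d: "d > 0" "\<And>s. u \<le> s \<Longrightarrow> s < u + d \<Longrightarrow> f s = f u"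
    using right_constantD[OF rc u(1)] by blast
  \<comment> \<open>The first grid point from \<open>u\<close> on shows \<open>f u\<close>, which is
    not \<open>z\<close>, so it lies behind the initial stretch. It is not the final point either,
    since \<open>f u = a\<close> would make the path itself pass at time \<open>u\<close>.\<close>
  have start: "\<exists>l. u \<le> real l * h \<and> i \<le> l \<and> l < k \<and> f u \<in> D"
    if h: "0 < h" "h < d" and ik: "\<And>j. j < i \<Longrightarrow> f (real j * h) = z"
      "\<And>j. i \<le> j \<Longrightarrow> j < k \<Longrightarrow> f (real j * h) \<in> D" "f (real k * h) = a" for h :: real and i k :: nat
  proof -
    obtain l :: nat where l: "u \<le> real l * h" "real l * h < u + h" "\<And>j. j < l \<Longrightarrow> real j * h < u"
      using first_grid_point[OF h(1) u(1)] by blast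
    have fl: "f (real l * h) = f u" using l(1,2) h by (intro d(2)) auto
    have "i \<le> l" using ik(1)[of l] fl u(2) not_le by metis
    have "\<not> k < l" using l(3)[of k] u(3)[of "real k * h"] ik(3) ne(3) h(1) by fastforce
    moreover have "l \<noteq> k"
    proof
      assume "l = k"
      then have "f u = a" using fl ik(3) by simp
      then have "passes z D a f" unfolding passes_def using u by (intro exI[of _ u]) auto
      then show False using A by simp
    qed
    ultimately have "l < k" by simp
    then have "f u \<in> D" using ik(2)[of l] \<open>i \<le> l\<close> fl by simp
    then show ?thesis using l \<open>i \<le> l\<close> \<open>l < k\<close> by blast
  qed
  show ?thesis
  proof (cases "\<exists>b\<ge>u. f b \<notin> D")
    case False
    have "\<not> passes_grid h z D a f" if h: "0 < h" "h < d" for h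
    proof
      assume "passes_grid h z D a f"
      then obtain i k :: nat where ik: "\<And>j. j < i \<Longrightarrow> f (real j * h) = z"
          "\<And>j. i \<le> j \<Longrightarrow> j < k \<Longrightarrow> f (real j * h) \<in> D" "f (real k * h) = a"
        unfolding passes_grid_def by blast
      obtain l where l: "u \<le> real l * h" "l < k" using start[OF h ik] by blast
      have "real l * h \<le> real k * h" using l h by (intro mult_right_mono) auto
      then show False using False l ik(3) ne by auto
    qed
    then show ?thesis using d(1) by blast
  next
    case True
    then obtain b where b: "u \<le> b" "f b \<in> - D" by auto
    obtain r where r: "u \<le> r" "f r \<notin> D" "\<And>s. u \<le> s \<Longrightarrow> s < r \<Longrightarrow> f s \<in> D"
      using first_time[OF rc u(1) b] by blast
    have r0: "0 \<le> r" using r u by simp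
    obtain d' where d': "d' > 0" "\<And>s. r \<le> s \<Longrightarrow> s < r + d' \<Longrightarrow> f s = f r"
      using right_constantD[OF rc r0] by blast
    have fr: "f r \<noteq> a"
    proof
      assume "f r = a"
      then have "passes z D a f" unfolding passes_def using u r by (intro exI[of _ u] exI[of _ r]) auto
      then show False using A by simp
    qed
    \<comment> \<open>The grid point \<open>j0\<close> that follows \<open>r\<close> shows
      \<open>f r\<close>, which is neither \<open>a\<close> nor in \<open>D\<close>, although
      \<open>j0\<close> falls into the stretch where the grid demands \<open>D\<close>.\<close>
    have "\<not> passes_grid h z D a f" if h: "0 < h" "h < min d d'" for h
    proof
      assume "passes_grid h z D a f"
      then obtain i k :: nat where ik: "\<And>j. j < i \<Longrightarrow> f (real j * h) = z"
          "\<And>j. i \<le> j \<Longrightarrow> j < k \<Longrightarrow> f (real j * h) \<in> D" "f (real k * h) = a"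
        unfolding passes_grid_def by blast
      obtain l where l: "u \<le> real l * h" "i \<le> l" "l < k" using start[of h i k] ik h by auto
      have "real l * h \<le> real k * h" using l h by (intro mult_right_mono) auto
      then have kr: "r \<le> real k * h" using r(3)[of "real k * h"] l ik(3) ne by force
      obtain j0 :: nat where j0: "r \<le> real j0 * h" "real j0 * h < r + h" "\<And>j. j < j0 \<Longrightarrow> real j * h < r"
        using first_grid_point[OF h(1) r0] by blast
      have fj0: "f (real j0 * h) = f r" using j0(1,2) h by (intro d'(2)) auto
      have "j0 \<le> k" using j0(3)[of k] kr by force
      moreover have "j0 \<noteq> k" using fj0 fr ik(3) by auto
      moreover have "i \<le> j0"
      proof (rule ccontr)
        assume "\<not> i \<le> j0"
        then have "f r = z" using ik(1)[of j0] fj0 by simp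
        have "j0 < l" using l \<open>\<not> i \<le> j0\<close> by simp
        obtain l' :: nat where l': "u \<le> real l' * h" "real l' * h < u + h" "\<And>j. j < l' \<Longrightarrow> real j * h < u"
          using first_grid_point[OF h(1) u(1)] by blast
        have fl: "f (real l' * h) = f u" using l'(1,2) h by (intro d(2)) auto
        have "i \<le> l'" using ik(1)[of l'] fl u(2) by (metis not_le)
        then have "j0 < l'" using \<open>\<not> i \<le> j0\<close> by simp
        then have "real j0 * h < u" using l' by simp
        then show False using j0(1) r(1) by simp
      qed
      ultimately have "f r \<in> D" using ik(2)[of j0] fj0 by simp
      then show False using r by simp
    qed
    then show ?thesis using d(1) d'(1) by (intro exI[of _ "min d d'"]) auto
  qed
qed

lemma passes_grid_eventually:
  assumes rc: "right_constant f" and ne: "z \<notin> D" "a \<notin> D" "a \<noteq> z"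
  shows "\<forall>\<^sub>F m in sequentially. passes_grid (inverse (real (Suc m))) z D a f \<longleftrightarrow> passes z D a f"
proof -
  obtain d where d: "d > 0" "\<And>h. 0 < h \<Longrightarrow> h < d \<Longrightarrow> passes_grid h z D a f \<longleftrightarrow> passes z D a f"
    using passes_grid_if_passes[OF rc] not_passes_grid_if_not_passes[OF rc ne]
    by (cases "passes z D a f") (metis (full_types))+
  have "\<forall>\<^sub>F m in sequentially. inverse (real (Suc m)) < d"
    using LIMSEQ_inverse_real_of_nat d(1) by (rule order_tendstoD)
  then show ?thesis by eventually_elim (use d in auto)
qed

text \<open>The condition on \<open>f h\<close> forbids the shifted path to begin with a new stretch
  in \<open>z\<close>.\<close>

lemma passes_grid_step_inside:
  assumes "f 0 \<in> D" "z \<notin> D" "a \<notin> D" "a \<noteq> z"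
  shows "passes_grid h z D a f \<longleftrightarrow> f h \<in> insert a D \<and> passes_grid h z D a (\<lambda>t. f (h + t))"
proof
  assume "passes_grid h z D a f"
  then obtain i k :: nat where ik: "i \<le> k" "\<And>j. j < i \<Longrightarrow> f (real j * h) = z"
      "\<And>j. i \<le> j \<Longrightarrow> j < k \<Longrightarrow> f (real j * h) \<in> D" "f (real k * h) = a"
    unfolding passes_grid_def by blast
  have "i = 0" using ik(2)[of 0] assms by (cases i) auto
  moreover obtain k' where k': "k = Suc k'" using ik(4) assms by (cases k) auto
  ultimately have D: "f (real j * h + h) \<in> D" if "j < k'" for j
    using ik(3)[of "Suc j"] that by (simp add: algebra_simps)
  have a: "f (real k' * h + h) = a" using ik(4) k' by (simp add: algebra_simps)
  have "f h \<in> insert a D" using D[of 0] a by (cases k') auto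
  moreover have "passes_grid h z D a (\<lambda>t. f (h + t))"
    unfolding passes_grid_def using D a by (intro exI[of _ 0] exI[of _ k']) (auto simp: add.commute)
  ultimately show "f h \<in> insert a D \<and> passes_grid h z D a (\<lambda>t. f (h + t))" by simp
next
  assume A: "f h \<in> insert a D \<and> passes_grid h z D a (\<lambda>t. f (h + t))"
  then obtain i k :: nat where ik: "i \<le> k" "\<And>j. j < i \<Longrightarrow> f (h + real j * h) = z"
      "\<And>j. i \<le> j \<Longrightarrow> j < k \<Longrightarrow> f (h + real j * h) \<in> D" "f (h + real k * h) = a"
    unfolding passes_grid_def by blast
  have "i = 0" using ik(2)[of 0] assms A by (cases i) auto
  have D: "f (real j * h) \<in> D" if "j < Suc k" for j
    using that ik(3)[of "j - 1"] assms(1) \<open>i = 0\<close>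
    by (cases j) (auto simp: algebra_simps)
  have "f (real (Suc k) * h) = a" using ik(4) by (simp add: algebra_simps)
  then show "passes_grid h z D a f"
    unfolding passes_grid_def using D by (intro exI[of _ 0] exI[of _ "Suc k"]) auto
qed

text \<open>Here the shifted path may continue the stretch in \<open>z\<close>. The condition on
  \<open>f h\<close> provides the finite set of states over which \<open>grid_step\<close>
  sums.\<close>

lemma passes_grid_step_start:
  assumes "f 0 = z" "z \<notin> D" "a \<noteq> z"
  shows "passes_grid h z D a f \<longleftrightarrow>
    f h \<in> insert z (insert a D) \<and> passes_grid h z D a (\<lambda>t. f (h + t))"
proof
  assume "passes_grid h z D a f"
  then obtain i k :: nat where ik: "i \<le> k" "\<And>j. j < i \<Longrightarrow> f (real j * h) = z"
      "\<And>j. i \<le> j \<Longrightarrow> j < k \<Longrightarrow> f (real j * h) \<in> D" "f (real k * h) = a"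
    unfolding passes_grid_def by blast
  have "i \<noteq> 0" using ik(3)[of 0] ik(4) assms by (cases k) auto
  then obtain i' where i': "i = Suc i'" by (cases i) auto
  obtain k' where k': "k = Suc k'" using ik(1) i' by (cases k) auto
  have z: "f (h + real j * h) = z" if "j < i'" for j
    using ik(2)[of "Suc j"] that i' by (simp add: algebra_simps)
  have D: "f (h + real j * h) \<in> D" if "i' \<le> j" "j < k'" for j
    using ik(3)[of "Suc j"] that i' k' by (simp add: algebra_simps)
  have a: "f (h + real k' * h) = a" using ik(4) k' by (simp add: algebra_simps)
  have "f h \<in> insert z (insert a D)"
    using z[of 0] D[of 0] a by (cases "i' = 0"; cases "k' = 0") auto
  moreover have "passes_grid h z D a (\<lambda>t. f (h + t))"
    unfolding passes_grid_def using z D a ik(1) i' k' by (intro exI[of _ i'] exI[of _ k']) auto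
  ultimately show "f h \<in> insert z (insert a D) \<and> passes_grid h z D a (\<lambda>t. f (h + t))" by simp
next
  assume A: "f h \<in> insert z (insert a D) \<and> passes_grid h z D a (\<lambda>t. f (h + t))"
  then obtain i k :: nat where ik: "i \<le> k" "\<And>j. j < i \<Longrightarrow> f (h + real j * h) = z"
      "\<And>j. i \<le> j \<Longrightarrow> j < k \<Longrightarrow> f (h + real j * h) \<in> D" "f (h + real k * h) = a"
    unfolding passes_grid_def by blast
  have z: "f (real j * h) = z" if "j < Suc i" for j
    using that ik(2)[of "j - 1"] assms(1) by (cases j) (auto simp: algebra_simps)
  have D: "f (real j * h) \<in> D" if "Suc i \<le> j" "j < Suc k" for j
    using that ik(3)[of "j - 1"] by (cases j) (auto simp: algebra_simps)
  have "f (real (Suc k) * h) = a" using ik(4) by (simp add: algebra_simps)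
  then show "passes_grid h z D a f"
    unfolding passes_grid_def using z D ik(1) by (intro exI[of _ "Suc i"] exI[of _ "Suc k"]) auto
qed

section \<open>Power series in a triangular matrix\<close>

lemma mat_power_eq_0:
  assumes A: "\<And>x y. y \<le> x \<Longrightarrow> A x y = 0" and "y < x + n"
  shows "mat_power A n x y = 0"
  using assms(2)
proof (induction n arbitrary: y)
  case (Suc n)
  have "mat_power A n x z * A z y = 0" if "z < y" for z
    using Suc.IH[of z] Suc.prems that by auto
  then show ?case by (simp only: mat_power.simps) (auto intro!: sum.neutral)
qed auto

text \<open>The recursion multiplies on the right; eigenvector equations are needed on both sides.
  The range includes \<open>z = y\<close> because the factor is the identity for
  \<open>n = 0\<close>.\<close>

lemma mat_power_Suc_left:
  assumes A: "\<And>x y. y \<le> x \<Longrightarrow> A x y = 0"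
  shows "mat_power A (Suc n) x y = (\<Sum>z\<le>y. A x z * mat_power A n z y)"
proof (induction n arbitrary: y)
  case 0
  have "(\<Sum>z<y. of_bool (x = z) * A z y) = A x y"
    using A[of y x] by (cases "x < y") (auto simp: of_bool_def if_distrib[of "\<lambda>a. a * _"] cong: if_cong)
  moreover have "(\<Sum>z\<le>y. A x z * of_bool (z = y)) = A x y"
    by (simp add: of_bool_def if_distrib[of "\<lambda>a. _ * a"] cong: if_cong)
  ultimately show ?case by simp
next
  case (Suc n)
  have "mat_power A (Suc (Suc n)) x y = (\<Sum>z<y. (\<Sum>v\<le>z. A x v * mat_power A n v z) * A z y)"
    using Suc.IH by (subst mat_power.simps) simp
  also have "\<dots> = (\<Sum>z<y. (\<Sum>v\<le>y. A x v * mat_power A n v z) * A z y)"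
  proof (rule sum.cong[OF refl])
    fix z assume "z \<in> {..<y}"
    then have "(\<Sum>v\<le>z. A x v * mat_power A n v z) = (\<Sum>v\<le>y. A x v * mat_power A n v z)"
      using mat_power_eq_0[of A, OF A] by (intro sum.mono_neutral_left) auto
    then show "(\<Sum>v\<le>z. A x v * mat_power A n v z) * A z y = (\<Sum>v\<le>y. A x v * mat_power A n v z) * A z y"
      by simp
  qed
  also have "\<dots> = (\<Sum>v\<le>y. A x v * mat_power A (Suc n) v y)"
    by (simp add: sum_distrib_left sum_distrib_right mult.assoc sum.swap[of _ "{..<y}"])
  finally show ?case .
qed

text \<open>The Neumann series of \<open>A (I - q A)^(-1)\<close>. The next two expansions
  \<open>power_series_right\<close> and \<open>power_series_left\<close> are its resolvent
  identities.\<close>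

definition power_series :: "(nat \<Rightarrow> nat \<Rightarrow> real) \<Rightarrow> real \<Rightarrow> nat \<Rightarrow> nat \<Rightarrow> real" where
  "power_series A q x y = (\<Sum>n. q ^ n * mat_power A (Suc n) x y)"

lemma scale_function_eq_power_series:
  "scale_function P X Q q x y = power_series (excursion_scale P X Q 0) q x y"
  by (simp add: scale_function_def power_series_def)

context
  fixes A :: "nat \<Rightarrow> nat \<Rightarrow> real"
  assumes A: "\<And>x y. y \<le> x \<Longrightarrow> A x y = 0"
begin

text \<open>Triangularity kills all terms with \<open>n \<ge> y\<close>. The free bound
  \<open>N\<close> gives entries in different columns a common range of summation.\<close>

lemma power_series_eq_sum:
  assumes "y \<le> N"
  shows "power_series A q x y = (\<Sum>n<N. q ^ n * mat_power A (Suc n) x y)"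
  unfolding power_series_def
  using assms by (intro suminf_finite) (auto simp: mat_power_eq_0[of A, OF A] simp del: mat_power.simps)

lemma power_series_eq_0: "y \<le> x \<Longrightarrow> power_series A q x y = 0"
  by (subst power_series_eq_sum[OF order_refl])
    (auto simp: mat_power_eq_0[of A, OF A] simp del: mat_power.simps)

lemma power_series_split:
  "power_series A q x y = A x y + q * (\<Sum>n<y. q ^ n * mat_power A (Suc (Suc n)) x y)"
proof -
  have "power_series A q x y = (\<Sum>n<Suc y. q ^ n * mat_power A (Suc n) x y)"
    by (rule power_series_eq_sum) simp
  also have "\<dots> = mat_power A (Suc 0) x y + q * (\<Sum>n<y. q ^ n * mat_power A (Suc (Suc n)) x y)"
    by (subst sum.lessThan_Suc_shift)
      (simp add: sum_distrib_left mult.assoc mult.left_commute del: mat_power.simps)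
  also have "mat_power A (Suc 0) x y = A x y"
    by (subst mat_power_Suc_left[of A, OF A])
      (simp_all add: of_bool_def if_distrib[of "\<lambda>a. _ * a"] cong: if_cong)
  finally show ?thesis .
qed

lemma power_series_right:
  "power_series A q x y = A x y + q * (\<Sum>z<y. power_series A q x z * A z y)"
proof -
  have "(\<Sum>n<y. q ^ n * mat_power A (Suc (Suc n)) x y)
      = (\<Sum>n<y. \<Sum>z<y. q ^ n * mat_power A (Suc n) x z * A z y)"
    by (subst mat_power.simps) (simp add: sum_distrib_left mult.assoc del: mat_power.simps)
  also have "\<dots> = (\<Sum>z<y. power_series A q x z * A z y)"
    by (subst sum.swap) (auto simp: power_series_eq_sum[of _ y] sum_distrib_right simp del: mat_power.simps
        intro!: sum.cong)
  finally show ?thesis using power_series_split by simp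
qed

lemma power_series_left:
  "power_series A q x y = A x y + q * (\<Sum>z<y. A x z * power_series A q z y)"
proof -
  have "(\<Sum>n<y. q ^ n * mat_power A (Suc (Suc n)) x y)
      = (\<Sum>n<y. \<Sum>z\<le>y. q ^ n * (A x z * mat_power A (Suc n) z y))"
    by (subst mat_power_Suc_left[of A, OF A]) (simp_all add: sum_distrib_left del: mat_power.simps)
  also have "\<dots> = (\<Sum>z\<le>y. A x z * power_series A q z y)"
    by (subst sum.swap) (auto simp: power_series_eq_sum[of y y] sum_distrib_left mult_ac
        simp del: mat_power.simps intro!: sum.cong)
  also have "\<dots> = (\<Sum>z<y. A x z * power_series A q z y)"
    by (rule sum.mono_neutral_right) (auto simp: power_series_eq_0 not_less)
  finally show ?thesis using power_series_split by simp
qed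

end

text \<open>With rows shifted by one, \<open>Q\<close> is upper triangular, so a right inverse is also a left inverse.\<close>

lemma left_inverse_if_right_inverse:
  fixes Q W :: "nat \<Rightarrow> nat \<Rightarrow> real"
  assumes Q: "\<And>x y. y + 2 \<le> x \<Longrightarrow> Q x y = 0" "\<And>y. 1 \<le> y \<Longrightarrow> Q y (y - 1) \<noteq> 0"
    and W: "\<And>x z. z \<le> x \<Longrightarrow> W x z = 0"
    and QW: "\<And>y z. 1 \<le> y \<Longrightarrow> y \<le> z \<Longrightarrow> (\<Sum>w<z. Q y w * W w z) = of_bool (y = z)"
  shows "(\<Sum>z=1..Suc y. W x z * Q z y) = of_bool (x = y)"
proof -
  \<comment> \<open>\<open>C\<close> is row \<open>x\<close> of the defect \<open>W Q - I\<close>.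
    From \<open>W (Q W) = W\<close> it follows that \<open>C W = 0\<close>; the entries
    \<open>W z (Suc z)\<close> are nonzero, so \<open>C\<close> vanishes by induction along the
    columns.\<close>
  define C where "C y = (\<Sum>z=1..Suc y. W x z * Q z y) - of_bool (x = y)" for y
  have diag: "W z (Suc z) \<noteq> 0" for z
  proof -
    have "(\<Sum>w<Suc z. Q (Suc z) w * W w (Suc z)) = Q (Suc z) z * W z (Suc z)"
      using Q(1) by (auto simp: lessThan_Suc)
    then show ?thesis using QW[of "Suc z" "Suc z"] by auto
  qed
  have CW: "(\<Sum>y\<le>k. C y * W y (Suc k)) = 0" for k
  proof -
    have "(\<Sum>y\<le>k. (\<Sum>z=1..Suc y. W x z * Q z y) * W y (Suc k))
        = (\<Sum>y\<le>k. (\<Sum>z=1..Suc k. W x z * Q z y) * W y (Suc k))"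
    proof (rule sum.cong[OF refl])
      fix y assume "y \<in> {..k}"
      then have "(\<Sum>z=1..Suc y. W x z * Q z y) = (\<Sum>z=1..Suc k. W x z * Q z y)"
        using Q(1) by (intro sum.mono_neutral_left) auto
      then show "(\<Sum>z=1..Suc y. W x z * Q z y) * W y (Suc k) = (\<Sum>z=1..Suc k. W x z * Q z y) * W y (Suc k)"
        by simp
    qed
    also have "\<dots> = (\<Sum>z=1..Suc k. W x z * (\<Sum>y<Suc k. Q z y * W y (Suc k)))"
      by (simp only: lessThan_Suc_atMost sum_distrib_left sum_distrib_right mult.assoc
          sum.swap[of _ "{..k}"])
    also have "\<dots> = (\<Sum>z=1..Suc k. W x z * of_bool (z = Suc k))"
      by (rule sum.cong) (auto simp: QW simp del: sum.lessThan_Suc)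
    also have "\<dots> = W x (Suc k)"
      by (simp add: of_bool_def if_distrib[of "\<lambda>a. _ * a"] cong: if_cong)
    also have "\<dots> = (\<Sum>y\<le>k. of_bool (x = y) * W y (Suc k))"
      using W[of "Suc k" x] by (cases "x \<le> k") (auto simp: of_bool_def if_distrib[of "\<lambda>a. a * _"] cong: if_cong)
    finally show ?thesis by (simp add: C_def left_diff_distrib sum_subtractf)
  qed
  have "C y = 0"
  proof (induction y rule: less_induct)
    case (less y)
    have "(\<Sum>v\<le>y. C v * W v (Suc y)) = C y * W y (Suc y)"
      using less by (subst sum.remove[of _ y]) (auto intro!: sum.neutral)
    then show ?case using CW[of y] diag[of y] by simp
  qed
  then show ?thesis by (simp add: C_def)
qed

context
  fixes Q W :: "nat \<Rightarrow> nat \<Rightarrow> real" and q :: real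
  assumes Q: "\<And>x y. y + 2 \<le> x \<Longrightarrow> Q x y = 0" "\<And>y. 1 \<le> y \<Longrightarrow> Q y (y - 1) \<noteq> 0"
    and W: "\<And>x z. z \<le> x \<Longrightarrow> W x z = 0"
    and QW: "\<And>y z. 1 \<le> y \<Longrightarrow> y \<le> z \<Longrightarrow> (\<Sum>w<z. Q y w * W w z) = of_bool (y = z)"
begin

text \<open>Apply \<open>Q\<close> from the left to \<open>power_series_left\<close> and use
  \<open>Q W = I\<close>.\<close>

lemma power_series_right_eigenvector:
  assumes "1 \<le> y" "y \<le> z"
  shows "(\<Sum>w<z. Q y w * power_series W q w z) = of_bool (y = z) + q * power_series W q y z"
proof -
  \<comment> \<open>The hypothesis covers \<open>y \<le> v\<close>. For \<open>v < y\<close> each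
    summand vanishes, by skip-freeness or by triangularity.\<close>
  have QW': "(\<Sum>w<z. Q y w * W w v) = of_bool (y = v)" if "v < z" for v
  proof (cases "y \<le> v")
    case True
    have "(\<Sum>w<z. Q y w * W w v) = (\<Sum>w<v. Q y w * W w v)"
      using that W by (intro sum.mono_neutral_right) auto
    then show ?thesis using QW[OF assms(1) True] by simp
  next
    case False
    have "Q y w * W w v = 0" for w
      using False Q(1)[of w y] W[of v w] by (cases "w < v") auto
    then have "(\<Sum>w<z. Q y w * W w v) = 0" by (intro sum.neutral) auto
    then show ?thesis using False by simp
  qed
  have "(\<Sum>w<z. Q y w * power_series W q w z)
      = (\<Sum>w<z. Q y w * W w z) + q * (\<Sum>w<z. \<Sum>v<z. Q y w * W w v * power_series W q v z)"
  proof -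
    have "(\<Sum>w<z. Q y w * power_series W q w z)
        = (\<Sum>w<z. Q y w * (W w z + q * (\<Sum>v<z. W w v * power_series W q v z)))"
      by (rule sum.cong[OF refl], subst power_series_left[OF W]) (assumption, rule refl)
    then show ?thesis
      by (simp only: distrib_left sum.distrib sum_distrib_left mult.assoc mult.left_commute[of _ q])
  qed
  also have "(\<Sum>w<z. \<Sum>v<z. Q y w * W w v * power_series W q v z)
      = (\<Sum>v<z. (\<Sum>w<z. Q y w * W w v) * power_series W q v z)"
    by (subst sum.swap) (simp add: sum_distrib_right)
  also have "\<dots> = (\<Sum>v<z. of_bool (y = v) * power_series W q v z)"
    by (rule sum.cong) (auto simp: QW')
  also have "\<dots> = power_series W q y z"
    using assms power_series_eq_0[of W z y q, OF W]
    by (cases "y < z") (auto simp: of_bool_def if_distrib[of "\<lambda>a. a * _"] cong: if_cong)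
  finally show ?thesis using QW[OF assms] by simp
qed

text \<open>Row \<open>Suc y\<close> of \<open>Q\<close> has one nonzero entry left of the diagonal,
  so this entry does not depend on \<open>q\<close>; in particular its sign is known for every
  \<open>q\<close>.\<close>

lemma power_series_last: "power_series W q y (Suc y) = 1 / Q (Suc y) y"
proof -
  have "(\<Sum>w<Suc y. Q (Suc y) w * power_series W q w (Suc y)) = Q (Suc y) y * power_series W q y (Suc y)"
    using Q(1) by (auto simp: lessThan_Suc)
  then show ?thesis
    using power_series_right_eigenvector[of "Suc y" "Suc y"] power_series_eq_0[of W "Suc y" "Suc y" q, OF W] Q(2)[of "Suc y"]
    by (simp add: field_simps)
qed

lemma power_series_left_eigenvector:
  "(\<Sum>z=1..Suc y. power_series W q x z * Q z y) = of_bool (x = y) + q * power_series W q x y"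
proof -
  have WQ: "(\<Sum>z=1..Suc y. W v z * Q z y) = of_bool (v = y)" for v
    using Q W QW by (rule left_inverse_if_right_inverse)
  have "power_series W q x z = W x z + q * (\<Sum>v\<le>y. power_series W q x v * W v z)" if "z \<le> Suc y" for z
  proof -
    have "(\<Sum>v<z. power_series W q x v * W v z) = (\<Sum>v\<le>y. power_series W q x v * W v z)"
      using that W by (intro sum.mono_neutral_left) auto
    then show ?thesis using power_series_right[of W q x z, OF W] by simp
  qed
  then have "(\<Sum>z=1..Suc y. power_series W q x z * Q z y)
      = (\<Sum>z=1..Suc y. (W x z + q * (\<Sum>v\<le>y. power_series W q x v * W v z)) * Q z y)"
    by (intro sum.cong) auto
  also have "\<dots> = (\<Sum>z=1..Suc y. W x z * Q z y)
      + q * (\<Sum>z=1..Suc y. \<Sum>v\<le>y. power_series W q x v * (W v z * Q z y))"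
    by (simp only: distrib_right sum.distrib sum_distrib_left sum_distrib_right mult.assoc)
  also have "(\<Sum>z=1..Suc y. \<Sum>v\<le>y. power_series W q x v * (W v z * Q z y))
      = (\<Sum>v\<le>y. power_series W q x v * (\<Sum>z=1..Suc y. W v z * Q z y))"
    by (subst sum.swap) (simp only: sum_distrib_left)
  also have "\<dots> = power_series W q x y"
    by (simp only: WQ) (simp add: of_bool_def if_distrib[of "\<lambda>a. _ * a"] cong: if_cong)
  finally show ?thesis by (simp only: WQ)
qed

end

section \<open>A minimum principle for eigenvectors on a finite set of states\<close>

text \<open>Let \<open>b\<close> be the largest state where \<open>f\<close> fails to be positive
  and subtract from \<open>g\<close> the largest multiple \<open>c * f\<close> that keeps the
  difference \<open>k\<close> nonnegative above \<open>b\<close>. At a zero \<open>w\<close> of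
  \<open>k\<close> the eigenvalue equation gives \<open>Q k \<le> 0\<close>, yet every term of that
  sum is nonnegative, and the zero set can be left with positive rate towards a state where the
  difference is positive.\<close>

lemma positive_if_supersolution:
  fixes Q :: "nat \<Rightarrow> nat \<Rightarrow> real" and f g :: "nat \<Rightarrow> real"
  assumes Q: "\<And>x y. x \<noteq> y \<Longrightarrow> 0 \<le> Q x y" "\<And>x y. y + 2 \<le> x \<Longrightarrow> Q x y = 0"
    and exit: "\<And>Z n. Z \<noteq> {} \<Longrightarrow> Z \<subseteq> {1..<n} \<Longrightarrow> \<exists>w\<in>Z. \<exists>v. v \<notin> insert 0 Z \<and> 0 < Q w v"
    and g: "\<And>y. 1 \<le> y \<Longrightarrow> 0 < g y" "0 \<le> g 0"
      "\<And>y N. 1 \<le> y \<Longrightarrow> y < N \<Longrightarrow> (\<Sum>w<N. Q y w * g w) \<le> - l * g y"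
    and f: "0 < f n" "\<And>y. 1 \<le> y \<Longrightarrow> y \<le> n \<Longrightarrow> (\<Sum>w\<le>n. Q y w * f w) = - l * f y"
    and y: "y \<le> n"
  shows "0 < f y"
proof (rule ccontr)
  assume "\<not> 0 < f y"
  define B where "B = {y. y \<le> n \<and> f y \<le> 0}"
  have B: "finite B" "B \<noteq> {}" using y \<open>\<not> 0 < f y\<close> by (auto simp: B_def)
  define b where "b = Max B"
  have "b \<in> B" unfolding b_def using B by (rule Max_in)
  then have b: "b < n" "f b \<le> 0" using f(1) by (auto simp: B_def le_less)
  have fpos: "0 < f w" if "b < w" "w \<le> n" for w
  proof (rule ccontr)
    assume "\<not> 0 < f w"
    then have "w \<le> b" unfolding b_def using B(1) that by (intro Max_ge) (auto simp: B_def)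
    then show False using that by simp
  qed
  define D where "D = {b<..n}"
  have D: "finite D" "D \<noteq> {}" using b by (auto simp: D_def)
  define c where "c = Min ((\<lambda>w. g w / f w) ` D)"
  have "c \<in> (\<lambda>w. g w / f w) ` D" unfolding c_def using D by (intro Min_in) auto
  then obtain w0 where w0: "w0 \<in> D" "c = g w0 / f w0" by auto
  have c0: "0 < c" using w0 g(1)[of w0] fpos[of w0] by (auto simp: D_def)
  define k where "k w = g w - c * f w" for w
  have k: "0 \<le> k w" if "w \<in> D" for w
  proof -
    have "c \<le> g w / f w" unfolding c_def using D that by (intro Min_le) auto
    then show ?thesis using fpos[of w] that by (auto simp: k_def D_def field_simps)
  qed
  have cf: "c * f b \<le> 0" using c0 b(2) by (intro mult_nonneg_nonpos) auto
  have "0 \<le> g b" using g(1)[of b] g(2) by (cases "b = 0") auto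
  then have kb: "0 \<le> k b" using cf by (simp add: k_def)
  have kb': "0 < k b" if "1 \<le> b" using g(1)[OF that] cf by (simp add: k_def)
  have k0: "k w = 0 \<or> 0 < k w" if "w \<in> insert b D" for w
    using k kb that by force
  define Z where "Z = {w \<in> D. k w = 0}"
  have "w0 \<in> Z" using w0 fpos[of w0] by (auto simp: Z_def k_def D_def)
  moreover have "Z \<subseteq> {1..<Suc n}" by (auto simp: Z_def D_def)
  ultimately obtain w v where wv: "w \<in> Z" "v \<notin> insert 0 Z" "0 < Q w v" using exit[of Z "Suc n"] by blast
  have w: "b < w" "w \<le> n" "k w = 0" "1 \<le> w" using wv by (auto simp: Z_def D_def)
  \<comment> \<open>Above \<open>n\<close>, where \<open>f\<close> counts as 0, the difference is
    continued by \<open>g\<close>, so that jumps beyond \<open>n\<close> contribute with the right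
    sign.\<close>
  define e where "e u = (if u \<le> n then k u else g u)" for u
  have bv: "b \<le> v" using wv(3) Q(2)[of v w] w(1) by (cases "v + 2 \<le> w") auto
  define N where "N = Suc (max n v)"
  have lt: "(\<Sum>u<N. Q w u * e u) \<le> 0"
  proof -
    have "(\<Sum>u<N. Q w u * e u) = (\<Sum>u<N. Q w u * g u) - c * (\<Sum>u<N. Q w u * (if u \<le> n then f u else 0))"
      by (auto simp: e_def k_def sum_distrib_left sum_subtractf[symmetric] algebra_simps intro!: sum.cong)
    also have "(\<Sum>u<N. Q w u * (if u \<le> n then f u else 0)) = (\<Sum>u\<le>n. Q w u * f u)"
      by (rule sum.mono_neutral_cong_right) (auto simp: N_def)
    also have "\<dots> = - l * f w" using f(2) w by simp
    finally have "(\<Sum>u<N. Q w u * e u) = (\<Sum>u<N. Q w u * g u) - c * (- l * f w)" .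
    moreover have "(\<Sum>u<N. Q w u * g u) \<le> - l * g w"
      using w by (intro g(3)) (auto simp: N_def)
    ultimately have "(\<Sum>u<N. Q w u * e u) \<le> - l * k w"
      by (simp add: k_def algebra_simps)
    then show ?thesis using w by simp
  qed
  \<comment> \<open>States below \<open>b\<close> cannot be reached from \<open>w > b\<close> in one
    jump, and the possibly negative diagonal rate meets \<open>e w = 0\<close>.\<close>
  have nn: "0 \<le> Q w u * e u" for u
  proof (cases "u < b")
    case True
    then show ?thesis using Q(2)[of u w] w by simp
  next
    case False
    have "0 \<le> e u" using False k[of u] kb g(1)[of u] by (cases "u = b") (auto simp: e_def D_def)
    then show ?thesis using Q(1)[of w u] w by (cases "w = u") (auto simp: e_def)
  qed
  have "Q w v * e v \<le> (\<Sum>u<N. Q w u * e u)"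
    using nn by (intro member_le_sum) (auto simp: N_def)
  moreover have "0 < Q w v * e v"
  proof -
    have "0 < e v"
    proof (cases "v \<le> n")
      case True
      show ?thesis
      proof (cases "v = b")
        case True
        \<comment> \<open>\<open>exit\<close> excludes \<open>v = 0\<close>, the only state where
          \<open>g\<close>, and hence \<open>k b\<close>, might vanish.\<close>
        then show ?thesis using kb' wv(2) b by (auto simp: e_def)
      next
        case False
        then have "v \<in> D" using bv True by (auto simp: D_def)
        then show ?thesis using k0[of v] wv(2) True by (auto simp: e_def Z_def)
      qed
    next
      case False
      then show ?thesis using g(1)[of v] by (auto simp: e_def)
    qed
    then show ?thesis using wv(3) by simp
  qed
  ultimately show False using lt by simp
qed

section \<open>The Markov property on path space\<close>

text \<open>Only live values at nonnegative times are prescribed, which matches the form of the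
  Markov axiom. The event of being killed at a given time is still generated, as the complement of a
  countable union.\<close>

definition path_cylinders :: "(real \<Rightarrow> nat option) set set" where
  "path_cylinders = {{f. \<forall>(t, v)\<in>K. f t = Some v} | K. finite K \<and> K \<subseteq> {0..} \<times> UNIV}"

definition path_space :: "(real \<Rightarrow> nat option) measure" where
  "path_space = sigma UNIV path_cylinders"

lemma space_path_space [simp]: "space path_space = UNIV"
  by (simp add: path_space_def space_measure_of)

lemma sets_path_space: "sets path_space = sigma_sets UNIV path_cylinders"
  by (simp add: path_space_def sets_measure_of)

lemma Int_stable_path_cylinders: "Int_stable path_cylinders"
proof (rule Int_stableI)
  fix a b assume "a \<in> path_cylinders" "b \<in> path_cylinders"
  then obtain K L where "finite K" "K \<subseteq> {0..} \<times> UNIV" "a = {f. \<forall>(t, v)\<in>K. f t = Some v}"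
      "finite L" "L \<subseteq> {0..} \<times> UNIV" "b = {f. \<forall>(t, v)\<in>L. f t = Some v}"
    unfolding path_cylinders_def by blast
  then show "a \<inter> b \<in> path_cylinders"
    unfolding path_cylinders_def by (intro CollectI exI[of _ "K \<union> L"]) auto
qed

lemma pred_path_space_eq [measurable]:
  assumes "0 \<le> t"
  shows "Measurable.pred path_space (\<lambda>f. f t = Some v)"
proof -
  have "{f. f t = Some v} \<in> path_cylinders"
    unfolding path_cylinders_def using assms by (intro CollectI exI[of _ "{(t, v)}"]) auto
  then show ?thesis by (auto simp: pred_def sets_path_space)
qed

lemma pred_path_space_mem [measurable]:
  assumes "0 \<le> t"
  shows "Measurable.pred path_space (\<lambda>f. f t \<in> Some ` D)"
proof -
  have "(\<lambda>f. f t \<in> Some ` D) = (\<lambda>f. \<exists>v\<in>D. f t = Some v)" by auto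
  then show ?thesis using assms by simp
qed

lemma pred_passes_grid [measurable]:
  assumes "0 < h"
  shows "Measurable.pred path_space (passes_grid h (Some z) (Some ` D) (Some a))"
proof -
  have [simp]: "0 \<le> real j * h" for j :: nat using assms by simp
  show ?thesis unfolding passes_grid_def[abs_def] by measurable
qed

text \<open>Constraints given as a relation either contradict each other or form a function on
  finitely many times, which is the shape \<open>Markov_finite\<close> works with.\<close>

lemma cylinder_cases:
  fixes K :: "(real \<times> nat) set"
  assumes "finite K" "K \<subseteq> {0..} \<times> UNIV"
  shows "{f. \<forall>(t, v)\<in>K. f t = Some v} = {} \<or>
    (\<exists>J v. finite J \<and> J \<subseteq> {0..} \<and>
      {f. \<forall>(t, v)\<in>K. f t = Some v} = {f. \<forall>t\<in>J. f t = Some (v t)})"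
proof (cases "\<exists>t a b. (t, a) \<in> K \<and> (t, b) \<in> K \<and> a \<noteq> b")
  case True
  then obtain t a b where "(t, a) \<in> K" "(t, b) \<in> K" "a \<noteq> b" by blast
  then have "f t = Some a \<and> f t = Some b" if "\<forall>(t, v)\<in>K. f t = Some v" for f
    using that by fastforce
  then have "{f. \<forall>(t, v)\<in>K. f t = Some v} = {}" using \<open>a \<noteq> b\<close> by force
  then show ?thesis by blast
next
  case False
  define v where "v t = (SOME a. (t, a) \<in> K)" for t
  have v: "a = v t" if "(t, a) \<in> K" for t a
  proof -
    have "(t, v t) \<in> K" unfolding v_def using that by (rule someI)
    then show ?thesis using False that by blast
  qed
  have "{f. \<forall>(t, v)\<in>K. f t = Some v} = {f. \<forall>t\<in>fst ` K. f t = Some (v t)}"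
    using v by fastforce
  moreover have "finite (fst ` K)" "fst ` K \<subseteq> {0..}" using assms by auto
  ultimately show ?thesis by blast
qed

lemma (in finite_measure) measure_tendsto:
  assumes A: "\<And>m. A m \<in> sets M" "B \<in> sets M"
    and ev: "\<And>w. w \<in> space M \<Longrightarrow> \<forall>\<^sub>F m in sequentially. w \<in> A m \<longleftrightarrow> w \<in> B"
  shows "(\<lambda>m. measure M (A m)) \<longlonglongrightarrow> measure M B"
proof -
  have "(\<lambda>m. \<integral>w. indicator (A m) w \<partial>M) \<longlonglongrightarrow> (\<integral>w. indicator B w \<partial>M :: real)"
  proof (rule integral_dominated_convergence[where w = "\<lambda>_. 1"])
    show "AE w in M. (\<lambda>m. indicator (A m) w :: real) \<longlonglongrightarrow> indicator B w"
    proof (rule AE_I2)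
      fix w assume "w \<in> space M"
      from ev[OF this] have "\<forall>\<^sub>F m in sequentially. indicator (A m) w = (indicator B w :: real)"
        by eventually_elim (auto simp: indicator_def)
      then show "(\<lambda>m. indicator (A m) w :: real) \<longlonglongrightarrow> indicator B w"
        by (rule tendsto_eventually)
    qed
  qed (use A in \<open>auto simp: indicator_def\<close>)
  then show ?thesis using A by simp
qed

text \<open>Fatou's lemma for sets: the event is the increasing union of the tail intersections
  \<open>C N\<close>.\<close>

lemma (in finite_measure) measure_eventually_le:
  assumes A: "\<And>m. A m \<in> sets M" and b: "\<forall>\<^sub>F m in sequentially. measure M (A m) \<le> b m" "b \<longlonglongrightarrow> \<beta>"
  shows "measure M {w \<in> space M. \<forall>\<^sub>F m in sequentially. w \<in> A m} \<le> \<beta>"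
proof -
  define C where "C N = (\<Inter>m\<in>{N..}. A m)" for N :: nat
  have C: "C N \<in> sets M" for N unfolding C_def using A by (intro sets.countable_INT') auto
  have le: "measure M (C N) \<le> \<beta>" for N
  proof (rule tendsto_lowerbound[OF b(2) _ sequentially_bot])
    have "\<forall>\<^sub>F m in sequentially. N \<le> m" by simp
    then show "\<forall>\<^sub>F m in sequentially. measure M (C N) \<le> b m"
      using b(1)
    proof eventually_elim
      case (elim m)
      have "measure M (C N) \<le> measure M (A m)" using A elim by (intro finite_measure_mono) (auto simp: C_def)
      then show ?case using elim by simp
    qed
  qed
  have "incseq C" by (auto simp: incseq_def C_def)
  then have "(\<lambda>N. measure M (C N)) \<longlonglongrightarrow> measure M (\<Union>N. C N)"
    using C by (intro finite_Lim_measure_incseq) auto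
  then have "measure M (\<Union>N. C N) \<le> \<beta>" by (rule LIMSEQ_le_const2) (use le in auto)
  moreover have "{w \<in> space M. \<forall>\<^sub>F m in sequentially. w \<in> A m} = (\<Union>N. C N)"
    using A[THEN sets.sets_into_space] by (auto simp: C_def eventually_sequentially)
  ultimately show ?thesis by simp
qed

context killed_markov_chain
begin

lemma space_P [simp]: "space (P x) = space M"
  using sets_eq_imp_space_eq[OF sets_P] .

lemma finite_measure_P: "finite_measure (P x)"
  using prob_space_P by (rule prob_space.finite_measure)

text \<open>From the explosion time on the path is constantly \<open>None\<close>, so right
  constancy extends beyond the times covered by the axiom.\<close>

lemma right_constant_X:
  assumes w: "w \<in> space M"
  shows "right_constant (\<lambda>t. X t w)"
  unfolding right_constant_def
proof (intro allI impI)
  fix t :: real assume t: "0 \<le> t"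
  show "\<exists>d>0. \<forall>s. t \<le> s \<and> s < t + d \<longrightarrow> X s w = X t w"
  proof (cases "explosion_time X w \<le> ereal t")
    case True
    have "X s w = None" if "t \<le> s" for s
      using killed_at_explosion[OF w, of s] True t that by (auto intro: order_trans[where y = "ereal t"])
    then show ?thesis by (intro exI[of _ 1]) auto
  next
    case False
    then have "\<forall>\<^sub>F s in at_right t. X s w = X t w" using right_continuous[OF w t] by simp
    then obtain b where b: "t < b" "\<And>s. t < s \<Longrightarrow> s < b \<Longrightarrow> X s w = X t w"
      unfolding eventually_at_right_field by blast
    then show ?thesis by (intro exI[of _ "b - t"]) (auto simp: le_less)
  qed
qed

lemma None_absorbing:
  assumes w: "w \<in> space M" and "0 \<le> s" "s \<le> t" "X s w = None"
  shows "X t w = None"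
  using killed_at_explosion[OF w, of s] killed_at_explosion[OF w, of t] assms
  by (auto intro: order_trans[where y = "ereal s"])

lemma sets_X_eq [measurable]: "0 \<le> t \<Longrightarrow> {w \<in> space M. X t w = v} \<in> sets M"
  using measurable_sets[OF measurable_X, of t "{v}"] by (simp add: vimage_def Int_def conj_commute)

lemma sigma_algebra_past: "sigma_algebra (space M) (past_sets M X s)"
  unfolding past_sets_def by (rule sigma_algebra_sigma_sets) auto

lemma past_sets_subset: "A \<in> past_sets M X s \<Longrightarrow> A \<in> sets M"
proof -
  assume "A \<in> past_sets M X s"
  moreover have "past_sets M X s \<subseteq> sets M"
    unfolding past_sets_def
  proof (rule sets.sigma_sets_subset, safe)
    fix u :: real and B :: "nat option set" assume "0 \<le> u"
    then show "X u -` B \<inter> space M \<in> sets M"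
      by (intro measurable_sets[OF measurable_X]) auto
  qed
  ultimately show ?thesis by blast
qed

lemma past_sets_mono: "s \<le> t \<Longrightarrow> past_sets M X s \<subseteq> past_sets M X t"
  unfolding past_sets_def by (rule sigma_sets_mono') force

lemma past_sets_space: "space M \<in> past_sets M X s"
  unfolding past_sets_def by (rule sigma_sets_top)

lemma past_sets_Int_X:
  assumes "A \<in> past_sets M X s" "0 \<le> u" "u \<le> s"
  shows "{w \<in> A. X u w \<in> B} \<in> past_sets M X s"
proof -
  interpret sigma_algebra "space M" "past_sets M X s" by (rule sigma_algebra_past)
  have "X u -` B \<inter> space M \<in> past_sets M X s"
    unfolding past_sets_def using assms by (intro sigma_sets.Basic) auto
  then have "A \<inter> (X u -` B \<inter> space M) \<in> past_sets M X s" using assms by blast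
  also have "A \<inter> (X u -` B \<inter> space M) = {w \<in> A. X u w \<in> B}"
    using sets_into_space[OF assms(1)] by auto
  finally show ?thesis .
qed

lemma past_sets_Int_all:
  assumes "finite J" "A \<in> past_sets M X s" "\<And>u. u \<in> J \<Longrightarrow> 0 \<le> T u \<and> T u \<le> s"
  shows "{w \<in> A. \<forall>u\<in>J. X (T u) w \<in> B u} \<in> past_sets M X s"
  using assms(1,3)
proof (induction J)
  case (insert u J)
  have "{w \<in> {w \<in> A. \<forall>u\<in>J. X (T u) w \<in> B u}. X (T u) w \<in> B u} \<in> past_sets M X s"
    using insert by (intro past_sets_Int_X) auto
  then show ?case by (rule back_subst[of "\<lambda>S. S \<in> past_sets M X s"]) auto
qed (use assms in simp)

lemma sets_X_path:
  assumes "0 \<le> s" "E \<in> sets path_space"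
  shows "{w \<in> space M. (\<lambda>t. X (s + t) w) \<in> E} \<in> sets M"
proof -
  have "(\<lambda>w t. X (s + t) w) \<in> M \<rightarrow>\<^sub>M path_space"
    unfolding path_space_def
  proof (rule measurable_measure_of)
    fix C assume "C \<in> path_cylinders"
    then obtain K where K: "finite K" "K \<subseteq> {0..} \<times> UNIV" "C = {f. \<forall>(t, v)\<in>K. f t = Some v}"
      unfolding path_cylinders_def by blast
    have "{w \<in> space M. \<forall>p\<in>K. X (s + fst p) w = Some (snd p)} \<in> sets M"
      using K assms(1) by (intro sets.sets_Collect_finite_All sets_X_eq) auto
    then show "(\<lambda>w t. X (s + t) w) -` C \<inter> space M \<in> sets M"
      by (rule back_subst[of "\<lambda>S. S \<in> sets M"]) (auto simp: K(3) split_beta)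
  qed auto
  from measurable_sets[OF this assms(2)] show ?thesis
    by (rule back_subst[of "\<lambda>S. S \<in> sets M"]) auto
qed

text \<open>Induction on the largest time \<open>b\<close>. Everything up to the preceding time
  \<open>a\<close> is a past event, so the axiom splits off the same last factor, the transition
  from \<open>v a\<close> to \<open>v b\<close>, under \<open>P x\<close> and under
  \<open>P y\<close>.\<close>

lemma Markov_finite:
  assumes "finite J" "J \<subseteq> {0..}" and s: "0 \<le> s" and A: "A \<in> past_sets M X s"
  shows "measure (P x) {w \<in> A. X s w = Some y \<and> (\<forall>t\<in>J. X (s + t) w = Some (v t))} =
    measure (P x) {w \<in> A. X s w = Some y} * measure (P y) {w \<in> space M. \<forall>t\<in>J. X t w = Some (v t)}"
  using assms(1,2)
proof (induction J rule: finite_linorder_max_induct)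
  case empty
  show ?case using prob_space.prob_space[OF prob_space_P, of y] by simp
next
  case (insert b J)
  show ?case
  proof (cases "J = {}")
    case True
    then show ?thesis using Markov[OF s _ A, of b x y "v b"] insert by simp
  next
    case False
    define a where "a = Max J"
    have a: "a \<in> J" "\<And>t. t \<in> J \<Longrightarrow> t \<le> a"
      using insert False by (auto simp: a_def)
    have a': "a < b" "0 \<le> a" using a(1) insert by auto
    define A' where "A' = {w \<in> A. X s w = Some y \<and> (\<forall>t\<in>J. X (s + t) w = Some (v t))}"
    have "{w \<in> {w \<in> A. X s w \<in> {Some y}}. \<forall>t\<in>J. X (s + t) w \<in> {Some (v t)}} \<in> past_sets M X (s + a)"
      using insert a a' s past_sets_mono[of s "s + a"] A by (intro past_sets_Int_all past_sets_Int_X) auto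
    then have A': "A' \<in> past_sets M X (s + a)"
      by (rule back_subst[of "\<lambda>S. S \<in> past_sets M X (s + a)"]) (auto simp: A'_def)
    define B' where "B' = {w \<in> space M. \<forall>t\<in>J. X t w = Some (v t)}"
    have "{w \<in> space M. \<forall>t\<in>J. X t w \<in> {Some (v t)}} \<in> past_sets M X a"
      using insert a a' past_sets_space by (intro past_sets_Int_all) auto
    then have B': "B' \<in> past_sets M X a" by (simp add: B'_def)
    have 1: "measure (P x) {w \<in> A. X s w = Some y \<and> (\<forall>t\<in>insert b J. X (s + t) w = Some (v t))}
        = measure (P x) A' * measure (P (v a)) {w \<in> space M. X (b - a) w = Some (v b)}"
    proof -
      have "{w \<in> A. X s w = Some y \<and> (\<forall>t\<in>insert b J. X (s + t) w = Some (v t))}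
          = {w \<in> A'. X (s + a) w = Some (v a) \<and> X (s + a + (b - a)) w = Some (v b)}"
        using a(1) by (auto simp: A'_def)
      moreover have "A' = {w \<in> A'. X (s + a) w = Some (v a)}" using a(1) by (auto simp: A'_def)
      ultimately show ?thesis using Markov[OF _ _ A', of "b - a" x "v a" "v b"] a' s by simp
    qed
    have 2: "measure (P y) {w \<in> space M. \<forall>t\<in>insert b J. X t w = Some (v t)}
        = measure (P y) B' * measure (P (v a)) {w \<in> space M. X (b - a) w = Some (v b)}"
    proof -
      have "{w \<in> space M. \<forall>t\<in>insert b J. X t w = Some (v t)}
          = {w \<in> B'. X a w = Some (v a) \<and> X (a + (b - a)) w = Some (v b)}"
        using a(1) by (auto simp: B'_def)
      moreover have "B' = {w \<in> B'. X a w = Some (v a)}" using a(1) by (auto simp: B'_def)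
      ultimately show ?thesis using Markov[OF _ _ B', of "b - a" y "v a" "v b"] a' by simp
    qed
    have "measure (P x) A' = measure (P x) {w \<in> A. X s w = Some y} * measure (P y) B'"
      using insert unfolding A'_def B'_def by auto
    then show ?thesis unfolding 1 2 by simp
  qed
qed

text \<open>Cylinders are stable under intersection and generate \<open>path_space\<close>, so
  Dynkin's theorem reduces the claim to \<open>Markov_finite\<close>.\<close>

lemma Markov_path:
  assumes s: "0 \<le> s" and A: "A \<in> past_sets M X s" and E: "E \<in> sets path_space"
  shows "measure (P x) {w \<in> A. X s w = Some y \<and> (\<lambda>t. X (s + t) w) \<in> E} =
    measure (P x) {w \<in> A. X s w = Some y} * measure (P y) {w \<in> space M. (\<lambda>t. X t w) \<in> E}"
proof -
  interpret px: prob_space "P x" by (rule prob_space_P)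
  interpret py: prob_space "P y" by (rule prob_space_P)
  define B where "B = {w \<in> A. X s w = Some y}"
  have "{w \<in> A. X s w \<in> {Some y}} \<in> past_sets M X s" using A s by (intro past_sets_Int_X) auto
  then have B: "B \<in> sets M" unfolding B_def using past_sets_subset by simp
  have BS: "B \<subseteq> space M" using B sets.sets_into_space by blast
  have eq: "{w \<in> A. X s w = Some y \<and> (\<lambda>t. X (s + t) w) \<in> E} = {w \<in> B. (\<lambda>t. X (s + t) w) \<in> E}" for E
    by (auto simp: B_def)
  have meas: "{w \<in> B. (\<lambda>t. X (s + t) w) \<in> E} \<in> sets (P x)" "{w \<in> space M. (\<lambda>t. X t w) \<in> E} \<in> sets (P y)"
    if "E \<in> sets path_space" for E
  proof -
    have "{w \<in> B. (\<lambda>t. X (s + t) w) \<in> E} = B \<inter> {w \<in> space M. (\<lambda>t. X (s + t) w) \<in> E}"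
      using BS by auto
    then show "{w \<in> B. (\<lambda>t. X (s + t) w) \<in> E} \<in> sets (P x)"
      using B sets_X_path[OF s that] by (simp add: sets_P)
    show "{w \<in> space M. (\<lambda>t. X t w) \<in> E} \<in> sets (P y)"
      using sets_X_path[of 0 E] that by (simp add: sets_P)
  qed
  have cyl: "path_cylinders \<subseteq> Pow UNIV" by simp
  have "measure (P x) {w \<in> B. (\<lambda>t. X (s + t) w) \<in> E} =
    measure (P x) B * measure (P y) {w \<in> space M. (\<lambda>t. X t w) \<in> E}"
    using Int_stable_path_cylinders cyl E[unfolded sets_path_space]
  proof (induction rule: sigma_sets_induct_disjoint)
    case (basic C)
    then obtain K where K: "finite K" "K \<subseteq> {0..} \<times> UNIV" "C = {f. \<forall>(t, v)\<in>K. f t = Some v}"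
      unfolding path_cylinders_def by blast
    from cylinder_cases[OF K(1,2), folded K(3)] show ?case
    proof (elim disjE exE conjE)
      assume "C = {}"
      then show ?thesis by simp
    next
      fix J v assume J: "finite J" "J \<subseteq> {0..}" "C = {f. \<forall>t\<in>J. f t = Some (v t)}"
      show ?thesis
        unfolding J(3) using Markov_finite[OF J(1,2) s A, of x y v] eq[of "{f. \<forall>t\<in>J. f t = Some (v t)}"]
        by (simp add: B_def)
    qed
  next
    case (compl C)
    have C: "C \<in> sets path_space" using compl by (simp add: sets_path_space)
    have "{w \<in> B. (\<lambda>t. X (s + t) w) \<in> UNIV - C} = B - {w \<in> B. (\<lambda>t. X (s + t) w) \<in> C}" by auto
    also have "measure (P x) \<dots> = measure (P x) B - measure (P x) {w \<in> B. (\<lambda>t. X (s + t) w) \<in> C}"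
      using meas(1)[OF C] B by (intro px.finite_measure_Diff) (auto simp: sets_P)
    also have "\<dots> = measure (P x) B * (1 - measure (P y) {w \<in> space M. (\<lambda>t. X t w) \<in> C})"
      using compl(2) by (simp only: right_diff_distrib mult_1_right)
    also have "1 - measure (P y) {w \<in> space M. (\<lambda>t. X t w) \<in> C} =
        measure (P y) (space (P y) - {w \<in> space M. (\<lambda>t. X t w) \<in> C})"
      using meas(2)[OF C] by (rule py.prob_compl[symmetric])
    also have "space (P y) - {w \<in> space M. (\<lambda>t. X t w) \<in> C} =
        {w \<in> space M. (\<lambda>t. X t w) \<in> UNIV - C}" by auto
    finally show ?case .
  next
    case (union C)
    have C: "C i \<in> sets path_space" for i using union by (auto simp: sets_path_space)
    have "(\<lambda>i. measure (P x) {w \<in> B. (\<lambda>t. X (s + t) w) \<in> C i}) sums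
        measure (P x) (\<Union>i. {w \<in> B. (\<lambda>t. X (s + t) w) \<in> C i})"
      using meas(1)[OF C] union(1) by (intro px.finite_measure_UNION) (auto simp: disjoint_family_on_def)
    moreover have "(\<lambda>i. measure (P y) {w \<in> space M. (\<lambda>t. X t w) \<in> C i}) sums
        measure (P y) (\<Union>i. {w \<in> space M. (\<lambda>t. X t w) \<in> C i})"
      using meas(2)[OF C] union(1) by (intro py.finite_measure_UNION) (auto simp: disjoint_family_on_def)
    then have "(\<lambda>i. measure (P x) B * measure (P y) {w \<in> space M. (\<lambda>t. X t w) \<in> C i}) sums
        (measure (P x) B * measure (P y) (\<Union>i. {w \<in> space M. (\<lambda>t. X t w) \<in> C i}))"
      by (rule sums_mult)
    ultimately have "measure (P x) (\<Union>i. {w \<in> B. (\<lambda>t. X (s + t) w) \<in> C i}) =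
        measure (P x) B * measure (P y) (\<Union>i. {w \<in> space M. (\<lambda>t. X t w) \<in> C i})"
      using union(3) by (simp add: sums_unique2)
    moreover have "(\<Union>i. {w \<in> B. (\<lambda>t. X (s + t) w) \<in> C i}) = {w \<in> B. (\<lambda>t. X (s + t) w) \<in> (\<Union>i. C i)}"
      "(\<Union>i. {w \<in> space M. (\<lambda>t. X t w) \<in> C i}) = {w \<in> space M. (\<lambda>t. X t w) \<in> (\<Union>i. C i)}" by auto
    ultimately show ?case by simp
  qed simp_all
  then show ?thesis unfolding eq B_def .
qed

end

section \<open>Skeletons and the generator\<close>

text \<open>A sequence of step sizes, so that dominated convergence and countable unions of events
  are available.\<close>

abbreviation mesh :: "nat \<Rightarrow> real" where
  "mesh m \<equiv> inverse (real (Suc m))"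

lemma mesh_tendsto: "filterlim mesh (at_right 0) sequentially"
  unfolding filterlim_at
  using LIMSEQ_inverse_real_of_nat by (auto simp: eventually_sequentially)

lemma eventually_mesh_less: "0 < d \<Longrightarrow> \<forall>\<^sub>F m in sequentially. mesh m < d"
  using LIMSEQ_inverse_real_of_nat by (rule order_tendstoD)

context killed_markov_chain
begin

definition transition :: "real \<Rightarrow> nat \<Rightarrow> nat \<Rightarrow> real" where
  "transition t x y = measure (P x) {w \<in> space M. X t w = Some y}"

lemma transition_nonneg: "0 \<le> transition t x y"
  by (simp add: transition_def)

lemma transition_le_1: "transition t x y \<le> 1"
  unfolding transition_def using prob_space.prob_le_1[OF prob_space_P] .

lemma Q_tendsto: "(\<lambda>m. (transition (mesh m) x y - of_bool (x = y)) / mesh m) \<longlonglongrightarrow> Q x y"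
  unfolding transition_def by (rule filterlim_compose[OF Q_matrix mesh_tendsto])

lemma Q_nonneg:
  assumes "x \<noteq> y"
  shows "0 \<le> Q x y"
  using Q_tendsto[of x y] assms transition_nonneg by (intro LIMSEQ_le_const) (auto simp del: inverse_inverse_eq)

lemma grid_step:
  assumes h: "0 < h" and F: "finite F" and E: "E \<in> sets path_space"
    and step: "\<And>f. f 0 = Some y \<Longrightarrow> f \<in> E \<longleftrightarrow> f h \<in> Some ` F \<and> (\<lambda>t. f (h + t)) \<in> E"
  shows "measure (P y) {w \<in> space M. (\<lambda>t. X t w) \<in> E} =
    (\<Sum>v\<in>F. transition h y v * measure (P v) {w \<in> space M. (\<lambda>t. X t w) \<in> E})"
proof -
  interpret p: prob_space "P y" by (rule prob_space_P)
  define B where "B v = {w \<in> space M. X h w = Some v \<and> (\<lambda>t. X (h + t) w) \<in> E}" for v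
  have B: "B v \<in> sets (P y)" for v
  proof -
    have "{w \<in> space M. X h w = Some v} \<inter> {w \<in> space M. (\<lambda>t. X (h + t) w) \<in> E} \<in> sets (P y)"
      using sets_X_path[OF _ E, of h] sets_X_eq[of h] h by (auto simp: sets_P)
    then show ?thesis by (rule back_subst[of "\<lambda>S. S \<in> sets (P y)"]) (auto simp: B_def)
  qed
  have "measure (P y) {w \<in> space M. (\<lambda>t. X t w) \<in> E} = measure (P y) (\<Union>v\<in>F. B v)"
  proof (rule p.finite_measure_eq_AE)
    show "AE w in P y. w \<in> {w \<in> space M. (\<lambda>t. X t w) \<in> E} \<longleftrightarrow> w \<in> (\<Union>v\<in>F. B v)"
      using start[of y] AE_space
    proof eventually_elim
      case (elim w)
      then show ?case using step[of "\<lambda>t. X t w"] by (auto simp: B_def)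
    qed
    show "{w \<in> space M. (\<lambda>t. X t w) \<in> E} \<in> sets (P y)"
      using sets_X_path[of 0, OF _ E] by (simp add: sets_P)
  qed (use B F in auto)
  also have "\<dots> = (\<Sum>v\<in>F. measure (P y) (B v))"
    using B F by (intro p.finite_measure_finite_Union) (auto simp: disjoint_family_on_def B_def)
  also have "\<dots> = (\<Sum>v\<in>F. transition h y v * measure (P v) {w \<in> space M. (\<lambda>t. X t w) \<in> E})"
    unfolding B_def transition_def using h by (intro sum.cong refl Markov_path E past_sets_space) auto
  finally show ?thesis .
qed

text \<open>The step equation says that the difference quotient of the transition matrix annihilates
  \<open>u m\<close> in row \<open>y\<close>. As \<open>F\<close> is finite, the limit can be taken
  term by term, with \<open>u m\<close> varying along.\<close>

lemma generator_equation:
  assumes F: "finite F" "y \<in> F"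
    and u: "\<And>v. v \<in> F \<Longrightarrow> (\<lambda>m. u m v) \<longlonglongrightarrow> U v"
    and step: "\<And>m. u m y = (\<Sum>v\<in>F. transition (mesh m) y v * u m v)"
  shows "(\<Sum>v\<in>F. Q y v * U v) = 0"
proof -
  have "(\<lambda>m. \<Sum>v\<in>F. (transition (mesh m) y v - of_bool (y = v)) / mesh m * u m v) \<longlonglongrightarrow> (\<Sum>v\<in>F. Q y v * U v)"
    by (intro tendsto_sum tendsto_mult Q_tendsto u)
  moreover have "(\<Sum>v\<in>F. (transition (mesh m) y v - of_bool (y = v)) / mesh m * u m v) = 0" for m
  proof -
    have "(\<Sum>v\<in>F. (transition (mesh m) y v - of_bool (y = v)) * u m v) = 0"
      using F step[of m]
      by (simp add: left_diff_distrib sum_subtractf of_bool_def if_distrib[of "\<lambda>a. a * _"] cong: if_cong)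
    then have "(\<Sum>v\<in>F. (transition (mesh m) y v - of_bool (y = v)) * u m v) / mesh m = 0" by simp
    then show ?thesis by (simp only: sum_divide_distrib times_divide_eq_left)
  qed
  ultimately show ?thesis by (simp add: LIMSEQ_const_iff)
qed

text \<open>From \<open>y\<close> in \<open>D\<close> the initial stretch in \<open>z\<close> is
  empty: the probability of leaving \<open>D\<close> through \<open>a\<close>. From \<open>z\<close>
  it is the probability that the path, after its stay in \<open>z\<close>, reaches \<open>a\<close>
  through \<open>D\<close> without returning.\<close>

definition pass_prob :: "nat \<Rightarrow> nat set \<Rightarrow> nat \<Rightarrow> nat \<Rightarrow> real" where
  "pass_prob z D a y = measure (P y) {w \<in> space M. passes (Some z) (Some ` D) (Some a) (\<lambda>t. X t w)}"

context
  fixes z a :: nat and D :: "nat set"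
  assumes D: "finite D" "z \<notin> D" "a \<notin> D" "a \<noteq> z"
begin

lemma sets_passes_grid: "0 < h \<Longrightarrow> {f. passes_grid h (Some z) (Some ` D) (Some a) f} \<in> sets path_space"
  using pred_passes_grid[of h z D a] by (simp add: pred_def)

lemma passes_grid_iff_passes:
  assumes "w \<in> space M"
  shows "\<forall>\<^sub>F m in sequentially. passes_grid (mesh m) (Some z) (Some ` D) (Some a) (\<lambda>t. X t w) \<longleftrightarrow>
    passes (Some z) (Some ` D) (Some a) (\<lambda>t. X t w)"
  using D by (intro passes_grid_eventually right_constant_X assms) auto

text \<open>The event quantifies over uncountably many times; measurability is inherited from the
  grid events, which eventually agree with it at every path.\<close>

lemma sets_passes: "{w \<in> space M. passes (Some z) (Some ` D) (Some a) (\<lambda>t. X t w)} \<in> sets M"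
proof -
  have "{w \<in> space M. passes_grid (mesh m) (Some z) (Some ` D) (Some a) (\<lambda>t. X t w)} \<in> sets M" for m
    using sets_X_path[of 0, OF _ sets_passes_grid[of "mesh m"]] by simp
  then have "{w \<in> space M. \<exists>N. \<forall>m. N \<le> m \<longrightarrow> passes_grid (mesh m) (Some z) (Some ` D) (Some a) (\<lambda>t. X t w)} \<in> sets M"
    by measurable
  then show ?thesis
  proof (rule back_subst[of "\<lambda>S. S \<in> sets M"], intro Collect_cong conj_cong refl)
    fix w assume w: "w \<in> space M"
    have "(\<exists>N. \<forall>m\<ge>N. passes_grid (mesh m) (Some z) (Some ` D) (Some a) (\<lambda>t. X t w)) \<longleftrightarrow>
        (\<forall>\<^sub>F m in sequentially. passes_grid (mesh m) (Some z) (Some ` D) (Some a) (\<lambda>t. X t w))"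
      by (simp only: eventually_sequentially)
    also have "\<dots> \<longleftrightarrow> (\<forall>\<^sub>F m::nat in sequentially. passes (Some z) (Some ` D) (Some a) (\<lambda>t. X t w))"
      by (rule eventually_subst[OF passes_grid_iff_passes[OF w]])
    also have "\<dots> \<longleftrightarrow> passes (Some z) (Some ` D) (Some a) (\<lambda>t. X t w)"
      by simp
    finally show "(\<exists>N. \<forall>m\<ge>N. passes_grid (mesh m) (Some z) (Some ` D) (Some a) (\<lambda>t. X t w)) \<longleftrightarrow>
      passes (Some z) (Some ` D) (Some a) (\<lambda>t. X t w)" .
  qed
qed

lemma pass_prob_tendsto:
  "(\<lambda>m. measure (P y) {w \<in> space M. passes_grid (mesh m) (Some z) (Some ` D) (Some a) (\<lambda>t. X t w)})
    \<longlonglongrightarrow> pass_prob z D a y"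
  unfolding pass_prob_def
proof (rule finite_measure.measure_tendsto[OF finite_measure_P])
  show "{w \<in> space M. passes_grid (mesh m) (Some z) (Some ` D) (Some a) (\<lambda>t. X t w)} \<in> sets (P y)" for m
    using sets_X_path[of 0, OF _ sets_passes_grid[of "mesh m"]] by (simp add: sets_P)
  show "{w \<in> space M. passes (Some z) (Some ` D) (Some a) (\<lambda>t. X t w)} \<in> sets (P y)"
    using sets_passes by (simp add: sets_P)
  show "\<forall>\<^sub>F m in sequentially.
      w \<in> {w \<in> space M. passes_grid (mesh m) (Some z) (Some ` D) (Some a) (\<lambda>t. X t w)} \<longleftrightarrow>
      w \<in> {w \<in> space M. passes (Some z) (Some ` D) (Some a) (\<lambda>t. X t w)}" if "w \<in> space (P y)" for w
    using passes_grid_iff_passes[of w] that by simp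
qed

text \<open>State \<open>z\<close> is missing from the sum although \<open>pass_prob z D a z\<close>
  may be positive: a path that has been in \<open>D\<close> must not return to
  \<open>z\<close>.\<close>

lemma pass_prob_inside:
  assumes "y \<in> D"
  shows "(\<Sum>v\<in>insert a D. Q y v * pass_prob z D a v) = 0"
proof (rule generator_equation)
  fix m
  have "measure (P y) {w \<in> space M. (\<lambda>t. X t w) \<in> {f. passes_grid (mesh m) (Some z) (Some ` D) (Some a) f}} =
    (\<Sum>v\<in>insert a D. transition (mesh m) y v *
      measure (P v) {w \<in> space M. (\<lambda>t. X t w) \<in> {f. passes_grid (mesh m) (Some z) (Some ` D) (Some a) f}})"
  proof (rule grid_step)
    fix f :: "real \<Rightarrow> nat option" assume f: "f 0 = Some y"
    have "passes_grid (mesh m) (Some z) (Some ` D) (Some a) f \<longleftrightarrow>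
        f (mesh m) \<in> insert (Some a) (Some ` D) \<and> passes_grid (mesh m) (Some z) (Some ` D) (Some a) (\<lambda>t. f (mesh m + t))"
      using f assms D by (intro passes_grid_step_inside) auto
    then show "f \<in> {f. passes_grid (mesh m) (Some z) (Some ` D) (Some a) f} \<longleftrightarrow> f (mesh m) \<in> Some ` insert a D \<and>
        (\<lambda>t. f (mesh m + t)) \<in> {f. passes_grid (mesh m) (Some z) (Some ` D) (Some a) f}" by simp
  qed (use D sets_passes_grid in auto)
  then show "measure (P y) {w \<in> space M. passes_grid (mesh m) (Some z) (Some ` D) (Some a) (\<lambda>t. X t w)} =
    (\<Sum>v\<in>insert a D. transition (mesh m) y v *
      measure (P v) {w \<in> space M. passes_grid (mesh m) (Some z) (Some ` D) (Some a) (\<lambda>t. X t w)})"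
    by simp
qed (use D assms pass_prob_tendsto in auto)

lemma pass_prob_start:
  "(\<Sum>v\<in>insert z (insert a D). Q z v * pass_prob z D a v) = 0"
proof (rule generator_equation)
  fix m
  have "measure (P z) {w \<in> space M. (\<lambda>t. X t w) \<in> {f. passes_grid (mesh m) (Some z) (Some ` D) (Some a) f}} =
    (\<Sum>v\<in>insert z (insert a D). transition (mesh m) z v *
      measure (P v) {w \<in> space M. (\<lambda>t. X t w) \<in> {f. passes_grid (mesh m) (Some z) (Some ` D) (Some a) f}})"
  proof (rule grid_step)
    fix f :: "real \<Rightarrow> nat option" assume f: "f 0 = Some z"
    have "passes_grid (mesh m) (Some z) (Some ` D) (Some a) f \<longleftrightarrow>
        f (mesh m) \<in> insert (Some z) (insert (Some a) (Some ` D)) \<and>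
        passes_grid (mesh m) (Some z) (Some ` D) (Some a) (\<lambda>t. f (mesh m + t))"
      using f D by (intro passes_grid_step_start) auto
    then show "f \<in> {f. passes_grid (mesh m) (Some z) (Some ` D) (Some a) f} \<longleftrightarrow>
        f (mesh m) \<in> Some ` insert z (insert a D) \<and>
        (\<lambda>t. f (mesh m + t)) \<in> {f. passes_grid (mesh m) (Some z) (Some ` D) (Some a) f}" by simp
  qed (use D sets_passes_grid in auto)
  then show "measure (P z) {w \<in> space M. passes_grid (mesh m) (Some z) (Some ` D) (Some a) (\<lambda>t. X t w)} =
    (\<Sum>v\<in>insert z (insert a D). transition (mesh m) z v *
      measure (P v) {w \<in> space M. passes_grid (mesh m) (Some z) (Some ` D) (Some a) (\<lambda>t. X t w)})"
    by simp
qed (use D pass_prob_tendsto in auto)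

lemma pass_prob_target: "pass_prob z D a a = 1"
proof -
  interpret p: prob_space "P a" by (rule prob_space_P)
  have "AE w in P a. w \<in> {w \<in> space M. passes (Some z) (Some ` D) (Some a) (\<lambda>t. X t w)}"
    using start[of a] AE_space
  proof eventually_elim
    case (elim w)
    then show ?case by (auto simp: passes_def intro!: exI[of _ 0])
  qed
  then show ?thesis unfolding pass_prob_def using sets_passes by (subst p.prob_eq_1) (auto simp: sets_P)
qed

end

section \<open>Almost every path jumps only along positive rates\<close>

definition jump :: "'w \<Rightarrow> real \<Rightarrow> nat \<Rightarrow> nat \<Rightarrow> bool" where
  "jump w r y y' \<longleftrightarrow> 0 < r \<and> (\<forall>\<^sub>F s in at_left r. X s w = Some y) \<and> X r w = Some y'"

text \<open>A jump from \<open>y\<close> to \<open>y'\<close> before time \<open>T\<close> shows on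
  every fine grid as two successive grid values \<open>y\<close>, \<open>y'\<close>. The expected
  number of such pairs is at most about \<open>T / h\<close> times the transition probability over
  \<open>h\<close>, which tends to \<open>T * Q y y' = 0\<close>.\<close>

lemma AE_no_jump:
  assumes Q0: "Q y y' = 0" and ne: "y \<noteq> y'"
  shows "AE w in P x. \<forall>r. \<not> jump w r y y'"
proof -
  interpret p: prob_space "P x" by (rule prob_space_P)
  define B where "B T m = {w \<in> space M. \<exists>k\<in>{..T * Suc m}. X (real k * mesh m) w = Some y \<and>
    X (real k * mesh m + mesh m) w = Some y'}" for T m :: nat
  have B: "B T m \<in> sets (P x)" for T m
  proof -
    have "{w \<in> space M. X (real k * mesh m) w = Some y \<and> X (real k * mesh m + mesh m) w = Some y'} \<in> sets M" for k
      by (intro sets.sets_Collect_conj sets_X_eq) auto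
    then show ?thesis unfolding B_def sets_P by (intro sets.sets_Collect_finite_Ex) auto
  qed
  have null: "AE w in P x. \<not> (\<forall>\<^sub>F m in sequentially. w \<in> B T m)" for T
  proof -
    \<comment> \<open>The number of grid steps equals \<open>(T + mesh m) / mesh m\<close>, which
      turns the transition probability into the difference quotient of
      \<open>Q y y'\<close>.\<close>
    define b where "b m = real (Suc (T * Suc m)) * transition (mesh m) y y'" for m
    have "measure (P x) (B T m) \<le> b m" for m
    proof -
      define C where "C k = {w \<in> space M. X (real k * mesh m) w = Some y \<and> X (real k * mesh m + mesh m) w = Some y'}" for k
      have C: "C k \<in> sets (P x)" for k
        unfolding C_def sets_P by (intro sets.sets_Collect_conj sets_X_eq) auto
      have "B T m = (\<Union>k\<in>{..T * Suc m}. C k)" by (auto simp: B_def C_def)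
      then have "measure (P x) (B T m) \<le> (\<Sum>k\<in>{..T * Suc m}. measure (P x) (C k))"
        using C by (auto intro!: p.finite_measure_subadditive_finite)
      also have "\<dots> \<le> (\<Sum>k\<in>{..T * Suc m}. transition (mesh m) y y')"
      proof (rule sum_mono)
        fix k
        have "measure (P x) (C k) = measure (P x) {w \<in> space M. X (real k * mesh m) w = Some y} * transition (mesh m) y y'"
          unfolding C_def transition_def by (rule Markov) (auto simp: past_sets_space)
        also have "\<dots> \<le> 1 * transition (mesh m) y y'"
          by (intro mult_right_mono p.prob_le_1 transition_nonneg)
        finally show "measure (P x) (C k) \<le> transition (mesh m) y y'" by simp
      qed
      also have "\<dots> = b m" by (simp add: b_def)
      finally show ?thesis .
    qed
    moreover have "b \<longlonglongrightarrow> (real T + 0) * Q y y'"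
    proof -
      have "b = (\<lambda>m. (real T + mesh m) * ((transition (mesh m) y y' - of_bool (y = y')) / mesh m))"
        using ne by (auto simp: b_def field_simps fun_eq_iff)
      moreover have "(\<lambda>m. (real T + mesh m) * ((transition (mesh m) y y' - of_bool (y = y')) / mesh m)) \<longlonglongrightarrow>
        (real T + 0) * Q y y'"
        by (intro tendsto_intros Q_tendsto LIMSEQ_inverse_real_of_nat)
      ultimately show ?thesis by (simp only:)
    qed
    ultimately have "measure (P x) {w \<in> space (P x). \<forall>\<^sub>F m in sequentially. w \<in> B T m} \<le> (real T + 0) * Q y y'"
      using B by (intro p.measure_eventually_le) auto
    then have 0: "measure (P x) {w \<in> space M. \<forall>\<^sub>F m in sequentially. w \<in> B T m} = 0"
      using Q0 by (simp add: measure_le_0_iff)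
    have "(\<Inter>m\<in>{N..}. B T m) \<in> sets (P x)" for N
      using B by (intro sets.countable_INT') auto
    then have "(\<Union>N. \<Inter>m\<in>{N..}. B T m) \<in> sets (P x)" by blast
    moreover have "(\<Union>N. \<Inter>m\<in>{N..}. B T m) = {w \<in> space M. \<forall>\<^sub>F m in sequentially. w \<in> B T m}"
      using B[THEN sets.sets_into_space] by (auto simp: eventually_sequentially)
    ultimately have "{w \<in> space M. \<forall>\<^sub>F m in sequentially. w \<in> B T m} \<in> null_sets (P x)"
      using 0 by (simp add: null_sets_def p.emeasure_eq_measure)
    then show ?thesis by (rule AE_I') auto
  qed
  have "AE w in P x. \<forall>T. \<not> (\<forall>\<^sub>F m in sequentially. w \<in> B T m)"
    using null by (simp add: AE_all_countable)
  with AE_space show ?thesis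
  proof eventually_elim
    case (elim w)
    show ?case
    proof (intro allI notI)
      fix r assume "jump w r y y'"
      then have r: "0 < r" "\<forall>\<^sub>F s in at_left r. X s w = Some y" "X r w = Some y'" by (auto simp: jump_def)
      obtain b where b: "b < r" "\<And>s. b < s \<Longrightarrow> s < r \<Longrightarrow> X s w = Some y"
        using r(2) unfolding eventually_at_left_field by blast
      obtain d where d: "d > 0" "\<And>s. r \<le> s \<Longrightarrow> s < r + d \<Longrightarrow> X s w = Some y'"
        using right_constantD[OF right_constant_X[of w], of r] elim(1) r by auto
      \<comment> \<open>For a mesh below \<open>e\<close> the last grid point before
        \<open>r\<close> lies in \<open>(b, r)\<close> and the next one in
        \<open>[r, r + d)\<close>.\<close>
      define e where "e = min d (min r (r - b))"
      have e: "0 < e" "e \<le> d" "e \<le> r" "e \<le> r - b" using r b d by (auto simp: e_def)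
      obtain T :: nat where T: "r \<le> real T" using real_arch_simple by blast
      have "\<forall>\<^sub>F m in sequentially. w \<in> B T m"
        using eventually_mesh_less[OF e(1)]
      proof eventually_elim
        case (elim m)
        have h: "0 < mesh m" by simp
        obtain k :: nat where k: "r \<le> real k * mesh m" "real k * mesh m < r + mesh m"
            "\<And>j. j < k \<Longrightarrow> real j * mesh m < r"
          using first_grid_point[OF h, of r] r(1) by (auto simp: less_imp_le)
        have "k \<noteq> 0" using k(1) r(1) by (cases k) auto
        then obtain j where j: "k = Suc j" by (cases k) auto
        have jr: "real j * mesh m < r" using k(3) j by simp
        have jk: "real j * mesh m + mesh m = real k * mesh m" using j by (simp add: algebra_simps)
        have "b < real j * mesh m" using k(1) jk e elim by linarith
        then have "X (real j * mesh m) w = Some y" using b(2) jr by simp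
        moreover have "X (real j * mesh m + mesh m) w = Some y'"
          unfolding jk using k e elim by (intro d(2)) auto
        moreover have "j \<le> T * Suc m"
        proof -
          have "real j * mesh m < real T" using jr T by simp
          then have "real j < real T * real (Suc m)" by (simp add: field_simps)
          then have "real j < real (T * Suc m)" by (simp only: of_nat_mult)
          then show ?thesis by (simp only: of_nat_less_iff less_imp_le)
        qed
        ultimately show ?case using \<open>w \<in> space (P x)\<close> by (auto simp: B_def)
      qed
      then show False using elim by blast
    qed
  qed
qed

definition regular_path :: "'w \<Rightarrow> bool" where
  "regular_path w \<longleftrightarrow> w \<in> space M \<and> (\<forall>y y' r. jump w r y y' \<longrightarrow> y = y' \<or> Q y y' \<noteq> 0)"

lemma AE_regular_path: "AE w in P x. regular_path w"
proof -
  have "AE w in P x. y \<noteq> y' \<and> Q y y' = 0 \<longrightarrow> (\<forall>r. \<not> jump w r y y')" for y y'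
    using AE_no_jump[of y y' x] by (cases "y \<noteq> y' \<and> Q y y' = 0") auto
  then have "AE w in P x. \<forall>y y'. y \<noteq> y' \<and> Q y y' = 0 \<longrightarrow> (\<forall>r. \<not> jump w r y y')"
    by (simp add: AE_all_countable)
  with AE_space show ?thesis by eventually_elim (auto simp: regular_path_def)
qed

text \<open>At the first exit time \<open>r\<close> the path is alive, because it is alive at the
  later time \<open>b\<close>, so it has a left limit there. This limit is a state of
  \<open>C\<close>, and regularity makes the rate of the jump nonzero.\<close>

lemma exit_jump:
  assumes w: "regular_path w" and ab: "0 \<le> a" "a \<le> b"
    and a: "X a w \<in> Some ` C" and b: "X b w = Some v" "v \<notin> C"
  shows "\<exists>r y y'. a < r \<and> r \<le> b \<and> y \<in> C \<and> y' \<notin> C \<and> Q y y' \<noteq> 0 \<and> X r w = Some y' \<and>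
    (\<forall>s. a \<le> s \<and> s < r \<longrightarrow> X s w \<in> Some ` C)"
proof -
  have wM: "w \<in> space M" using w by (simp add: regular_path_def)
  have "X b w \<in> - Some ` C" using b by auto
  from first_time[OF right_constant_X[OF wM] ab this]
  obtain r where r: "a \<le> r" "r \<le> b" "X r w \<notin> Some ` C" "\<And>s. a \<le> s \<Longrightarrow> s < r \<Longrightarrow> X s w \<in> Some ` C"
    by blast
  have ar: "a < r" using r a by (cases "a = r") auto
  have "X r w \<noteq> None" using None_absorbing[OF wM, of r b] b r ab by auto
  then obtain y' where y': "X r w = Some y'" by auto
  have "ereal r < explosion_time X w"
    using killed_at_explosion[OF wM, of r] y' ar ab by (simp add: not_le)
  then obtain y where y: "\<forall>\<^sub>F s in at_left r. X s w = Some y"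
    using left_limits[OF wM, of r] ar ab by auto
  have "\<forall>\<^sub>F s in at_left r. a < s \<and> s < r"
    using eventually_at_left_real[OF ar] by simp
  with y have "\<forall>\<^sub>F s in at_left r. X s w = Some y \<and> a < s \<and> s < r"
    by (rule eventually_conj)
  then obtain s where "X s w = Some y" "a < s" "s < r"
    using eventually_happens[of _ "at_left r"] trivial_limit_at_left_real by blast
  then have "y \<in> C" using r(4)[of s] by auto
  moreover have "y' \<notin> C" using r(3) y' by auto
  moreover have "Q y y' \<noteq> 0"
    using w y y' ar ab calculation unfolding regular_path_def jump_def by force
  ultimately show ?thesis using ar r y' by blast
qed

end

section \<open>The scale matrix\<close>

lemma hit_less_iff: "hit X A w < y \<longleftrightarrow> (\<exists>t>0. ereal t < y \<and> X t w \<in> Some ` A)"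
  unfolding hit_def Inf_less_iff by auto

text \<open>Used to replace real times by rational ones, so that events about hitting become
  countable unions.\<close>

lemma right_constant_rat:
  assumes f: "right_constant f" and t: "0 \<le> t" "ereal t < y"
  shows "\<exists>q::rat. t < of_rat q \<and> ereal (of_rat q) < y \<and> f (of_rat q) = f t"
proof -
  obtain d where d: "d > 0" "\<And>s. t \<le> s \<Longrightarrow> s < t + d \<Longrightarrow> f s = f t"
    using right_constantD[OF f t(1)] by blast
  obtain b where b: "ereal t < ereal b" "ereal b < y" using ereal_dense2[OF t(2)] by blast
  have "t < min b (t + d)" using b d by simp
  then obtain q :: rat where q: "t < of_rat q" "of_rat q < min b (t + d)" using of_rat_dense by blast
  have "ereal (of_rat q) < y" using q(2) b(2) by (auto intro: less_trans[of _ "ereal b"])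
  then show ?thesis using q d(2)[of "of_rat q"] by auto
qed

lemma (in finite_measure) not_AE_notin:
  assumes "0 < measure M S"
  shows "\<not> (AE w in M. w \<notin> S)"
proof
  assume AE: "AE w in M. w \<notin> S"
  \<comment> \<open>\<open>measure\<close> is 0 outside the sigma-algebra, so positivity includes
    measurability.\<close>
  have "S \<in> sets M" using assms measure_notin_sets by force
  then have "S \<in> null_sets M" using AE AE_iff_null_sets[of S M] by simp
  then show False using assms by (simp add: measure_eq_0_null_sets)
qed

context killed_markov_chain
begin

lemma hit_eq:
  assumes w: "w \<in> space M" and 0: "X 0 w \<notin> Some ` A" and hit: "hit X A w < \<infinity>"
  shows "\<exists>r>0. hit X A w = ereal r \<and> X r w \<in> Some ` A \<and> (\<forall>s. 0 \<le> s \<and> s < r \<longrightarrow> X s w \<notin> Some ` A)"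
proof -
  obtain t where t: "0 < t" "X t w \<in> Some ` A" using hit unfolding hit_less_iff by blast
  obtain r where r: "0 \<le> r" "X r w \<in> Some ` A" "\<And>s. 0 \<le> s \<Longrightarrow> s < r \<Longrightarrow> X s w \<notin> Some ` A"
    using first_time[OF right_constant_X[OF w] order_refl less_imp_le[OF t(1)] t(2)] by blast
  have r0: "0 < r" using r 0 by (cases "r = 0") auto
  have "hit X A w = ereal r"
  proof (rule antisym)
    show "hit X A w \<le> ereal r" unfolding hit_def using r r0 by (intro Inf_lower) auto
    show "ereal r \<le> hit X A w" unfolding hit_def
    proof (rule Inf_greatest)
      fix e assume "e \<in> ereal ` {t. 0 < t \<and> X t w \<in> Some ` A}"
      then obtain t where t: "e = ereal t" "0 < t" "X t w \<in> Some ` A" by blast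
      then show "ereal r \<le> e" using r(3)[of t] by (cases "t < r") auto
    qed
  qed
  then show ?thesis using r r0 by blast
qed

lemma measurable_hit [measurable]: "hit X A \<in> borel_measurable M"
proof (rule borel_measurableI_less)
  fix y :: ereal
  have "{w \<in> space M. hit X A w < y} =
    (\<Union>q\<in>{q::rat. 0 < (of_rat q :: real) \<and> ereal (of_rat q) < y}. X (of_rat q) -` (Some ` A) \<inter> space M)"
  proof (intro set_eqI iffI)
    fix w assume "w \<in> {w \<in> space M. hit X A w < y}"
    then obtain t where w: "w \<in> space M" and t: "0 < t" "ereal t < y" "X t w \<in> Some ` A"
      unfolding hit_less_iff by blast
    obtain q :: rat where "t < of_rat q" "ereal (of_rat q) < y" "X (of_rat q) w = X t w"
      using right_constant_rat[OF right_constant_X[OF w], of t y] t by auto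
    moreover have "0 < (of_rat q :: real)" using calculation t by linarith
    ultimately show "w \<in> (\<Union>q\<in>{q::rat. 0 < (of_rat q :: real) \<and> ereal (of_rat q) < y}. X (of_rat q) -` (Some ` A) \<inter> space M)"
      using w t by (intro UN_I[of q]) auto
  next
    fix w assume "w \<in> (\<Union>q\<in>{q::rat. 0 < (of_rat q :: real) \<and> ereal (of_rat q) < y}. X (of_rat q) -` (Some ` A) \<inter> space M)"
    then show "w \<in> {w \<in> space M. hit X A w < y}" unfolding hit_less_iff by blast
  qed
  also have "\<dots> \<in> sets M"
    by (intro sets.countable_UN' image_subsetI measurable_sets[OF measurable_X]) auto
  finally show "{w \<in> space M. hit X A w < y} \<in> sets M" .
qed

lemma measurable_return_time [measurable]: "return_time X z \<in> borel_measurable M"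
proof (rule borel_measurableI_less)
  fix y :: ereal
  define R where "R = {q::rat. 0 < (of_rat q :: real) \<and> ereal (of_rat q) < y}"
  have exit0: "0 \<le> exit_time X z w" for w
    unfolding exit_time_def hit_def by (rule Inf_greatest) auto
  have "{w \<in> space M. return_time X z w < y} =
    (\<Union>q\<in>R. {w \<in> space M. exit_time X z w < ereal (of_rat q)} \<inter> {w \<in> space M. X (of_rat q) w = Some z})"
  proof (intro set_eqI iffI)
    fix w assume "w \<in> {w \<in> space M. return_time X z w < y}"
    then obtain t where w: "w \<in> space M" and t: "exit_time X z w < ereal t" "ereal t < y" "X t w = Some z"
      unfolding return_time_def Inf_less_iff by auto
    have t0: "0 < t" using exit0[of w] t(1) by (metis ereal_less(2) le_less_trans)
    obtain q :: rat where q: "t < of_rat q" "ereal (of_rat q) < y" "X (of_rat q) w = X t w"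
      using right_constant_rat[OF right_constant_X[OF w], of t y] t t0 by auto
    have "exit_time X z w < ereal (of_rat q)" using t(1) q(1) by (auto intro: less_trans[of _ "ereal t"])
    moreover have "0 < (of_rat q :: real)" using q t0 by linarith
    ultimately show "w \<in> (\<Union>q\<in>R. {w \<in> space M. exit_time X z w < ereal (of_rat q)} \<inter> {w \<in> space M. X (of_rat q) w = Some z})"
      using w t t0 q by (intro UN_I[of q]) (auto simp: R_def)
  next
    fix w assume "w \<in> (\<Union>q\<in>R. {w \<in> space M. exit_time X z w < ereal (of_rat q)} \<inter> {w \<in> space M. X (of_rat q) w = Some z})"
    then show "w \<in> {w \<in> space M. return_time X z w < y}"
      unfolding return_time_def Inf_less_iff R_def by auto
  qed
  also have "\<dots> \<in> sets M"
  proof (intro sets.countable_UN' image_subsetI sets.Int)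
    fix q assume "q \<in> R"
    then show "{w \<in> space M. X (of_rat q) w = Some z} \<in> sets M" by (intro sets_X_eq) (auto simp: R_def)
    show "{w \<in> space M. exit_time X z w < ereal (of_rat q)} \<in> sets M"
      unfolding exit_time_def by measurable
  qed auto
  finally show "{w \<in> space M. return_time X z w < y} \<in> sets M" .
qed

end

section \<open>Skip-free paths, signs of the rates, and excursions\<close>

context downward_skip_free_chain
begin

lemma crossing:
  assumes w: "regular_path w" and ab: "0 \<le> a" "a \<le> b"
    and a: "X a w = Some v" "c < v" and b: "X b w = Some v'" "v' \<le> c"
  shows "\<exists>r. a < r \<and> r \<le> b \<and> X r w = Some c"
proof -
  have ac: "X a w \<in> Some ` {c<..}" using a by auto
  have bc: "v' \<notin> {c<..}" using b by auto
  obtain r y y' where r: "a < r" "r \<le> b" "y \<in> {c<..}" "y' \<notin> {c<..}" "Q y y' \<noteq> 0" "X r w = Some y'"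
    using exit_jump[OF w ab ac b(1) bc] by blast
  have "\<not> y' + 2 \<le> y" using skip_free r(5) by blast
  then have "y' = c" using r(3,4) by auto
  then show ?thesis using r by blast
qed

lemma Q_0: "Q 0 y = 0"
proof -
  have "transition t 0 y = of_bool (0 = y)" if "0 \<le> t" for t
  proof -
    interpret p: prob_space "P 0" by (rule prob_space_P)
    have "transition t 0 0 = 1"
      unfolding transition_def using trap[OF that] that AE_space[of "P 0"]
      by (subst p.prob_eq_1) (auto simp: sets_P intro: sets_X_eq)
    moreover have "transition t 0 y = 0" if "y \<noteq> 0"
      unfolding transition_def using trap[OF \<open>0 \<le> t\<close>] that \<open>0 \<le> t\<close>
      by (subst p.prob_eq_0) (auto simp: sets_P intro!: sets_X_eq elim!: eventually_mono)
    ultimately show ?thesis by (cases "y = 0") auto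
  qed
  then have "(\<lambda>m. (transition (mesh m) 0 y - of_bool (0 = y)) / mesh m) = (\<lambda>m. 0)" by simp
  then show ?thesis using Q_tendsto[of 0 y] by (simp only: LIMSEQ_const_iff)
qed

text \<open>The axiom \<open>trap\<close> speaks of one fixed time under \<open>P 0\<close>. For a
  single path the reason is different: leaving 0 would be a jump, and row 0 of \<open>Q\<close>
  vanishes.\<close>

lemma absorbing_0:
  assumes w: "regular_path w" and st: "0 \<le> s" "s \<le> t" and s: "X s w = Some 0"
  shows "X t w = Some 0"
proof -
  have wM: "w \<in> space M" using w by (simp add: regular_path_def)
  have stay: "v = 0" if "X u w = Some v" "s \<le> u" for u v
    using exit_jump[OF w st(1) that(2) _ that(1), of "{0}"] s Q_0 by auto
  show ?thesis
  proof (cases "X t w")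
    case None
    have "\<not> explosion_time X w \<le> ereal s" using killed_at_explosion[OF wM st(1)] s by simp
    then have "ereal s < (SUP z. hit X {z..} w)" by (simp add: explosion_time_def not_le)
    then obtain z where z: "ereal s < hit X {z..} w" unfolding less_SUP_iff by blast
    \<comment> \<open>To explode, the path must still rise above level \<open>z\<close> after time
      \<open>s\<close>. Level \<open>Suc z\<close> is used because \<open>z\<close> might be 0, and
      a visit to \<open>{0..}\<close> would not contradict staying in 0.\<close>
    have "hit X {Suc z..} w \<le> explosion_time X w"
      unfolding explosion_time_def by (rule SUP_upper) simp
    also have "\<dots> \<le> ereal t" using killed_at_explosion[OF wM, of t] None st by simp
    finally have "hit X {Suc z..} w < \<infinity>" by (rule le_less_trans) simp
    then obtain u where u: "0 < u" "X u w \<in> Some ` {Suc z..}" unfolding hit_less_iff by blast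
    have "hit X {z..} w \<le> ereal u" unfolding hit_def using u by (intro Inf_lower) auto
    then have "s < u" using z by (metis ereal_less_eq(3) linorder_not_less order_trans)
    then show ?thesis using u(2) stay[of u] by auto
  next
    case (Some v)
    then show ?thesis using stay[of t v] st by simp
  qed
qed

text \<open>A hitting event of positive probability contains a regular path, and a single regular
  path already exhibits nonzero rates.\<close>

lemma hits:
  assumes "1 \<le> x"
  shows "\<exists>w. regular_path w \<and> X 0 w = Some x \<and> (\<exists>t>0. X t w = Some y)"
proof (rule ccontr)
  assume none: "\<not> ?thesis"
  have "AE w in P x. w \<notin> {w \<in> space M. hit X {y} w < \<infinity>}"
    using AE_regular_path[of x] start[of x]
  proof eventually_elim
    case (elim w)
    then show ?case using none unfolding hit_less_iff by auto
  qed
  then show False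
    using finite_measure.not_AE_notin[OF finite_measure_P irreducible[OF assms, of y]] by simp
qed

text \<open>A path from \<open>y\<close> to 0 must leave \<open>{y..}\<close>, and the only jump out
  of this set that skip-freeness permits is the one from \<open>y\<close> to
  \<open>y - 1\<close>.\<close>

lemma Q_down_pos:
  assumes "1 \<le> y"
  shows "0 < Q y (y - 1)"
proof -
  obtain w t where w: "regular_path w" "X 0 w = Some y" "0 < t" "X t w = Some 0"
    using hits[OF assms, of 0] by blast
  have C: "X 0 w \<in> Some ` {y..}" "0 \<notin> {y..}" using w assms by auto
  obtain v v' where v: "v \<in> {y..}" "v' \<notin> {y..}" "Q v v' \<noteq> 0"
    using exit_jump[OF w(1) order_refl less_imp_le[OF w(3)] C(1) w(4) C(2)] by blast
  have "\<not> v' + 2 \<le> v" using skip_free v(3) by blast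
  then have "v = y" "v' = y - 1" using v by auto
  then show ?thesis using v Q_nonneg[of y "y - 1"] assms by simp
qed

lemma irreducible_exit:
  assumes "Z \<noteq> {}" "Z \<subseteq> {1..<n}"
  shows "\<exists>w\<in>Z. \<exists>v. v \<notin> insert 0 Z \<and> 0 < Q w v"
proof -
  obtain y where y: "y \<in> Z" using assms by blast
  then have "1 \<le> y" using assms by auto
  then obtain w t where w: "regular_path w" "X 0 w = Some y" "0 < t" "X t w = Some (Suc n)"
    using hits[of y "Suc n"] by blast
  \<comment> \<open>Adding 0 to the set keeps the exit jump from ending in 0; it cannot start there
    either, since row 0 of \<open>Q\<close> vanishes.\<close>
  have C: "X 0 w \<in> Some ` insert 0 Z" "Suc n \<notin> insert 0 Z" using w y assms by auto
  obtain v v' where v: "v \<in> insert 0 Z" "v' \<notin> insert 0 Z" "Q v v' \<noteq> 0"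
    using exit_jump[OF w(1) order_refl less_imp_le[OF w(3)] C(1) w(4) C(2)] by blast
  have "v \<noteq> 0" using v(3) by (cases "v = 0") (simp_all add: Q_0)
  moreover have "v \<noteq> v'" using v by blast
  then have "0 < Q v v'" using v(3) Q_nonneg[of v v'] by simp
  ultimately show ?thesis using v(1,2) by blast
qed

text \<open>Between leaving \<open>z\<close> and hitting \<open>x\<close> the path stays strictly
  between them: from above \<open>z\<close> it would have to cross \<open>z\<close> on its way down,
  and it cannot get below \<open>x\<close> without visiting \<open>x\<close>.\<close>

lemma hit_less_return_iff_passes:
  assumes w: "regular_path w" and 0: "X 0 w = Some z" and xz: "x < z"
  shows "hit X {x} w < return_time X z w \<longleftrightarrow> passes (Some z) (Some ` {x<..<z}) (Some x) (\<lambda>t. X t w)"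
proof
  have wM: "w \<in> space M" using w by (simp add: regular_path_def)
  assume hr: "hit X {x} w < return_time X z w"
  then have "hit X {x} w < \<infinity>" by auto
  then obtain t where t: "0 < t" "hit X {x} w = ereal t" "X t w = Some x"
      "\<And>s. 0 \<le> s \<Longrightarrow> s < t \<Longrightarrow> X s w \<noteq> Some x"
    using hit_eq[OF wM, of "{x}"] 0 xz by auto
  have ex: "exit_time X z w \<le> ereal t"
    unfolding exit_time_def hit_def using t xz by (intro Inf_lower) auto
  then have "hit X (UNIV - {z}) w < \<infinity>" unfolding exit_time_def by (rule le_less_trans) simp
  then obtain u where u: "0 < u" "exit_time X z w = ereal u" "X u w \<in> Some ` (UNIV - {z})"
      "\<And>s. 0 \<le> s \<Longrightarrow> s < u \<Longrightarrow> X s w \<notin> Some ` (UNIV - {z})"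
    using hit_eq[OF wM, of "UNIV - {z}"] 0 unfolding exit_time_def by auto
  have ut: "u \<le> t" using ex u(2) by simp
  have alive: "X s w \<noteq> None" if "0 \<le> s" "s \<le> t" for s
    using None_absorbing[OF wM that] t(3) by auto
  have noz: "X s w \<noteq> Some z" if "u \<le> s" "s \<le> t" for s
  proof
    assume s: "X s w = Some z"
    then have "u < s" using u(3) that by (cases "u = s") auto
    then have "return_time X z w \<le> ereal s"
      unfolding return_time_def using s u(2) by (intro Inf_lower) auto
    also have "\<dots> \<le> hit X {x} w" using t that by simp
    finally show False using hr by simp
  qed
  have "X s w = Some z" if "0 \<le> s" "s < u" for s
  proof -
    have "X s w \<noteq> None" using that ut by (intro alive) auto
    then obtain v where v: "X s w = Some v" by auto
    then show ?thesis using u(4)[OF that] by auto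
  qed
  moreover have "X s w \<in> Some ` {x<..<z}" if s: "u \<le> s" "s < t" for s
  proof -
    have "X s w \<noteq> None" using s u by (intro alive) auto
    then obtain v where v: "X s w = Some v" by auto
    have "v \<noteq> x" using t(4)[of s] s u v by auto
    moreover have "v \<noteq> z" using noz[of s] s v by auto
    moreover have "\<not> z < v"
    proof
      assume "z < v"
      then obtain r where "s < r" "r \<le> t" "X r w = Some z"
        using crossing[OF w, of s t v z x] s u v t xz by auto
      then show False using noz[of r] s by auto
    qed
    moreover have "\<not> v < x"
    proof
      assume "v < x"
      then obtain r where "0 < r" "r \<le> s" "X r w = Some x"
        using crossing[OF w, of 0 s z x v] s u v 0 xz by auto
      then show False using t(4)[of r] s by auto
    qed
    ultimately show ?thesis using v by auto
  qed
  ultimately show "passes (Some z) (Some ` {x<..<z}) (Some x) (\<lambda>t. X t w)"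
    unfolding passes_def using u ut t by (intro exI[of _ u] exI[of _ t]) auto
next
  have wM: "w \<in> space M" using w by (simp add: regular_path_def)
  assume "passes (Some z) (Some ` {x<..<z}) (Some x) (\<lambda>t. X t w)"
  then obtain u t where ut: "0 \<le> u" "u \<le> t" "\<And>s. 0 \<le> s \<Longrightarrow> s < u \<Longrightarrow> X s w = Some z"
      "\<And>s. u \<le> s \<Longrightarrow> s < t \<Longrightarrow> X s w \<in> Some ` {x<..<z}" "X t w = Some x"
    unfolding passes_def by blast
  have t0: "0 < t"
  proof (rule ccontr)
    assume "\<not> 0 < t"
    then have "t = 0" using ut by simp
    then show False using ut(5) 0 xz by simp
  qed
  obtain d where d: "d > 0" "\<And>s. t \<le> s \<Longrightarrow> s < t + d \<Longrightarrow> X s w = X t w"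
    using right_constantD[OF right_constant_X[OF wM] less_imp_le[OF t0]] by blast
  have ex: "ereal u \<le> exit_time X z w"
    unfolding exit_time_def hit_def
  proof (rule Inf_greatest)
    fix e assume "e \<in> ereal ` {t. 0 < t \<and> X t w \<in> Some ` (UNIV - {z})}"
    then obtain s v where "e = ereal s" "0 < s" "X s w = Some v" "v \<noteq> z" by blast
    then show "ereal u \<le> e" using ut(3)[of s] by (cases "s < u") auto
  qed
  \<comment> \<open>The stay in \<open>x\<close> of length \<open>d\<close> after time
    \<open>t\<close> makes the comparison of the two infima strict.\<close>
  have "ereal (t + d) \<le> return_time X z w"
    unfolding return_time_def
  proof (rule Inf_greatest)
    fix e assume "e \<in> ereal ` {t. exit_time X z w < ereal t \<and> X t w = Some z}"
    then obtain s where s: "e = ereal s" "exit_time X z w < ereal s" "X s w = Some z" by blast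
    have "ereal u < ereal s" using ex s(2) by (rule le_less_trans)
    then have "u < s" by simp
    then have "t \<le> s" using ut(4)[of s] s by (cases "s < t") auto
    then show "ereal (t + d) \<le> e" using d(2)[of s] s ut(5) xz by (cases "s < t + d") auto
  qed
  moreover have "hit X {x} w \<le> ereal t"
    unfolding hit_def using t0 ut by (intro Inf_lower) auto
  moreover have "ereal t < ereal (t + d)" using d by simp
  ultimately show "hit X {x} w < return_time X z w" by (meson le_less_trans less_le_trans)
qed

lemma excursion_laplace_0:
  assumes xz: "x < z"
  shows "excursion_laplace P X Q 0 z x = - Q z z * pass_prob z {x<..<z} x z"
proof -
  interpret p: prob_space "P z" by (rule prob_space_P)
  define S where "S = {w. hit X {x} w < return_time X z w}"
  have "(LINT w|P z. indicator S w * exp (- 0 * real_of_ereal (hit X {x} w - exit_time X z w)))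
      = (LINT w|P z. indicator S w)" by simp
  also have "\<dots> = measure (P z) (S \<inter> space M)" by simp
  also have "S \<inter> space M = {w \<in> space M. hit X {x} w < return_time X z w}" by (auto simp: S_def)
  also have "measure (P z) \<dots> =
    measure (P z) {w \<in> space M. passes (Some z) (Some ` {x<..<z}) (Some x) (\<lambda>t. X t w)}"
  proof (rule p.finite_measure_eq_AE)
    show "AE w in P z. w \<in> {w \<in> space M. hit X {x} w < return_time X z w} \<longleftrightarrow>
        w \<in> {w \<in> space M. passes (Some z) (Some ` {x<..<z}) (Some x) (\<lambda>t. X t w)}"
      using AE_regular_path[of z] start[of z]
    proof eventually_elim
      case (elim w)
      then show ?case using hit_less_return_iff_passes[OF _ _ xz, of w] by simp
    qed
    have "{w \<in> space M. hit X {x} w < return_time X z w} \<in> sets M" by measurable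
    then show "{w \<in> space M. hit X {x} w < return_time X z w} \<in> sets (P z)" by (simp add: sets_P)
    show "{w \<in> space M. passes (Some z) (Some ` {x<..<z}) (Some x) (\<lambda>t. X t w)} \<in> sets (P z)"
      unfolding sets_P using xz by (intro sets_passes) auto
  qed
  finally show ?thesis unfolding excursion_laplace_def pass_prob_def S_def by simp
qed

text \<open>Skip-freeness trims the range of summation so that it no longer involves
  \<open>x\<close>. This is what makes the solutions for different \<open>x\<close>
  comparable.\<close>

lemma pass_prob_equation:
  assumes "x < y" "y < z"
  shows "(\<Sum>v\<in>{y - 1..<z}. Q y v * pass_prob z {x<..<z} x v) = 0"
proof -
  have "(\<Sum>v\<in>insert x {x<..<z}. Q y v * pass_prob z {x<..<z} x v) = 0"
    using assms by (intro pass_prob_inside) auto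
  moreover have "(\<Sum>v\<in>{y - 1..<z}. Q y v * pass_prob z {x<..<z} x v) =
      (\<Sum>v\<in>insert x {x<..<z}. Q y v * pass_prob z {x<..<z} x v)"
    using assms by (intro sum.mono_neutral_left) (auto simp: skip_free)
  ultimately show ?thesis by simp
qed

text \<open>Upward jumps from \<open>z\<close> do not contribute, because the path comes back
  through \<open>z\<close> before it reaches \<open>x\<close>. What remains of the equation at
  \<open>z\<close> are the states \<open>z\<close> and \<open>z - 1\<close>.\<close>

lemma excursion_scale_eq:
  assumes "x < z"
  shows "excursion_scale P X Q 0 x z = 1 / (Q z (z - 1) * pass_prob z {x<..<z} x (z - 1))"
proof -
  have "(\<Sum>v\<in>insert z (insert x {x<..<z}). Q z v * pass_prob z {x<..<z} x v) = 0"
    using assms by (intro pass_prob_start) auto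
  moreover have "(\<Sum>v\<in>insert z (insert x {x<..<z}). Q z v * pass_prob z {x<..<z} x v)
      = (\<Sum>v\<in>{z - 1, z}. Q z v * pass_prob z {x<..<z} x v)"
    using assms by (intro sum.mono_neutral_right) (auto simp: skip_free)
  ultimately have "- Q z z * pass_prob z {x<..<z} x z = Q z (z - 1) * pass_prob z {x<..<z} x (z - 1)"
    using assms by simp
  then show ?thesis using assms excursion_laplace_0[OF assms] by (simp add: excursion_scale_def)
qed

text \<open>
  Row \<open>y + 1\<close> of the equation expresses the value at \<open>y\<close> through those at larger states, so up to
  the factor \<open>pass_prob z {x<..<z} x (z - 1)\<close> the solution does not depend on \<open>x\<close>.
\<close>

lemma pass_prob_factor:
  assumes "y < z"
  shows "pass_prob z {y<..<z} y (z - 1) \<noteq> 0 \<and>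
    (\<forall>x\<le>y. pass_prob z {x<..<z} x y * pass_prob z {y<..<z} y (z - 1) = pass_prob z {x<..<z} x (z - 1))"
  using assms
proof (induction "z - y" arbitrary: y rule: less_induct)
  case less
  define u where "u = (\<lambda>x. pass_prob z {x<..<z} x)"
  have u1: "u x x = 1" if "x < z" for x unfolding u_def using that by (intro pass_prob_target) auto
  have "u y (z - 1) \<noteq> 0 \<and> (\<forall>x\<le>y. u x y * u y (z - 1) = u x (z - 1))"
  proof (cases "y = z - 1")
    case True
    then show ?thesis using u1[of y] less.prems by simp
  next
    case False
    have IH: "u v (z - 1) \<noteq> 0 \<and> (\<forall>x\<le>v. u x v * u v (z - 1) = u x (z - 1))"
      if "v \<in> {Suc y..<z}" for v
      unfolding u_def using that by (intro less.hyps) auto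
    \<comment> \<open>By the induction hypothesis \<open>u x v = u x (z - 1) / u v (z - 1)\<close>,
      so \<open>K\<close> does not depend on \<open>x\<close>; taking \<open>x = y\<close>, where
      \<open>u y y = 1\<close>, determines it. The result is what the strong Markov property at the
      first visit to \<open>y\<close> would give.\<close>
    define K where "K = (\<Sum>v\<in>{Suc y..<z}. Q (Suc y) v / u v (z - 1))"
    have K: "Q (Suc y) y * u x y = - u x (z - 1) * K" if "x \<le> y" for x
    proof -
      have "{y..<z} = insert y {Suc y..<z}" using less.prems by auto
      then have "Q (Suc y) y * u x y + (\<Sum>v\<in>{Suc y..<z}. Q (Suc y) v * u x v) = 0"
        using pass_prob_equation[of x "Suc y" z] that less.prems False by (simp add: u_def)
      moreover have "(\<Sum>v\<in>{Suc y..<z}. Q (Suc y) v * u x v) = u x (z - 1) * K"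
        unfolding K_def sum_distrib_left
      proof (rule sum.cong[OF refl])
        fix v assume v: "v \<in> {Suc y..<z}"
        then have "u x v * u v (z - 1) = u x (z - 1)" "u v (z - 1) \<noteq> 0"
          using IH[OF v] that by auto
        then show "Q (Suc y) v * u x v = u x (z - 1) * (Q (Suc y) v / u v (z - 1))"
          by (simp add: field_simps)
      qed
      ultimately show ?thesis by linarith
    qed
    have Q: "Q (Suc y) y \<noteq> 0" using Q_down_pos[of "Suc y"] by simp
    have Kyy: "Q (Suc y) y = - u y (z - 1) * K" using K[of y] u1[of y] less.prems by simp
    have "u y (z - 1) \<noteq> 0" using Kyy Q by auto
    moreover have "u x y * u y (z - 1) = u x (z - 1)" if "x \<le> y" for x
    proof -
      have "Q (Suc y) y * (u x y * u y (z - 1)) = Q (Suc y) y * u x (z - 1)"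
        using K[OF that] Kyy by algebra
      then show ?thesis using Q by simp
    qed
    ultimately show ?thesis by blast
  qed
  then show ?case by (simp add: u_def)
qed

abbreviation W :: "nat \<Rightarrow> nat \<Rightarrow> real" where
  "W \<equiv> excursion_scale P X Q 0"

lemma W_upper: "z \<le> x \<Longrightarrow> W x z = 0"
  by (simp add: excursion_scale_def)

text \<open>By \<open>pass_prob_factor\<close>, column \<open>z\<close> of \<open>W\<close> from
  \<open>x = y - 1\<close> on is a constant multiple of the passage probabilities with the fixed
  target \<open>x\<close>, so the equation of these applies.\<close>

lemma Q_W:
  assumes "1 \<le> y" "y \<le> z"
  shows "(\<Sum>w<z. Q y w * W w z) = of_bool (y = z)"
proof -
  have "(\<Sum>w<z. Q y w * W w z) = (\<Sum>w\<in>{y - 1..<z}. Q y w * W w z)"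
    by (intro sum.mono_neutral_right) (auto simp: skip_free)
  also have "\<dots> = of_bool (y = z)"
  proof (cases "y = z")
    case True
    have "pass_prob z {z - 1<..<z} (z - 1) (z - 1) = 1"
      using assms True by (intro pass_prob_target) auto
    then have "W (z - 1) z = 1 / Q z (z - 1)"
      using excursion_scale_eq[of "z - 1" z] assms True by simp
    moreover have "{y - 1..<z} = {z - 1}" using assms True by auto
    ultimately show ?thesis using True Q_down_pos[of z] assms by simp
  next
    case False
    define x where "x = y - 1"
    have xz: "x < y" "y < z" using assms False by (auto simp: x_def)
    define c where "c = Q z (z - 1) * pass_prob z {x<..<z} x (z - 1)"
    have "c \<noteq> 0" using pass_prob_factor[of x z] xz Q_down_pos[of z] by (auto simp: c_def)
    have "(\<Sum>w\<in>{y - 1..<z}. Q y w * W w z) = (\<Sum>w\<in>{y - 1..<z}. Q y w * pass_prob z {x<..<z} x w) / c"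
      unfolding sum_divide_distrib
    proof (rule sum.cong[OF refl])
      fix w assume w: "w \<in> {y - 1..<z}"
      have f: "pass_prob z {w<..<z} w (z - 1) \<noteq> 0"
        "pass_prob z {x<..<z} x w * pass_prob z {w<..<z} w (z - 1) = pass_prob z {x<..<z} x (z - 1)"
        using pass_prob_factor[of w z] w by (auto simp: x_def)
      have "pass_prob z {x<..<z} x w / c = 1 / (Q z (z - 1) * pass_prob z {w<..<z} w (z - 1))"
        using f Q_down_pos[of z] xz \<open>c \<noteq> 0\<close> unfolding c_def by (simp add: field_simps flip: f(2))
      also have "\<dots> = W w z" using excursion_scale_eq[of w z] w by simp
      finally show "Q y w * W w z = Q y w * pass_prob z {x<..<z} x w / c"
        by (simp only: times_divide_eq_right[symmetric])
    qed
    then show ?thesis using pass_prob_equation[OF xz] False by simp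
  qed
  finally show ?thesis .
qed

end

section \<open>Exponential moments of the hitting time of zero\<close>

text \<open>Tychonoff's theorem for a product of intervals, whose compactness is sequential as there
  are countably many factors.\<close>

lemma pointwise_convergent_subsequence:
  fixes f :: "nat \<Rightarrow> nat \<Rightarrow> real"
  assumes "\<And>k y. f k y \<in> {0..C y}"
  shows "\<exists>r g. strict_mono (r :: nat \<Rightarrow> nat) \<and> (\<forall>y. (\<lambda>k. f (r k) y) \<longlonglongrightarrow> g y)"
proof -
  have "compactin (product_topology (\<lambda>_. euclidean) UNIV) (\<Pi>\<^sub>E y\<in>UNIV. {0..C y})"
    by (subst compactin_PiE) (auto simp: compactin_euclidean_iff)
  then have "compact (\<Pi>\<^sub>E y\<in>UNIV. {0..C y})"
    by (simp add: euclidean_product_topology compactin_euclidean_iff)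
  then have 1: "seq_compact (\<Pi>\<^sub>E y\<in>UNIV. {0..C y})" by (rule compact_imp_seq_compact)
  have 2: "\<forall>k. f k \<in> (\<Pi>\<^sub>E y\<in>UNIV. {0..C y})" using assms by auto
  obtain g r where r: "strict_mono (r :: nat \<Rightarrow> nat)" "(f \<circ> r) \<longlonglongrightarrow> g"
    using seq_compactE[OF 1 2] by metis
  have "(\<lambda>k. (f \<circ> r) k y) \<longlonglongrightarrow> g y" for y
  proof -
    have "isCont (\<lambda>x::nat \<Rightarrow> real. x y) g"
      using continuous_on_product_coordinates[of y] continuous_on_eq_continuous_at[OF open_UNIV] by blast
    then show ?thesis using r(2) by (rule isCont_tendsto_compose)
  qed
  then show ?thesis using r(1) by (auto simp: o_def)
qed

context downward_skip_free_chain
begin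

text \<open>Negative times are cut off, which makes the function antitone on the whole line and so measurable.\<close>

definition survival :: "nat \<Rightarrow> real \<Rightarrow> real" where
  "survival x t = 1 - transition (max 0 t) x 0"

lemma survival_eq:
  assumes "0 \<le> t"
  shows "survival x t = measure (P x) {w \<in> space M. X t w \<noteq> Some 0}"
proof -
  interpret p: prob_space "P x" by (rule prob_space_P)
  have "{w \<in> space M. X t w = Some 0} \<in> sets (P x)" using assms sets_X_eq by (simp add: sets_P)
  then have "measure (P x) (space (P x) - {w \<in> space M. X t w = Some 0}) = survival x t"
    using assms by (subst p.prob_compl) (auto simp: survival_def transition_def max_def)
  also have "space (P x) - {w \<in> space M. X t w = Some 0} = {w \<in> space M. X t w \<noteq> Some 0}" by auto
  finally show ?thesis by simp
qed

lemma survival_nonneg: "0 \<le> survival x t"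
  using transition_le_1 by (simp add: survival_def)

lemma survival_antimono:
  assumes "s \<le> t"
  shows "survival x t \<le> survival x s"
proof -
  interpret p: prob_space "P x" by (rule prob_space_P)
  have "transition (max 0 s) x 0 \<le> transition (max 0 t) x 0"
    unfolding transition_def
  proof (rule p.finite_measure_mono_AE)
    show "AE w in P x. w \<in> {w \<in> space M. X (max 0 s) w = Some 0} \<longrightarrow> w \<in> {w \<in> space M. X (max 0 t) w = Some 0}"
      using AE_regular_path[of x]
    proof eventually_elim
      case (elim w)
      then show ?case using absorbing_0[of w "max 0 s" "max 0 t"] assms by auto
    qed
    show "{w \<in> space M. X (max 0 t) w = Some 0} \<in> sets (P x)" by (simp add: sets_P sets_X_eq)
  qed
  then show ?thesis by (simp add: survival_def)
qed

lemma measurable_survival [measurable]: "survival x \<in> borel_measurable borel"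
proof -
  have "mono (\<lambda>t. - survival x t)" using survival_antimono by (auto intro: monoI)
  then have "(\<lambda>t. - survival x t) \<in> borel_measurable borel" by (rule borel_measurable_mono)
  then show ?thesis by simp
qed

lemma survival_step:
  assumes F: "finite F" and h: "0 \<le> h" and t: "0 \<le> t"
  shows "(\<Sum>v\<in>F. transition h x v * survival v t) \<le> survival x (h + t)"
proof -
  interpret p: prob_space "P x" by (rule prob_space_P)
  define E where "E = {f :: real \<Rightarrow> nat option. f t \<noteq> Some 0}"
  have "Measurable.pred path_space (\<lambda>f. \<not> f t = Some 0)" using t by measurable
  then have E: "E \<in> sets path_space" by (simp add: E_def pred_def)
  define B where "B v = {w \<in> space M. X h w = Some v \<and> (\<lambda>t. X (h + t) w) \<in> E}" for v
  have "B v = {w \<in> space M. X h w = Some v} \<inter> {w \<in> space M. (\<lambda>t. X (h + t) w) \<in> E}" for v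
    by (auto simp: B_def)
  then have B: "B v \<in> sets (P x)" for v
    using sets_X_path[OF h E] sets_X_eq[OF h] by (simp add: sets_P)
  have "(\<Sum>v\<in>F. transition h x v * survival v t) = (\<Sum>v\<in>F. measure (P x) (B v))"
    unfolding B_def transition_def
    by (intro sum.cong refl, subst Markov_path[OF h past_sets_space E])
      (simp add: survival_eq[OF t] E_def)
  also have "\<dots> = measure (P x) (\<Union>v\<in>F. B v)"
    using B F by (intro p.finite_measure_finite_Union[symmetric]) (auto simp: disjoint_family_on_def B_def)
  also have "\<dots> \<le> measure (P x) {w \<in> space M. X (h + t) w \<noteq> Some 0}"
  proof (rule p.finite_measure_mono)
    have "{w \<in> space M. \<not> X (h + t) w = Some 0} \<in> sets M"
      using h t by (intro sets.sets_Collect_neg sets_X_eq) auto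
    then show "{w \<in> space M. X (h + t) w \<noteq> Some 0} \<in> sets (P x)" by (simp add: sets_P)
  qed (auto simp: B_def E_def)
  finally show ?thesis using survival_eq[of "h + t"] h t by simp
qed

lemma sum_transition_le_1:
  assumes F: "finite F" and h: "0 \<le> h"
  shows "(\<Sum>v\<in>F. transition h x v) \<le> 1"
proof -
  interpret p: prob_space "P x" by (rule prob_space_P)
  have "(\<Sum>v\<in>F. transition h x v) = measure (P x) (\<Union>v\<in>F. {w \<in> space M. X h w = Some v})"
    unfolding transition_def using F sets_X_eq[OF h]
    by (intro p.finite_measure_finite_Union[symmetric]) (auto simp: disjoint_family_on_def sets_P)
  then show ?thesis using p.prob_le_1 by simp
qed

text \<open>The exponential moment of the hitting time of 0, minus 1. It is written with fixed-time
  probabilities so that the Markov property at fixed times applies.\<close>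

definition survival_laplace :: "real \<Rightarrow> nat \<Rightarrow> ennreal" where
  "survival_laplace l x = (\<integral>\<^sup>+t. ennreal (l * exp (l * t) * survival x t) * indicator {0..} t \<partial>lborel)"

lemma nn_integral_exp:
  assumes "0 \<le> l" "a \<le> b"
  shows "(\<integral>\<^sup>+t. ennreal (l * exp (l * t)) * indicator {a..<b} t \<partial>lborel) = ennreal (exp (l * b) - exp (l * a))"
proof -
  have "(\<integral>\<^sup>+t. ennreal (l * exp (l * t)) * indicator {a..<b} t \<partial>lborel)
      = (\<integral>\<^sup>+t. ennreal (l * exp (l * t)) * indicator {a..b} t \<partial>lborel)"
  proof (rule nn_integral_cong_AE)
    show "AE t in lborel. ennreal (l * exp (l * t)) * indicator {a..<b} t = ennreal (l * exp (l * t)) * indicator {a..b} t"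
      using AE_lborel_singleton[of b] by eventually_elim (auto simp: indicator_def)
  qed
  also have "\<dots> = ennreal (exp (l * b) - exp (l * a))"
    using assms by (intro nn_integral_FTC_Icc) (auto intro!: derivative_eq_intros)
  finally show ?thesis .
qed

text \<open>Write \<open>exp (l * r)\<close> as 1 plus the integral of its derivative over
  \<open>{0..<r}\<close> and exchange the integrals. By absorption,
  \<open>t < \<tau>\<^sub>0\<close> means that the path is not in 0 at time
  \<open>t\<close>.\<close>

lemma exp_hit_eq:
  assumes l: "0 \<le> l" and x: "1 \<le> x" and hit: "AE w in P x. hit X {0} w < \<infinity>"
  shows "(\<integral>\<^sup>+ w. exp_ereal (ereal l * hit X {0} w) \<partial>P x) = 1 + survival_laplace l x"
proof -
  interpret p: prob_space "P x" by (rule prob_space_P)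
  interpret pair_sigma_finite lborel "P x" ..
  have hit_meas [measurable]: "hit X {0} \<in> borel_measurable (P x)"
    using measurable_hit[of "{0}"] by (simp add: measurable_cong_sets[OF sets_P refl])
  define f where "f = (\<lambda>(t, w). ennreal (l * exp (l * t)) * indicator {t. 0 \<le> t} t *
    indicator {w. ereal t < hit X {0} w} w)"
  have f: "f \<in> borel_measurable (lborel \<Otimes>\<^sub>M P x)"
    unfolding f_def indicator_def by measurable
  have pos: "AE w in P x. \<exists>r>0. hit X {0} w = ereal r"
    using AE_regular_path[of x] start[of x] hit
  proof eventually_elim
    case (elim w)
    then show ?case using hit_eq[of w "{0}"] x by (auto simp: regular_path_def)
  qed
  have "(\<integral>\<^sup>+ w. exp_ereal (ereal l * hit X {0} w) \<partial>P x) = (\<integral>\<^sup>+ w. 1 + (\<integral>\<^sup>+ t. f (t, w) \<partial>lborel) \<partial>P x)"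
  proof (rule nn_integral_cong_AE)
    show "AE w in P x. exp_ereal (ereal l * hit X {0} w) = 1 + (\<integral>\<^sup>+ t. f (t, w) \<partial>lborel)"
      using pos
    proof eventually_elim
      case (elim w)
      then obtain r where r: "0 < r" "hit X {0} w = ereal r" by blast
      have "(\<integral>\<^sup>+ t. f (t, w) \<partial>lborel) = (\<integral>\<^sup>+t. ennreal (l * exp (l * t)) * indicator {0..<r} t \<partial>lborel)"
        by (rule nn_integral_cong) (auto simp: f_def r indicator_def)
      also have "\<dots> = ennreal (exp (l * r) - exp (l * 0))"
        using l r by (intro nn_integral_exp) auto
      finally have "1 + (\<integral>\<^sup>+ t. f (t, w) \<partial>lborel) = ennreal 1 + ennreal (exp (l * r) - 1)" by simp
      also have "\<dots> = ennreal (1 + (exp (l * r) - 1))"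
        using l r by (intro ennreal_plus[symmetric]) auto
      finally show ?case by (simp add: exp_ereal_def r)
    qed
  qed
  also have "\<dots> = 1 + (\<integral>\<^sup>+ w. (\<integral>\<^sup>+ t. f (t, w) \<partial>lborel) \<partial>P x)"
  proof (subst nn_integral_add)
    have "(\<lambda>(w, t). f (t, w)) \<in> borel_measurable (P x \<Otimes>\<^sub>M lborel)"
      using f by (rule measurable_pair_swap)
    then show "(\<lambda>w. \<integral>\<^sup>+ t. f (t, w) \<partial>lborel) \<in> borel_measurable (P x)"
      by (rule lborel.borel_measurable_nn_integral)
  qed (use p.emeasure_space_1 in auto)
  also have "(\<integral>\<^sup>+ w. (\<integral>\<^sup>+ t. f (t, w) \<partial>lborel) \<partial>P x) = (\<integral>\<^sup>+ t. (\<integral>\<^sup>+ w. f (t, w) \<partial>P x) \<partial>lborel)"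
    using Fubini'[of "\<lambda>t w. f (t, w)"] f by simp
  also have "\<dots> = survival_laplace l x"
    unfolding survival_laplace_def
  proof (rule nn_integral_cong)
    fix t :: real
    show "(\<integral>\<^sup>+ w. f (t, w) \<partial>P x) = ennreal (l * exp (l * t) * survival x t) * indicator {0..} t"
    proof (cases "0 \<le> t")
      case True
      have S: "{w \<in> space M. ereal t < hit X {0} w} \<in> sets (P x)"
        using measurable_hit[of "{0}"] unfolding sets_P by measurable
      have "measure (P x) {w \<in> space M. ereal t < hit X {0} w} = measure (P x) {w \<in> space M. X t w \<noteq> Some 0}"
      proof (rule p.finite_measure_eq_AE[OF _ S])
        show "AE w in P x. w \<in> {w \<in> space M. ereal t < hit X {0} w} \<longleftrightarrow> w \<in> {w \<in> space M. X t w \<noteq> Some 0}"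
          using AE_regular_path[of x] start[of x] hit
        proof eventually_elim
          case (elim w)
          then have w: "w \<in> space M" by (simp add: regular_path_def)
          obtain r where r: "0 < r" "hit X {0} w = ereal r" "X r w = Some 0"
              "\<And>s. 0 \<le> s \<Longrightarrow> s < r \<Longrightarrow> X s w \<noteq> Some 0"
            using hit_eq[OF w, of "{0}"] elim x by auto
          have "t < r \<longleftrightarrow> X t w \<noteq> Some 0"
            using r(4)[OF True] absorbing_0[OF elim(1), of r t] r by (cases "t < r") auto
          then show ?case using w r by simp
        qed
        have "{w \<in> space M. \<not> X t w = Some 0} \<in> sets M"
          using True by (intro sets.sets_Collect_neg sets_X_eq) auto
        then show "{w \<in> space M. X t w \<noteq> Some 0} \<in> sets (P x)" by (simp add: sets_P)
      qed
      then have m: "emeasure (P x) {w \<in> space M. ereal t < hit X {0} w} = ennreal (survival x t)"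
        by (simp add: p.emeasure_eq_measure survival_eq[OF True])
      have "(\<integral>\<^sup>+ w. f (t, w) \<partial>P x) = (\<integral>\<^sup>+ w. ennreal (l * exp (l * t)) * indicator {w \<in> space M. ereal t < hit X {0} w} w \<partial>P x)"
        using True by (intro nn_integral_cong) (auto simp: f_def indicator_def)
      also have "\<dots> = ennreal (l * exp (l * t)) * ennreal (survival x t)"
        using S m by (simp add: nn_integral_cmult_indicator)
      finally show ?thesis using True l survival_nonneg by (simp add: ennreal_mult)
    qed (simp add: f_def)
  qed
  finally show ?thesis .
qed

text \<open>Shift the integration variable by \<open>h\<close>. Original times from \<open>h\<close>
  on are bounded below by the Markov property at \<open>h\<close>, those before \<open>h\<close> by
  the survival probability at \<open>h\<close>.\<close>

lemma survival_laplace_step: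
  assumes l: "0 \<le> l" and F: "finite F" and h: "0 \<le> h"
  shows "ennreal ((exp (l * h) - 1) * survival x h) +
    (\<Sum>v\<in>F. ennreal (exp (l * h) * transition h x v) * survival_laplace l v) \<le> survival_laplace l x"
proof -
  define f where "f t = ennreal (l * exp (l * t) * survival x t) * indicator {0..} t" for t :: real
  define g where "g v t = ennreal (exp (l * h) * transition h x v) *
    (ennreal (l * exp (l * t) * survival v t) * indicator {0..} t)" for v and t :: real
  define k where "k t = ennreal (exp (l * h) * survival x h) * (ennreal (l * exp (l * t)) * indicator {- h..<0} t)" for t :: real
  have f: "f \<in> borel_measurable borel" unfolding f_def by measurable
  have k: "k \<in> borel_measurable lborel" unfolding k_def by measurable
  have g: "g v \<in> borel_measurable lborel" for v unfolding g_def by measurable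
  have "survival_laplace l x = (\<integral>\<^sup>+t. f (h + 1 * t) \<partial>lborel)"
    unfolding survival_laplace_def f_def[symmetric]
    using nn_integral_real_affine[OF f, of 1 h] by simp
  moreover have "(\<integral>\<^sup>+t. k t + (\<Sum>v\<in>F. g v t) \<partial>lborel) \<le> (\<integral>\<^sup>+t. f (h + 1 * t) \<partial>lborel)"
  proof (rule nn_integral_mono)
    fix t :: real
    consider "t < - h" | "- h \<le> t" "t < 0" | "0 \<le> t" by linarith
    then show "k t + (\<Sum>v\<in>F. g v t) \<le> f (h + 1 * t)"
    proof cases
      case 1
      then show ?thesis using h by (simp add: k_def g_def)
    next
      case 2
      have "l * exp (l * t) * (exp (l * h) * survival x h) \<le> l * exp (l * t) * (exp (l * h) * survival x (h + t))"
        using 2 l survival_antimono[of "h + t" h x] by (intro mult_left_mono) auto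
      then show ?thesis using 2 l survival_nonneg
        by (simp add: k_def g_def f_def ennreal_mult[symmetric] exp_add algebra_simps ennreal_leI)
    next
      case 3
      have "(\<Sum>v\<in>F. g v t) = (\<Sum>v\<in>F. ennreal (l * exp (l * (h + t)) * (transition h x v * survival v t)))"
        using 3 l survival_nonneg transition_nonneg
        by (intro sum.cong refl) (simp add: g_def ennreal_mult[symmetric] exp_add algebra_simps)
      also have "\<dots> = ennreal (\<Sum>v\<in>F. l * exp (l * (h + t)) * (transition h x v * survival v t))"
        using l survival_nonneg transition_nonneg by (intro sum_ennreal) simp
      also have "\<dots> = ennreal (l * exp (l * (h + t)) * (\<Sum>v\<in>F. transition h x v * survival v t))"
        by (simp add: sum_distrib_left)
      also have "\<dots> \<le> ennreal (l * exp (l * (h + t)) * survival x (h + t))"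
        using l survival_step[OF F h 3] by (intro ennreal_leI mult_left_mono) auto
      finally show ?thesis using 3 h by (simp add: k_def f_def)
    qed
  qed
  moreover have "(\<integral>\<^sup>+t. k t + (\<Sum>v\<in>F. g v t) \<partial>lborel) = (\<integral>\<^sup>+t. k t \<partial>lborel) + (\<Sum>v\<in>F. \<integral>\<^sup>+t. g v t \<partial>lborel)"
    using k g by (subst nn_integral_add) (auto simp: nn_integral_sum)
  moreover have "(\<integral>\<^sup>+t. g v t \<partial>lborel) = ennreal (exp (l * h) * transition h x v) * survival_laplace l v" for v
    unfolding g_def survival_laplace_def by (rule nn_integral_cmult) measurable
  moreover have "(\<integral>\<^sup>+t. k t \<partial>lborel) = ennreal ((exp (l * h) - 1) * survival x h)"
  proof -
    have "(\<integral>\<^sup>+t. k t \<partial>lborel) = ennreal (exp (l * h) * survival x h) * (\<integral>\<^sup>+t. ennreal (l * exp (l * t)) * indicator {- h..<0} t \<partial>lborel)"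
      unfolding k_def by (rule nn_integral_cmult) measurable
    also have "(\<integral>\<^sup>+t. ennreal (l * exp (l * t)) * indicator {- h..<0} t \<partial>lborel) = ennreal (1 - exp (- (l * h)))"
      using nn_integral_exp[OF l, of "- h" 0] h by simp
    also have "ennreal (exp (l * h) * survival x h) * \<dots> = ennreal (exp (l * h) * survival x h * (1 - exp (- (l * h))))"
      using l h survival_nonneg by (intro ennreal_mult[symmetric]) auto
    also have "exp (l * h) * survival x h * (1 - exp (- (l * h))) = (exp (l * h) - 1) * survival x h"
      by (simp add: algebra_simps exp_minus)
    finally show ?thesis .
  qed
  ultimately show ?thesis by simp
qed

text \<open>Irreducibility concerns hitting at a random time. Visits last for an interval and so
  include a rational time; if every rational time had probability 0, so would hitting.\<close>

lemma transition_pos: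
  assumes "1 \<le> x"
  shows "\<exists>s>0. 0 < transition s x y"
proof (rule ccontr)
  assume none: "\<not> ?thesis"
  interpret p: prob_space "P x" by (rule prob_space_P)
  have "AE w in P x. 0 < (of_rat q :: real) \<longrightarrow> X (of_rat q) w \<noteq> Some y" for q
  proof (cases "0 < (of_rat q :: real)")
    case True
    then have "measure (P x) {w \<in> space M. X (of_rat q) w = Some y} = 0"
      using none transition_nonneg[of "of_rat q" x y] unfolding transition_def by (meson order_antisym_conv linorder_not_less)
    moreover have "{w \<in> space M. X (of_rat q) w = Some y} \<in> sets (P x)"
      using True by (simp add: sets_P sets_X_eq)
    ultimately have "AE w in P x. w \<notin> {w \<in> space M. X (of_rat q) w = Some y}"
      by (simp add: p.prob_eq_0)
    with AE_space show ?thesis by eventually_elim auto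
  qed auto
  then have "AE w in P x. \<forall>q. 0 < (of_rat q :: real) \<longrightarrow> X (of_rat q) w \<noteq> Some y"
    by (subst AE_all_countable) blast
  with AE_space have "AE w in P x. w \<notin> {w \<in> space M. hit X {y} w < \<infinity>}"
  proof eventually_elim
    case (elim w)
    have False if t: "0 < t" "X t w = Some y" for t
    proof -
      obtain q :: rat where "t < of_rat q" "X (of_rat q) w = X t w"
        using right_constant_rat[OF right_constant_X less_imp_le[OF t(1)], of w \<infinity>] elim by auto
      then show False using elim t by (metis less_trans)
    qed
    then show ?case unfolding hit_less_iff by auto
  qed
  then show False
    using finite_measure.not_AE_notin[OF finite_measure_P irreducible[OF assms, of y]] by simp
qed

end

section \<open>Tail bounds from a positive subinvariant measure\<close>

context killed_markov_chain
begin

text \<open>Let \<open>F i y\<close> be the probability of having stayed in \<open>D\<close> up to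
  step \<open>i\<close> and being in \<open>y\<close>. Subinvariance propagates
  \<open>\<pi> x * F i y \<le> r ^ i * \<pi> y\<close> from step to step, as for the chain reversed
  with respect to \<open>\<pi>\<close>. One more step leads to \<open>a\<close>.\<close>

lemma grid_exit_bound:
  assumes h: "0 < h" and D: "finite D" "x \<in> D" and \<pi>: "\<And>z. z \<in> D \<Longrightarrow> 0 < \<pi> z" and r: "0 \<le> r"
    and sub: "\<And>y. y \<in> D \<Longrightarrow> (\<Sum>z\<in>D. \<pi> z * transition h z y) \<le> r * \<pi> y"
  shows "measure (P x) {w \<in> space M. (\<forall>j\<in>{..i}. X (real j * h) w \<in> Some ` D) \<and> X (real (Suc i) * h) w = Some a}
    \<le> r ^ i * ((\<Sum>z\<in>D. \<pi> z * transition h z a) / \<pi> x)"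
proof -
  interpret p: prob_space "P x" by (rule prob_space_P)
  define A where "A i = {w \<in> space M. \<forall>j\<in>{..i}. X (real j * h) w \<in> Some ` D}" for i :: nat
  define F where "F i y = measure (P x) {w \<in> A i. X (real i * h) w = Some y}" for i y
  have A: "A i \<in> past_sets M X (real i * h)" for i
    unfolding A_def using h by (intro past_sets_Int_all past_sets_space) (auto intro: mult_right_mono)
  have step: "measure (P x) {w \<in> A i. X (real (Suc i) * h) w = Some b} \<le> (\<Sum>z\<in>D. F i z * transition h z b)" for i b
  proof -
    define E where "E z = {w \<in> A i. X (real i * h) w = Some z \<and> X (real i * h + h) w = Some b}" for z
    have E: "E z \<in> sets (P x)" for z
    proof -
      have "E z = A i \<inter> ({w \<in> space M. X (real i * h) w = Some z} \<inter> {w \<in> space M. X (real i * h + h) w = Some b})"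
        using sets.sets_into_space[OF past_sets_subset[OF A[of i]]] by (auto simp: E_def)
      then show ?thesis using past_sets_subset[OF A[of i]] h by (auto simp: sets_P intro!: sets.Int sets_X_eq)
    qed
    have "{w \<in> A i. X (real (Suc i) * h) w = Some b} \<subseteq> (\<Union>z\<in>D. E z)"
    proof
      fix w assume "w \<in> {w \<in> A i. X (real (Suc i) * h) w = Some b}"
      then have w: "w \<in> A i" "X (real i * h + h) w = Some b" by (auto simp: algebra_simps)
      then have "X (real i * h) w \<in> Some ` D" by (auto simp: A_def)
      then show "w \<in> (\<Union>z\<in>D. E z)" using w by (auto simp: E_def)
    qed
    then have "measure (P x) {w \<in> A i. X (real (Suc i) * h) w = Some b} \<le> measure (P x) (\<Union>z\<in>D. E z)"
      using E D by (intro p.finite_measure_mono) auto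
    also have "\<dots> \<le> (\<Sum>z\<in>D. measure (P x) (E z))"
      using E D by (intro p.finite_measure_subadditive_finite) auto
    also have "\<dots> = (\<Sum>z\<in>D. F i z * transition h z b)"
      unfolding E_def F_def transition_def using h by (intro sum.cong refl Markov A) auto
    finally show ?thesis .
  qed
  have bound: "\<pi> x * F i y \<le> r ^ i * \<pi> y" if "y \<in> D" for i y
    using that
  proof (induction i arbitrary: y)
    case 0
    show ?case
    proof (cases "y = x")
      case True
      then show ?thesis using \<pi>[of x] D(2) p.prob_le_1 by (simp add: F_def mult_left_le)
    next
      case False
      have "AE w in P x. w \<notin> {w \<in> A 0. X (real 0 * h) w = Some y}"
        using start[of x] by eventually_elim (use False in auto)
      then have "F 0 y = 0"
        using p.not_AE_notin[of "{w \<in> A 0. X (real 0 * h) w = Some y}"] measure_nonneg[of "P x"]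
        unfolding F_def by (meson order_antisym_conv linorder_not_less)
      then show ?thesis using \<pi>[OF 0] by simp
    qed
  next
    case (Suc i)
    have "F (Suc i) y \<le> measure (P x) {w \<in> A i. X (real (Suc i) * h) w = Some y}"
      unfolding F_def
    proof (rule p.finite_measure_mono)
      show "{w \<in> A (Suc i). X (real (Suc i) * h) w = Some y} \<subseteq> {w \<in> A i. X (real (Suc i) * h) w = Some y}"
        by (auto simp: A_def)
      have "{w \<in> A i. X (real (Suc i) * h) w = Some y} = A i \<inter> {w \<in> space M. X (real (Suc i) * h) w = Some y}"
        using sets.sets_into_space[OF past_sets_subset[OF A[of i]]] by auto
      then show "{w \<in> A i. X (real (Suc i) * h) w = Some y} \<in> sets (P x)"
        using past_sets_subset[OF A[of i]] h by (auto simp: sets_P intro!: sets.Int sets_X_eq)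
    qed
    also have "\<dots> \<le> (\<Sum>z\<in>D. F i z * transition h z y)" by (rule step)
    finally have "\<pi> x * F (Suc i) y \<le> \<pi> x * (\<Sum>z\<in>D. F i z * transition h z y)"
      using \<pi>[OF D(2)] by (intro mult_left_mono) auto
    also have "\<dots> = (\<Sum>z\<in>D. \<pi> x * F i z * transition h z y)" by (simp add: sum_distrib_left mult.assoc)
    also have "\<dots> \<le> (\<Sum>z\<in>D. r ^ i * \<pi> z * transition h z y)"
      using Suc.IH transition_nonneg by (intro sum_mono mult_right_mono) auto
    also have "\<dots> = r ^ i * (\<Sum>z\<in>D. \<pi> z * transition h z y)" by (simp add: sum_distrib_left mult.assoc)
    also have "\<dots> \<le> r ^ i * (r * \<pi> y)" using sub[OF Suc.prems] r by (intro mult_left_mono) auto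
    finally show ?case by (simp add: mult_ac)
  qed
  have "measure (P x) {w \<in> A i. X (real (Suc i) * h) w = Some a} \<le> (\<Sum>z\<in>D. F i z * transition h z a)" by (rule step)
  also have "\<dots> \<le> (\<Sum>z\<in>D. r ^ i * \<pi> z / \<pi> x * transition h z a)"
    using bound[of _ i] \<pi>[OF D(2)] transition_nonneg by (intro sum_mono mult_right_mono) (auto simp: field_simps)
  also have "\<dots> = r ^ i * ((\<Sum>z\<in>D. \<pi> z * transition h z a) / \<pi> x)"
    by (simp add: sum_distrib_left sum_divide_distrib mult_ac)
  finally show ?thesis by (simp add: A_def conj_assoc)
qed

end

context downward_skip_free_chain
begin

lemma survival_tail:
  assumes \<pi>: "\<And>z. 1 \<le> z \<Longrightarrow> 0 < \<pi> z"
    and eig: "\<And>y. 1 \<le> y \<Longrightarrow> (\<Sum>z=1..Suc y. \<pi> z * Q z y) = - l * \<pi> y"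
    and k: "0 < k" "k < l" and t: "0 \<le> t" and hit: "AE w in P 1. hit X {0} w < \<infinity>"
  shows "survival 1 t \<le> Q 1 0 / k * exp (- (k * t))"
proof -
  interpret p: prob_space "P 1" by (rule prob_space_P)
  define \<beta> where "\<beta> = Q 1 0 / k * exp (- (k * t))"
  define C where "C n m i = {w \<in> space M. (\<forall>j\<in>{..i}. X (real j * mesh m) w \<in> Some ` {1..<n}) \<and>
    X (real (Suc i) * mesh m) w = Some 0}" for n m i :: nat
  \<comment> \<open>The index of the last grid point not after \<open>t\<close>.
    \<open>B n m\<close> collects the paths whose first sampled visit to 0 comes after that index,
    having stayed in \<open>{1..<n}\<close> before.\<close>
  define K where "K m = nat \<lfloor>t / mesh m\<rfloor>" for m :: nat
  define B where "B n m = (\<Union>i. C n m (K m + i))" for n m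
  have C: "C n m i \<in> sets (P 1)" for n m i
  proof -
    have "{w \<in> space M. \<forall>j\<in>{..i}. X (real j * mesh m) w \<in> Some ` {1..<n}} \<in> past_sets M X (real i * mesh m)"
      by (intro past_sets_Int_all past_sets_space) (auto intro: mult_right_mono)
    then have "{w \<in> space M. \<forall>j\<in>{..i}. X (real j * mesh m) w \<in> Some ` {1..<n}} \<in> sets M"
      by (rule past_sets_subset)
    moreover have "{w \<in> space M. X (real (Suc i) * mesh m) w = Some 0} \<in> sets M" by (rule sets_X_eq) simp
    ultimately have "{w \<in> space M. \<forall>j\<in>{..i}. X (real j * mesh m) w \<in> Some ` {1..<n}} \<inter>
      {w \<in> space M. X (real (Suc i) * mesh m) w = Some 0} \<in> sets (P 1)" by (simp add: sets_P)
    then show ?thesis by (rule back_subst[of "\<lambda>S. S \<in> sets (P 1)"]) (auto simp: C_def)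
  qed
  have B: "B n m \<in> sets (P 1)" for n m unfolding B_def using C by auto
  have bound: "measure (P 1) {w \<in> space M. \<forall>\<^sub>F m in sequentially. w \<in> B n m} \<le> \<beta>" if n: "2 \<le> n" for n
  proof -
    define D where "D = {1..<n}"
    have D: "finite D" "1 \<in> D" using n by (auto simp: D_def)
    define s where "s m = (\<Sum>z\<in>D. \<pi> z * ((transition (mesh m) z 0 - of_bool (z = 0)) / mesh m)) / \<pi> 1" for m
    define b where "b m = exp (- (k * (t - mesh m))) * s m / k" for m
    \<comment> \<open>The gap between \<open>k\<close> and \<open>l\<close> absorbs the error of the
      difference quotients, so the inequality holds without remainder for small meshes, for all
      \<open>y\<close> in the finite set \<open>D\<close> at once.\<close>
    have ev: "\<forall>\<^sub>F m in sequentially. \<forall>y\<in>D. (\<Sum>z\<in>D. \<pi> z * transition (mesh m) z y) \<le> (1 - k * mesh m) * \<pi> y"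
    proof (rule eventually_ball_finite[OF D(1)], rule ballI)
      fix y assume y: "y \<in> D"
      have "(\<lambda>m. \<Sum>z\<in>D. \<pi> z * ((transition (mesh m) z y - of_bool (z = y)) / mesh m)) \<longlonglongrightarrow> (\<Sum>z\<in>D. \<pi> z * Q z y)"
        by (intro tendsto_intros Q_tendsto)
      moreover have "(\<Sum>z\<in>D. \<pi> z * Q z y) < - k * \<pi> y"
      proof -
        have "\<pi> z * Q z y = 0" if "z \<in> D - D \<inter> {1..Suc y}" for z
          using that skip_free[of y z] by (auto simp: D_def not_le)
        then have "(\<Sum>z\<in>D. \<pi> z * Q z y) = (\<Sum>z\<in>D \<inter> {1..Suc y}. \<pi> z * Q z y)"
          using D by (intro sum.mono_neutral_right) auto
        \<comment> \<open>The truncated sum lacks at most \<open>z = n\<close>, when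
          \<open>y = n - 1\<close>. That entry is off the diagonal and nonnegative, so the
          truncation goes in the right direction.\<close>
        also have "\<dots> \<le> (\<Sum>z=1..Suc y. \<pi> z * Q z y)"
        proof (rule sum_mono2)
          fix z assume z: "z \<in> {1..Suc y} - D \<inter> {1..Suc y}"
          then have "z \<noteq> y" using y by auto
          then show "0 \<le> \<pi> z * Q z y" using z \<pi>[of z] Q_nonneg[of z y] by simp
        qed auto
        also have "\<dots> = - l * \<pi> y" using eig y by (simp add: D_def)
        also have "\<dots> < - k * \<pi> y" using \<pi>[of y] y k by (simp add: D_def)
        finally show ?thesis .
      qed
      ultimately have "\<forall>\<^sub>F m in sequentially. (\<Sum>z\<in>D. \<pi> z * ((transition (mesh m) z y - of_bool (z = y)) / mesh m)) < - k * \<pi> y"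
        by (rule order_tendstoD)
      then show "\<forall>\<^sub>F m in sequentially. (\<Sum>z\<in>D. \<pi> z * transition (mesh m) z y) \<le> (1 - k * mesh m) * \<pi> y"
      proof eventually_elim
        case (elim m)
        have "(\<Sum>z\<in>D. \<pi> z * ((transition (mesh m) z y - of_bool (z = y)) / mesh m))
            = ((\<Sum>z\<in>D. \<pi> z * transition (mesh m) z y) - (\<Sum>z\<in>D. \<pi> z * of_bool (z = y))) / mesh m"
          by (simp only: sum_subtractf[symmetric] sum_divide_distrib right_diff_distrib times_divide_eq_right)
        also have "(\<Sum>z\<in>D. \<pi> z * of_bool (z = y)) = \<pi> y"
          using D(1) y by (simp add: of_bool_def if_distrib[of "\<lambda>a. _ * a"] cong: if_cong)
        finally have "((\<Sum>z\<in>D. \<pi> z * transition (mesh m) z y) - \<pi> y) / mesh m < - k * \<pi> y" using elim by simp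
        then have "(\<Sum>z\<in>D. \<pi> z * transition (mesh m) z y) - \<pi> y < - k * \<pi> y * mesh m"
          by (subst (asm) pos_divide_less_eq) auto
        moreover have "(1 - k * mesh m) * \<pi> y = \<pi> y + (- k * \<pi> y * mesh m)" by algebra
        ultimately show ?case by linarith
      qed
    qed
    have "\<forall>\<^sub>F m in sequentially. mesh m < 1 / k" using k by (intro eventually_mesh_less) auto
    with ev have "\<forall>\<^sub>F m in sequentially. measure (P 1) (B n m) \<le> b m"
    proof eventually_elim
      case (elim m)
      define r where "r = 1 - k * mesh m"
      have km: "0 < k * mesh m" using k by simp
      have r: "0 \<le> r" "r < 1" using elim(2) km k by (auto simp: r_def field_simps)
      define q where "q = (\<Sum>z\<in>D. \<pi> z * transition (mesh m) z 0) / \<pi> 1"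
      have q: "q = s m * mesh m"
      proof -
        have "(\<Sum>z\<in>D. \<pi> z * transition (mesh m) z 0) =
            (\<Sum>z\<in>D. \<pi> z * ((transition (mesh m) z 0 - of_bool (z = 0)) / mesh m) * mesh m)"
          by (intro sum.cong refl) (auto simp: D_def)
        then show ?thesis unfolding q_def s_def by (simp only: sum_distrib_right times_divide_eq_left)
      qed
      have q0: "0 \<le> q" unfolding q_def
        using \<pi> transition_nonneg by (intro divide_nonneg_pos sum_nonneg) (auto simp: D_def less_imp_le)
      have C_le: "measure (P 1) (C n m i) \<le> r ^ i * q" for i
        unfolding C_def D_def[symmetric] q_def
      proof (rule grid_exit_bound)
        show "(\<Sum>z\<in>D. \<pi> z * transition (mesh m) z y) \<le> r * \<pi> y" if "y \<in> D" for y
          using elim(1) that unfolding r_def by blast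
        show "0 < \<pi> z" if "z \<in> D" for z using \<pi>[of z] that by (simp add: D_def)
      qed (use D r in auto)
      have sums: "(\<lambda>i. r ^ (K m + i) * q) sums (r ^ K m * q * (1 / (1 - r)))"
        unfolding power_add using geometric_sums[of r, THEN sums_mult, of "r ^ K m * q"] r by (simp add: mult_ac)
      have summ: "summable (\<lambda>i. measure (P 1) (C n m (K m + i)))"
        using C_le by (intro summable_comparison_test'[OF sums_summable[OF sums]]) auto
      have "measure (P 1) (B n m) \<le> (\<Sum>i. measure (P 1) (C n m (K m + i)))"
        unfolding B_def using C summ by (intro p.finite_measure_subadditive_countably) auto
      also have "\<dots> \<le> (\<Sum>i. r ^ (K m + i) * q)"
        using C_le by (intro suminf_le summ sums_summable[OF sums]) auto
      also have "\<dots> = r ^ K m * q * (1 / (1 - r))" using sums by (rule sums_unique[symmetric])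
      \<comment> \<open>Summing over the exit step costs a factor \<open>1 / (k * mesh m)\<close>;
        the final step to 0 contributes \<open>q = s m * mesh m\<close>, and the mesh
        cancels.\<close>
      also have "\<dots> = r ^ K m * s m / k" using k unfolding q by (simp add: r_def)
      also have "\<dots> \<le> exp (- (k * (t - mesh m))) * s m / k"
      proof (intro divide_right_mono mult_right_mono)
        have "r \<le> exp (- (k * mesh m))" using exp_ge_add_one_self[of "- (k * mesh m)"] by (simp add: r_def)
        then have "r ^ K m \<le> exp (- (k * mesh m)) ^ K m" using r by (intro power_mono)
        also have "\<dots> = exp (- (k * (real (K m) * mesh m)))" by (simp add: exp_of_nat_mult[symmetric] mult_ac)
        also have "\<dots> \<le> exp (- (k * (t - mesh m)))"
        proof -
          have "0 \<le> t / mesh m" using t by simp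
          then have "t / mesh m - 1 \<le> real (K m)" unfolding K_def by linarith
          then have "(t / mesh m - 1) * mesh m \<le> real (K m) * mesh m" by (intro mult_right_mono) auto
          then have "t - mesh m \<le> real (K m) * mesh m" by (simp add: left_diff_distrib)
          then show ?thesis using k by simp
        qed
        finally show "r ^ K m \<le> exp (- (k * (t - mesh m)))" .
        show "0 \<le> s m" using q q0 by (simp add: zero_le_mult_iff)
      qed (use k in auto)
      finally show ?case unfolding b_def .
    qed
    moreover have "b \<longlonglongrightarrow> \<beta>"
    proof -
      have "s \<longlonglongrightarrow> (\<Sum>z\<in>D. \<pi> z * Q z 0) / \<pi> 1"
        unfolding s_def using \<pi>[of 1] by (intro tendsto_intros Q_tendsto) auto
      \<comment> \<open>Only state 1 jumps to 0, which explains the constant \<open>Q 1 0\<close>.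
        Its weight cancels the denominator \<open>\<pi> 1\<close>, so the bound depends neither on
        \<open>n\<close> nor on \<open>\<pi>\<close>.\<close>
      moreover have "(\<Sum>z\<in>D. \<pi> z * Q z 0) = (\<Sum>z\<in>{1}. \<pi> z * Q z 0)"
        using D by (intro sum.mono_neutral_right) (auto simp: D_def skip_free)
      ultimately have s: "s \<longlonglongrightarrow> Q 1 0" using \<pi>[of 1] by simp
      have "b \<longlonglongrightarrow> exp (- (k * (t - 0))) * Q 1 0 / k"
        unfolding b_def using k by (intro tendsto_intros LIMSEQ_inverse_real_of_nat s) auto
      then show ?thesis by (simp add: \<beta>_def mult.commute)
    qed
    ultimately show ?thesis using p.measure_eventually_le[of "B n" b \<beta>] B by simp
  qed
  define L where "L n = {w \<in> space M. \<forall>\<^sub>F m in sequentially. w \<in> B n m}" for n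
  have L: "L n \<in> sets (P 1)" for n
  proof -
    have "(\<Inter>m\<in>{N..}. B n m) \<in> sets (P 1)" for N
      using B by (intro sets.countable_INT') auto
    then have "(\<Union>N. \<Inter>m\<in>{N..}. B n m) \<in> sets (P 1)" by blast
    moreover have "(\<Union>N. \<Inter>m\<in>{N..}. B n m) = L n"
      using B[THEN sets.sets_into_space] by (auto simp: L_def eventually_sequentially)
    ultimately show ?thesis by simp
  qed
  have "C n m i \<subseteq> C n' m i" if "n \<le> n'" for n n' m i using that by (fastforce simp: C_def)
  then have BB: "B n m \<subseteq> B n' m" if "n \<le> n'" for n n' m using that unfolding B_def by blast
  have "L n \<subseteq> L n'" if "n \<le> n'" for n n'
    unfolding L_def using BB[OF that] by (blast intro: eventually_mono)
  then have inc: "incseq L" by (simp add: incseq_def)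
  have "survival 1 t = measure (P 1) {w \<in> space M. X t w \<noteq> Some 0}" by (rule survival_eq[OF t])
  also have "\<dots> \<le> measure (P 1) (\<Union>n. L n)"
  proof (rule p.finite_measure_mono_AE)
    show "AE w in P 1. w \<in> {w \<in> space M. X t w \<noteq> Some 0} \<longrightarrow> w \<in> (\<Union>n. L n)"
      using AE_regular_path[of 1] start[of 1] hit
    proof eventually_elim
      case (elim w)
      have w: "w \<in> space M" using elim by (simp add: regular_path_def)
      show ?case
      proof
        assume "w \<in> {w \<in> space M. X t w \<noteq> Some 0}"
        then have Xt: "X t w \<noteq> Some 0" by simp
        obtain r where r: "0 < r" "X r w = Some 0" "\<And>s. 0 \<le> s \<Longrightarrow> s < r \<Longrightarrow> X s w \<noteq> Some 0"
          using hit_eq[OF w, of "{0}"] elim by auto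
        have tr: "t < r" using absorbing_0[OF elim(1), of r t] r Xt by force
        have "\<not> explosion_time X w \<le> ereal r" using killed_at_explosion[OF w, of r] r by simp
        then have "ereal r < (SUP n. hit X {n..} w)" by (simp add: explosion_time_def not_le)
        then obtain n0 where n0: "ereal r < hit X {n0..} w" unfolding less_SUP_iff by blast
        \<comment> \<open>\<open>hit\<close> ignores time 0, so the starting state 1 has to be put
          into \<open>{1..<n}\<close> separately.\<close>
        define n where "n = max n0 2"
        have inD: "X s w \<in> Some ` {1..<n}" if s: "0 \<le> s" "s < r" for s
        proof -
          have "X s w \<noteq> None" using None_absorbing[OF w, of s r] s r by auto
          then obtain v where v: "X s w = Some v" by auto
          have "1 \<le> v" using r(3)[OF s] v by (cases v) auto
          moreover have "v < n"
          proof (cases "s = 0")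
            case True
            then show ?thesis using v elim by (simp add: n_def)
          next
            case False
            have "v < n0"
            proof (rule ccontr)
              assume "\<not> v < n0"
              then have "hit X {n0..} w \<le> ereal s"
                unfolding hit_def using v False s by (intro Inf_lower) auto
              also have "ereal s < ereal r" using s by simp
              finally show False using n0 by simp
            qed
            then show ?thesis by (simp add: n_def)
          qed
          ultimately show ?thesis using v by auto
        qed
        obtain d where d: "d > 0" "\<And>s. r \<le> s \<Longrightarrow> s < r + d \<Longrightarrow> X s w = X r w"
          using right_constantD[OF right_constant_X[OF w] less_imp_le[OF r(1)]] by blast
        have "\<forall>\<^sub>F m in sequentially. w \<in> B n m"
          using eventually_mesh_less[OF d(1)]
        proof eventually_elim
          case (elim m)
          have h: "0 < mesh m" by simp
          obtain i0 :: nat where i0: "r \<le> real i0 * mesh m" "real i0 * mesh m < r + mesh m"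
              "\<And>j. j < i0 \<Longrightarrow> real j * mesh m < r"
            using first_grid_point[OF h less_imp_le[OF r(1)]] by blast
          have "i0 \<noteq> 0" using i0(1) r(1) by (cases i0) auto
          then obtain i where i: "i0 = Suc i" by (cases i0) auto
          have "X (real (Suc i) * mesh m) w = Some 0"
            using d(2)[OF i0(1)] i0(2) elim r(2) unfolding i by simp
          moreover have "X (real j * mesh m) w \<in> Some ` {1..<n}" if "j \<in> {..i}" for j
            using i0(3)[of j] that i by (intro inD) auto
          ultimately have "w \<in> C n m i" using w unfolding C_def by blast
          moreover have "K m \<le> i"
          proof -
            have "t < real (Suc i) * mesh m" using tr i0(1) unfolding i by simp
            then have "t / mesh m < real (Suc i)" by (subst pos_divide_less_eq) auto
            then have "\<lfloor>t / mesh m\<rfloor> < int (Suc i)" by (subst floor_less_iff) simp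
            then show ?thesis unfolding K_def by linarith
          qed
          ultimately show ?case unfolding B_def by (intro UN_I[of "i - K m"]) auto
        qed
        then show "w \<in> (\<Union>n. L n)" using w unfolding L_def by blast
      qed
    qed
  qed (use L in auto)
  also have "\<dots> \<le> \<beta>"
  proof (rule LIMSEQ_le_const2)
    show "(\<lambda>n. measure (P 1) (L n)) \<longlonglongrightarrow> measure (P 1) (\<Union>n. L n)"
      using L inc by (intro p.finite_Lim_measure_incseq) auto
    show "\<exists>N. \<forall>n\<ge>N. measure (P 1) (L n) \<le> \<beta>"
      using bound unfolding L_def by blast
  qed
  finally show ?thesis unfolding \<beta>_def .
qed

end

section \<open>The decay parameter\<close>

context downward_skip_free_chain
begin

lemma scale_left_eigenvector:
  "(\<Sum>z=1..Suc y. power_series W q 0 z * Q z y) = of_bool (0 = y) + q * power_series W q 0 y"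
proof (rule power_series_left_eigenvector)
  show "Q y (y - 1) \<noteq> 0" if "1 \<le> y" for y using Q_down_pos[OF that] by simp
qed (use skip_free W_upper Q_W in auto)

text \<open>Column \<open>Suc n\<close> solves the eigenvalue equation in rows \<open>1..n\<close>,
  since the inhomogeneity sits in row \<open>Suc n\<close>. Its entry at \<open>n\<close> is
  positive whatever \<open>l\<close> is, and that starts the comparison.\<close>

lemma scale_pos_if_supersolution:
  assumes g: "\<And>y. 1 \<le> y \<Longrightarrow> 0 < g y" "0 \<le> g 0"
      "\<And>y N. 1 \<le> y \<Longrightarrow> y < N \<Longrightarrow> (\<Sum>w<N. Q y w * g w) \<le> - l * g y"
    and x: "0 < x"
  shows "0 < power_series W (- l) 0 x"
proof -
  obtain n where n: "x = Suc n" using x by (cases x) auto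
  have Q: "Q y (y - 1) \<noteq> 0" if "1 \<le> y" for y using Q_down_pos[OF that] by simp
  show ?thesis unfolding n
  proof (rule positive_if_supersolution[of Q g l "\<lambda>w. power_series W (- l) w (Suc n)" n 0])
    have "power_series W (- l) n (Suc n) = 1 / Q (Suc n) n"
      using skip_free Q W_upper Q_W by (rule power_series_last)
    then show "0 < power_series W (- l) n (Suc n)" using Q_down_pos[of "Suc n"] by simp
    show "(\<Sum>w\<le>n. Q y w * power_series W (- l) w (Suc n)) = - l * power_series W (- l) y (Suc n)"
      if "1 \<le> y" "y \<le> n" for y
    proof -
      have "(\<Sum>w<Suc n. Q y w * power_series W (- l) w (Suc n)) =
          of_bool (y = Suc n) + - l * power_series W (- l) y (Suc n)"
        using skip_free Q W_upper Q_W that(1) le_SucI[OF that(2)]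
        by (rule power_series_right_eigenvector)
      then show ?thesis using that by (simp add: lessThan_Suc_atMost)
    qed
    show "\<exists>w\<in>Z. \<exists>v. v \<notin> insert 0 Z \<and> 0 < Q w v" if "Z \<noteq> {}" "Z \<subseteq> {1..<m}" for Z m
      using irreducible_exit[OF that] .
  qed (use Q_nonneg skip_free g in auto)
qed

text \<open>The exponential moment started in \<open>y\<close>, provided that it is finite:
  \<open>enn2real\<close> sends infinity to 0, which explains the hypothesis \<open>fin\<close> of
  the lemmas below.\<close>

definition decay_fun :: "real \<Rightarrow> nat \<Rightarrow> real" where
  "decay_fun l y = (if y = 0 then 1 else 1 + enn2real (survival_laplace l y))"

lemma decay_fun_ge_1: "1 \<le> decay_fun l y"
  by (simp add: decay_fun_def)

text \<open>The Markov property at time \<open>h\<close>, with the paths outside \<open>insert 0 F\<close> at time \<open>h\<close> discarded.\<close>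

lemma decay_fun_step:
  assumes l: "0 \<le> l" and fin: "\<And>y. 1 \<le> y \<Longrightarrow> survival_laplace l y < \<infinity>"
    and F: "finite F" "0 \<notin> F" and h: "0 \<le> h" and y: "1 \<le> y"
  shows "transition h y 0 + exp (l * h) * (\<Sum>v\<in>F. transition h y v * decay_fun l v) \<le> decay_fun l y"
proof -
  define G where "G v = enn2real (survival_laplace l v)" for v
  define e where "e = exp (l * h)"
  have e: "1 \<le> e" using l h by (simp add: e_def)
  have G: "survival_laplace l v = ennreal (G v)" "0 \<le> G v" if "1 \<le> v" for v
    using fin[OF that] by (auto simp: G_def)
  have F1: "1 \<le> v" if "v \<in> F" for v using F(2) that by (cases v) auto
  have "ennreal ((e - 1) * survival y h + (\<Sum>v\<in>F. e * transition h y v * G v)) \<le> ennreal (G y)"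
  proof -
    have "ennreal ((e - 1) * survival y h) + (\<Sum>v\<in>F. ennreal (e * transition h y v) * survival_laplace l v)
        \<le> survival_laplace l y"
      unfolding e_def by (rule survival_laplace_step[OF l F(1) h])
    moreover have "(\<Sum>v\<in>F. ennreal (e * transition h y v) * survival_laplace l v) = (\<Sum>v\<in>F. ennreal (e * transition h y v * G v))"
      using e transition_nonneg G F1 by (intro sum.cong refl) (simp add: ennreal_mult)
    moreover have "\<dots> = ennreal (\<Sum>v\<in>F. e * transition h y v * G v)"
      using e transition_nonneg G F1 by (intro sum_ennreal) simp
    ultimately show ?thesis using e transition_nonneg G F1 y survival_nonneg
      by (simp add: ennreal_plus sum_nonneg)
  qed
  then have 1: "(e - 1) * survival y h + (\<Sum>v\<in>F. e * transition h y v * G v) \<le> G y"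
    using G(2)[OF y] by (simp add: ennreal_le_iff)
  have 2: "(\<Sum>v\<in>F. e * transition h y v * G v) = e * (\<Sum>v\<in>F. transition h y v * G v)"
    by (simp add: sum_distrib_left mult.assoc)
  have "(\<Sum>v\<in>insert 0 F. transition h y v) \<le> 1" using F h by (intro sum_transition_le_1) auto
  then have 3: "transition h y 0 + (\<Sum>v\<in>F. transition h y v) \<le> 1" using F by simp
  \<comment> \<open>Paths in \<open>F\<close> at time \<open>h\<close> are not yet absorbed, as
    \<open>0 \<notin> F\<close>. This trades the survival term for the summands 1 in
    \<open>decay_fun\<close>.\<close>
  have "(e - 1) * (\<Sum>v\<in>F. transition h y v) \<le> (e - 1) * survival y h"
    using 3 e h by (intro mult_left_mono) (auto simp: survival_def max_def)
  then have 4: "e * (\<Sum>v\<in>F. transition h y v) - (\<Sum>v\<in>F. transition h y v) \<le> (e - 1) * survival y h"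
    by (simp add: left_diff_distrib)
  have "(\<Sum>v\<in>F. transition h y v * decay_fun l v) = (\<Sum>v\<in>F. transition h y v) + (\<Sum>v\<in>F. transition h y v * G v)"
    unfolding sum.distrib[symmetric] using F(2)
    by (intro sum.cong refl) (auto simp: decay_fun_def G_def algebra_simps)
  then have "e * (\<Sum>v\<in>F. transition h y v * decay_fun l v) = e * (\<Sum>v\<in>F. transition h y v) + e * (\<Sum>v\<in>F. transition h y v * G v)"
    by (simp only: distrib_left)
  then have "transition h y 0 + e * (\<Sum>v\<in>F. transition h y v * decay_fun l v) \<le> 1 + G y"
    using 1 3 4 unfolding 2 by linarith
  then show ?thesis using y by (simp add: decay_fun_def G_def e_def)
qed

text \<open>The derivative of \<open>decay_fun_step\<close> at \<open>h = 0\<close>. States from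
  \<open>N\<close> on are discarded, hence an inequality.\<close>

lemma decay_fun_supersolution:
  assumes l: "0 \<le> l" and fin: "\<And>y. 1 \<le> y \<Longrightarrow> survival_laplace l y < \<infinity>" and y: "1 \<le> y" "y < N"
  shows "(\<Sum>w<N. Q y w * decay_fun l w) \<le> - l * decay_fun l y"
proof -
  define g where "g = decay_fun l"
  \<comment> \<open>The factor \<open>exp (l * h)\<close> is attached to states other than 0 only: a
    path found in 0 at time \<open>h\<close> was absorbed before, and it contributes at least
    1.\<close>
  define e where "e m v = (if v = 0 then 1 else exp (l * mesh m))" for m v :: nat
  have exp_lim: "(\<lambda>m. exp (l * mesh m)) \<longlonglongrightarrow> exp (l * 0)"
    by (intro tendsto_intros LIMSEQ_inverse_real_of_nat)
  have e: "(\<lambda>m. e m v) \<longlonglongrightarrow> 1" for v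
    using exp_lim by (cases "v = 0") (simp_all add: e_def)
  have "((\<lambda>x. exp (l * x)) has_real_derivative l) (at 0)"
    by (auto intro!: derivative_eq_intros)
  then have "(\<lambda>h. (exp (l * h) - 1) / h) \<midarrow>0\<rightarrow> l" by (simp add: DERIV_def)
  then have d: "(\<lambda>m. (exp (l * mesh m) - 1) / mesh m) \<longlonglongrightarrow> l"
    by (rule filterlim_compose) (rule filterlim_mono[OF mesh_tendsto at_le order_refl], simp)
  have "(\<lambda>m. (\<Sum>w<N. e m w * ((transition (mesh m) y w - of_bool (y = w)) / mesh m) * g w)
      + (exp (l * mesh m) - 1) / mesh m * g y) \<longlonglongrightarrow> (\<Sum>w<N. 1 * Q y w * g w) + l * g y"
    by (intro tendsto_intros e d Q_tendsto)
  moreover have "(\<Sum>w<N. e m w * ((transition (mesh m) y w - of_bool (y = w)) / mesh m) * g w)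
      + (exp (l * mesh m) - 1) / mesh m * g y \<le> 0" for m
  proof -
    have set: "{..<N} = insert 0 {1..<N}" using y by auto
    have "(\<Sum>w<N. e m w * transition (mesh m) y w * g w) =
        transition (mesh m) y 0 + exp (l * mesh m) * (\<Sum>w\<in>{1..<N}. transition (mesh m) y w * g w)"
      unfolding set by (simp add: e_def g_def decay_fun_def sum_distrib_left mult.assoc)
    also have "\<dots> \<le> g y"
      unfolding g_def using l fin y by (intro decay_fun_step) auto
    finally have 1: "(\<Sum>w<N. e m w * transition (mesh m) y w * g w) \<le> g y" .
    have "(\<Sum>w<N. e m w * of_bool (y = w) * g w) = (\<Sum>w<N. if y = w then exp (l * mesh m) * g y else 0)"
      using y by (intro sum.cong refl) (auto simp: e_def)
    also have "\<dots> = exp (l * mesh m) * g y" using y by simp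
    finally have 2: "(\<Sum>w<N. e m w * of_bool (y = w) * g w) = exp (l * mesh m) * g y" .
    have "(\<Sum>w<N. e m w * ((transition (mesh m) y w - of_bool (y = w)) / mesh m) * g w) =
      ((\<Sum>w<N. e m w * transition (mesh m) y w * g w) - (\<Sum>w<N. e m w * of_bool (y = w) * g w)) / mesh m"
      by (simp only: sum_subtractf[symmetric] sum_divide_distrib right_diff_distrib left_diff_distrib
          times_divide_eq_right times_divide_eq_left)
    also have "\<dots> + (exp (l * mesh m) - 1) / mesh m * g y =
      ((\<Sum>w<N. e m w * transition (mesh m) y w * g w) - g y) / mesh m"
      unfolding 2 by (simp only: times_divide_eq_left add_divide_distrib[symmetric] left_diff_distrib mult_1_left) simp
    also have "\<dots> \<le> 0" using 1 by (intro divide_nonpos_pos) auto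
    finally show ?thesis .
  qed
  ultimately have "(\<Sum>w<N. 1 * Q y w * g w) + l * g y \<le> 0"
    by (intro LIMSEQ_le_const2) auto
  then show ?thesis by (simp add: g_def)
qed

text \<open>Keep only the paths that are in \<open>y\<close> at a time \<open>s\<close> where this
  has positive probability.\<close>

lemma survival_laplace_finite:
  assumes l: "0 \<le> l" and x: "1 \<le> x" "survival_laplace l x < \<infinity>"
  shows "survival_laplace l y < \<infinity>"
proof -
  obtain s where s: "0 < s" "0 < transition s x y" using transition_pos[OF x(1)] by blast
  have "ennreal (exp (l * s) * transition s x y) * survival_laplace l y
      \<le> ennreal ((exp (l * s) - 1) * survival x s) + (\<Sum>v\<in>{y}. ennreal (exp (l * s) * transition s x v) * survival_laplace l v)"
    by simp
  also have "\<dots> \<le> survival_laplace l x"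
    using l s by (intro survival_laplace_step) auto
  finally have "ennreal (exp (l * s) * transition s x y) * survival_laplace l y < \<infinity>"
    using x(2) by (rule le_less_trans)
  then show ?thesis using s by (auto simp: ennreal_mult_less_top)
qed

text \<open>The constant \<open>transition s x y\<close> does not depend on \<open>l\<close>; this
  uniformity yields compactness as \<open>l\<close> varies.\<close>

lemma decay_fun_harnack:
  assumes l: "0 \<le> l" and fin: "\<And>y. 1 \<le> y \<Longrightarrow> survival_laplace l y < \<infinity>"
    and s: "0 \<le> s" and xy: "1 \<le> x" "1 \<le> y"
  shows "transition s x y * decay_fun l y \<le> decay_fun l x"
proof -
  have "transition s x y * decay_fun l y \<le> exp (l * s) * (transition s x y * decay_fun l y)"
    using mult_right_mono[of 1 "exp (l * s)" "transition s x y * decay_fun l y"]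
      l s transition_nonneg[of s x y] decay_fun_ge_1[of l y] by simp
  also have "\<dots> \<le> transition s x 0 + exp (l * s) * (\<Sum>v\<in>{y}. transition s x v * decay_fun l v)"
    using transition_nonneg by simp
  also have "\<dots> \<le> decay_fun l x" using xy by (intro decay_fun_step l fin s) auto
  finally show ?thesis .
qed

lemma scale_pos_if_survival_laplace_finite:
  assumes l: "0 \<le> l" and x: "1 \<le> x" "survival_laplace l x < \<infinity>" and z: "0 < z"
  shows "0 < power_series W (- l) 0 z"
proof (rule scale_pos_if_supersolution[OF _ _ _ z, of "decay_fun l"])
  show "0 < decay_fun l y" for y using decay_fun_ge_1[of l y] by simp
  show "0 \<le> decay_fun l 0" using decay_fun_ge_1[of l 0] by simp
  show "(\<Sum>w<N. Q y w * decay_fun l w) \<le> - l * decay_fun l y" if "1 \<le> y" "y < N" for y N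
    using that by (intro decay_fun_supersolution l survival_laplace_finite[OF l x]) auto
qed

text \<open>The moments may blow up along the sequence, so they are divided by their value at 1. The
  Harnack inequality bounds the quotients above, and also below by a positive number; supersolution
  inequalities involve finite sums and survive the limit.\<close>

lemma scale_pos_limit:
  assumes l: "\<And>k. 0 \<le> l k" "\<And>k y. 1 \<le> y \<Longrightarrow> survival_laplace (l k) y < \<infinity>" "l \<longlonglongrightarrow> m" and z: "0 < z"
  shows "0 < power_series W (- m) 0 z"
proof -
  have "\<exists>C. \<forall>k. decay_fun (l k) y / decay_fun (l k) 1 \<le> C" for y
  proof (cases "1 \<le> y")
    case True
    obtain s where s: "0 < s" "0 < transition s 1 y" using transition_pos[of 1 y] by auto
    have "decay_fun (l k) y / decay_fun (l k) 1 \<le> 1 / transition s 1 y" for k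
      using decay_fun_harnack[OF l(1,2), of s 1 y k] True s decay_fun_ge_1[of "l k" 1] by (simp add: field_simps)
    then show ?thesis by blast
  next
    case False
    then have "decay_fun (l k) y / decay_fun (l k) 1 \<le> 1" for k
      using decay_fun_ge_1[of "l k" 1] by (simp add: decay_fun_def[of _ y])
    then show ?thesis by blast
  qed
  then obtain C where C: "\<And>k y. decay_fun (l k) y / decay_fun (l k) 1 \<le> C y" by metis
  have nn: "0 \<le> decay_fun (l k) y / decay_fun (l k) 1" for k y
    using decay_fun_ge_1[of "l k" y] decay_fun_ge_1[of "l k" 1] by (intro divide_nonneg_nonneg) auto
  obtain r :: "nat \<Rightarrow> nat" and g where r: "strict_mono r"
      "\<And>y. (\<lambda>k. decay_fun (l (r k)) y / decay_fun (l (r k)) 1) \<longlonglongrightarrow> g y"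
    using pointwise_convergent_subsequence[of "\<lambda>k y. decay_fun (l k) y / decay_fun (l k) 1" C] C nn by auto
  have lr: "(\<lambda>k. l (r k)) \<longlonglongrightarrow> m" using LIMSEQ_subseq_LIMSEQ[OF l(3) r(1)] by (simp add: o_def)
  show ?thesis
  proof (rule scale_pos_if_supersolution[OF _ _ _ z, of g])
    show "0 < g y" if y: "1 \<le> y" for y
    proof -
      obtain s where s: "0 < s" "0 < transition s y 1" using transition_pos[OF y, of 1] by auto
      have "transition s y 1 \<le> decay_fun (l k) y / decay_fun (l k) 1" for k
        using decay_fun_harnack[OF l(1,2), of s y 1 k] y s decay_fun_ge_1[of "l k" 1] by (simp add: field_simps)
      then have "transition s y 1 \<le> g y" by (intro LIMSEQ_le_const[OF r(2)]) auto
      then show ?thesis using s by simp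
    qed
    show "0 \<le> g 0" using nn by (intro LIMSEQ_le_const[OF r(2)]) auto
    show "(\<Sum>w<N. Q y w * g w) \<le> - m * g y" if y: "1 \<le> y" "y < N" for y N
    proof (rule LIMSEQ_le)
      show "(\<lambda>k. \<Sum>w<N. Q y w * (decay_fun (l (r k)) w / decay_fun (l (r k)) 1)) \<longlonglongrightarrow> (\<Sum>w<N. Q y w * g w)"
        by (intro tendsto_intros r(2))
      show "(\<lambda>k. - l (r k) * (decay_fun (l (r k)) y / decay_fun (l (r k)) 1)) \<longlonglongrightarrow> - m * g y"
        by (intro tendsto_intros r(2) lr)
      have "(\<Sum>w<N. Q y w * (decay_fun (l (r k)) w / decay_fun (l (r k)) 1))
          \<le> - l (r k) * (decay_fun (l (r k)) y / decay_fun (l (r k)) 1)" for k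
      proof -
        have "(\<Sum>w<N. Q y w * (decay_fun (l (r k)) w / decay_fun (l (r k)) 1)) =
            (\<Sum>w<N. Q y w * decay_fun (l (r k)) w) / decay_fun (l (r k)) 1"
          by (simp add: sum_divide_distrib)
        also have "\<dots> \<le> - l (r k) * decay_fun (l (r k)) y / decay_fun (l (r k)) 1"
          using decay_fun_supersolution[OF l(1,2) y, of "r k"] decay_fun_ge_1[of "l (r k)" 1]
          by (intro divide_right_mono) auto
        finally show ?thesis by simp
      qed
      then show "\<exists>n0. \<forall>k\<ge>n0. (\<Sum>w<N. Q y w * (decay_fun (l (r k)) w / decay_fun (l (r k)) 1))
          \<le> - l (r k) * (decay_fun (l (r k)) y / decay_fun (l (r k)) 1)" by blast
    qed
  qed
qed

lemma survival_laplace_finite_if_scale_pos: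
  assumes pos: "\<And>x. 0 < x \<Longrightarrow> 0 < power_series W (- l) 0 x" and l': "0 \<le> l'" "l' < l"
    and hit: "AE w in P 1. hit X {0} w < \<infinity>"
  shows "survival_laplace l' 1 < \<infinity>"
proof -
  \<comment> \<open>The tail bound needs a rate strictly below \<open>l\<close>, integrability
    against \<open>exp (l' * t)\<close> one strictly above \<open>l'\<close>.\<close>
  define k where "k = (l' + l) / 2"
  have k: "0 < k" "k < l" "l' < k" using l' by (auto simp: k_def)
  define d where "d = k - l'"
  have d: "0 < d" using k by (simp add: d_def)
  define c where "c = Q 1 0 / k"
  have c: "0 \<le> c" using Q_nonneg[of 1 0] k by (simp add: c_def)
  have tail: "survival 1 t \<le> c * exp (- (k * t))" if "0 \<le> t" for t
    unfolding c_def
  proof (rule survival_tail[of "power_series W (- l) 0", OF _ _ k(1,2) that hit])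
    show "0 < power_series W (- l) 0 z" if "1 \<le> z" for z using pos[of z] that by simp
    show "(\<Sum>z=1..Suc y. power_series W (- l) 0 z * Q z y) = - l * power_series W (- l) 0 y"
      if "1 \<le> y" for y using scale_left_eigenvector[of "- l" y] that by simp
  qed
  have "survival_laplace l' 1 \<le> (\<integral>\<^sup>+t. ennreal (l' * c * exp (- (d * t))) * indicator {0..} t \<partial>lborel)"
    unfolding survival_laplace_def
  proof (rule nn_integral_mono)
    fix t :: real
    have "l' * exp (l' * t) * survival 1 t \<le> l' * c * exp (- (d * t))" if "0 \<le> t"
    proof -
      have "l' * exp (l' * t) * survival 1 t \<le> l' * exp (l' * t) * (c * exp (- (k * t)))"
        using l' tail[OF that] by (intro mult_left_mono) auto
      also have "\<dots> = l' * c * exp (l' * t + - (k * t))" unfolding exp_add by simp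
      also have "l' * t + - (k * t) = - (d * t)" by (simp add: d_def algebra_simps)
      finally show ?thesis .
    qed
    then show "ennreal (l' * exp (l' * t) * survival 1 t) * indicator {0..} t \<le>
        ennreal (l' * c * exp (- (d * t))) * indicator {0..} t"
      by (cases "0 \<le> t") (auto intro: ennreal_leI)
  qed
  also have "\<dots> = ennreal (0 - (- (l' * c / d) * exp (- (d * 0))))"
  proof (rule nn_integral_FTC_atLeast)
    show "((\<lambda>t. - (l' * c / d) * exp (- (d * t))) has_real_derivative
        l' * c * exp (- (d * t))) (at t)" for t
      using d by (auto intro!: derivative_eq_intros)
    have "((\<lambda>t. - (l' * c / d) * exp (- (d * t))) \<longlongrightarrow> - (l' * c / d) * 0) at_top"
      using d by (intro tendsto_intros filterlim_compose[OF exp_at_bot] filterlim_uminus_at_bot_at_top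
          filterlim_compose[OF filterlim_uminus_at_bot_at_top] filterlim_tendsto_pos_mult_at_top[OF tendsto_const _ filterlim_ident]) auto
    then show "((\<lambda>t. - (l' * c / d) * exp (- (d * t))) \<longlongrightarrow> 0) at_top" by simp
  qed (use l' c in auto)
  also have "\<dots> < \<infinity>" by simp
  finally show ?thesis .
qed

text \<open>In column 1 of the left eigenvector equation the contribution of state 2 is nonnegative.
  The bound, the exit rate of state 1, makes the supremum in the theorem a real number.\<close>

lemma scale_pos_bound:
  assumes "\<And>x. 0 < x \<Longrightarrow> 0 < power_series W (- l) 0 x"
  shows "l \<le> - Q 1 1"
proof -
  have "(\<Sum>z=1..Suc 1. power_series W (- l) 0 z * Q z 1) = - l * power_series W (- l) 0 1"
    using scale_left_eigenvector[of "- l" 1] by simp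
  moreover have "{1..Suc 1} = {1, 2::nat}" by auto
  ultimately have "power_series W (- l) 0 1 * Q 1 1 + power_series W (- l) 0 2 * Q 2 1 = - l * power_series W (- l) 0 1"
    by (simp add: numeral_2_eq_2)
  moreover have "0 \<le> power_series W (- l) 0 2 * Q 2 1"
    using assms[of 2] Q_nonneg[of 2 1] by simp
  ultimately have "power_series W (- l) 0 1 * l \<le> power_series W (- l) 0 1 * (- Q 1 1)"
    by (simp add: algebra_simps)
  then show ?thesis using assms[of 1] by (subst (asm) mult_le_cancel_left_pos) auto
qed

lemma survival_laplace_0: "survival_laplace 0 x = 0"
  by (simp add: survival_laplace_def)

lemma decay_parameter_eq:
  assumes hit: "\<And>x. AE w in P x. hit X {0} w < \<infinity>"
  shows "decay_parameter P X = Sup (ereal ` {l. 0 \<le> l \<and> (\<exists>x\<ge>1. survival_laplace l x < \<infinity>)})"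
proof -
  have "(\<integral>\<^sup>+ w. exp_ereal (ereal l * hit X {0} w) \<partial>P x) < \<infinity> \<longleftrightarrow> survival_laplace l x < \<infinity>"
    if "0 \<le> l" "1 \<le> x" for l x
    using exp_hit_eq[OF that hit] by simp
  then have "{l. 0 \<le> l \<and> (\<exists>x\<ge>1. (\<integral>\<^sup>+ w. exp_ereal (ereal l * hit X {0} w) \<partial>P x) < \<infinity>)} =
    {l. 0 \<le> l \<and> (\<exists>x\<ge>1. survival_laplace l x < \<infinity>)}" by blast
  then show ?thesis unfolding decay_parameter_def by simp
qed

end

theorem theorem1p9:
  fixes M :: "'w measure"
    and P :: "nat \<Rightarrow> 'w measure"
    and X :: "real \<Rightarrow> 'w \<Rightarrow> nat option"
    and Q :: "nat \<Rightarrow> nat \<Rightarrow> real"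
  assumes "downward_skip_free_chain M P X Q"
    and "\<And>x. AE w in P x. hit X {0} w < \<infinity>"
  shows "\<exists>m\<in>{l::real. 0 \<le> l \<and> (\<forall>x>0. 0 < scale_function P X Q (- l) 0 x)}.
           (\<forall>l\<in>{l::real. 0 \<le> l \<and> (\<forall>x>0. 0 < scale_function P X Q (- l) 0 x)}. l \<le> m) \<and>
           decay_parameter P X = ereal m"
proof -
  interpret downward_skip_free_chain M P X Q by fact
  define S where "S = {l::real. 0 \<le> l \<and> (\<forall>x>0. 0 < scale_function P X Q (- l) 0 x)}"
  define T where "T = {l::real. 0 \<le> l \<and> (\<exists>x\<ge>1. survival_laplace l x < \<infinity>)}"
  have S: "l \<in> S \<longleftrightarrow> 0 \<le> l \<and> (\<forall>x>0. 0 < power_series W (- l) 0 x)" for l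
    by (simp add: S_def scale_function_eq_power_series)
  have TS: "T \<subseteq> S"
    using scale_pos_if_survival_laplace_finite by (auto simp: T_def S)
  have ST: "l' \<in> T" if "l \<in> S" "0 \<le> l'" "l' < l" for l l'
    using survival_laplace_finite_if_scale_pos[OF _ that(2,3) assms(2)] that by (auto simp: S T_def)
  have T_fin: "survival_laplace l y < \<infinity>" if "l \<in> T" for l y
    using that survival_laplace_finite by (auto simp: T_def)
  have T0: "0 \<in> T" by (auto simp: T_def survival_laplace_0)
  have "l \<le> - Q 1 1" if "l \<in> T" for l
    using that TS scale_pos_bound by (auto simp: S)
  then have bdd: "bdd_above T" by (rule bdd_aboveI)
  define m where "m = Sup T"
  have m: "l \<le> m" if "l \<in> T" for l unfolding m_def using that bdd by (rule cSup_upper)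
  have m0: "0 \<le> m" using m[OF T0] .
  have below: "l \<in> T" if l: "0 \<le> l" "l < m" for l
  proof -
    obtain l' where "l' \<in> T" "l < l'" using less_cSupD[of T l] T0 l(2) by (auto simp: m_def)
    then show ?thesis using ST TS l(1) by blast
  qed
  have "m \<in> S"
  proof (cases "m = 0")
    case True
    then show ?thesis using T0 TS by blast
  next
    case False
    \<comment> \<open>The moment of order \<open>m\<close> itself may be infinite, so
      \<open>m\<close> is approached by rates strictly below it, where moments are finite.\<close>
    define l where "l k = m - m * mesh k" for k
    have l_T: "l k \<in> T" for k
    proof (rule below)
      have "m * mesh k \<le> m * 1" using m0 by (intro mult_left_mono) (auto simp: field_simps)
      then show "0 \<le> l k" by (simp add: l_def)
      have "0 < m * mesh k" using m0 False by (intro mult_pos_pos) auto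
      then show "l k < m" by (simp add: l_def)
    qed
    have "l \<longlonglongrightarrow> m - m * 0"
      unfolding l_def by (intro tendsto_intros LIMSEQ_inverse_real_of_nat)
    then have "0 < power_series W (- m) 0 x" if "0 < x" for x
      using l_T T_fin that by (intro scale_pos_limit[of l]) (auto simp: T_def)
    then show ?thesis using m0 by (simp add: S)
  qed
  moreover have "l \<le> m" if "l \<in> S" for l
  proof (rule ccontr)
    assume "\<not> l \<le> m"
    then have "(l + m) / 2 \<in> T" using m0 by (intro ST[OF that]) auto
    then show False using m[of "(l + m) / 2"] \<open>\<not> l \<le> m\<close> by simp
  qed
  moreover have "decay_parameter P X = ereal m"
    unfolding decay_parameter_eq[OF assms(2)] T_def[symmetric]
  proof (rule Sup_eqI)
    show "u \<le> ereal m" if "u \<in> ereal ` T" for u using that m by auto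
    show "ereal m \<le> u" if u: "\<And>v. v \<in> ereal ` T \<Longrightarrow> v \<le> u" for u
    proof (cases u)
      case (real r)
      have "v \<le> r" if "v \<in> T" for v using u[of "ereal v"] that real by simp
      then have "m \<le> r" unfolding m_def using T0 by (intro cSup_least) auto
      then show ?thesis using real by simp
    next
      case MInf
      then show ?thesis using u[of "ereal 0"] T0 by auto
    qed simp
  qed
  ultimately show ?thesis unfolding S_def[symmetric] by blast
qed

end
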